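(* Let $D$ be a finite-dimensional graded-division algebra over a field $\mathbb F$ with abelian support, let $\mathbb K=Z(D)$, and let $\varphi_0$ be a fixed degree-preserving involution on $D$. If $(D,\varphi_0)$ is central simple as an algebra with involution, then the graded algebras with involution of the form $\mathcal M(D,\varphi_0,q,s,\underline d,\delta)$, subject to the convention that $\delta=1$ if $\mathbb K\ne\mathbb F$, are classified up to equivalence by $q$, $s$, $\delta$, and the orbit of the multiset $\widetilde\Sigma(\underline d)$ in $X_{\varphi_0}(D,\delta)$ under the action of the group $A^+_{\varphi_0}(D)$.
   Context: All algebras are associative over an arbitrary field $\mathbb F$. A graded-division algebra is a unital graded algebra in which all nonzero homogeneous elements are invertible; $D^\times_{\mathrm{gr}}$ is the group of nonzero homogeneous elements; $\mathrm{Int}(d)(x)=dxd^{-1}$. An involution is an $\mathbb F$-linear antiautomorphism of order at most 2; degree-preserving means each homogeneous component is mapped to itself. $(D,\varphi_0)$ is central simple as an algebra with involution if it has no proper nonzero $\varphi_0$-invariant two-sided ideals and the $\varphi_0$-symmetric elements of $Z(D)$ are exactly $\mathbb F$. An equivalence of graded algebras with involution is an algebra isomorphism commuting with the involutions and mapping each nonzero homogeneous component onto a homogeneous component. "Classified up to equivalence by" means: two of them are equivalent if and only if the listed invariants coincide. Construction of $\mathcal M$. Let $T$ be the support of $D$, $q,s\ge0$ integers not both zero, $\delta\in\{\pm1\}\subset\mathbb F$, $\underline d=(d_1,\dots,d_q)$ with $d_i\in D^\times_{\mathrm{gr}}$, $\varphi_0(d_i)=\delta d_i$, $t_i=\deg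 d_i$, $k=q+2s$. $\widetilde G(T,q,s,\underline t)$ is the quotient of $F\times T$, $F$ free abelian on $\tilde g_1,\dots,\tilde g_k$, by $\tilde g_1^2t_1^{-1}=\dots=\tilde g_q^2t_q^{-1}=\tilde g_{q+1}\tilde g_{q+2}=\dots=\tilde g_{q+2s-1}\tilde g_{q+2s}$. $\mathcal M(D,\varphi_0,q,s,\underline d,\delta)$ is $M_k(D)=M_k(\mathbb F)\otimes D$ graded by $\deg(E_{ij}\otimes d)=\tilde g_i\tilde g_j^{-1}t$ for $0\ne d\in D_t$, with involution $X\mapsto\Phi^{-1}\varphi_0(X^T)\Phi$, $\Phi=\mathrm{diag}\left(d_1,\dots,d_q,\begin{bmatrix}0&1\\ \delta&0\end{bmatrix},\dots,\begin{bmatrix}0&1\\ \delta&0\end{bmatrix}\right)$ ($s$ blocks of size 2). Actions. $D^\times_{\mathrm{gr}}$ acts on the set $D^\times_{\mathrm{gr}}$ by $c*d=cd\varphi_0(c)$; $\mathcal O(d)$ denotes the orbit of $d$ and $X_{\varphi_0}(D,\delta)=\{\mathcal O(d)\mid d\in D^\times_{\mathrm{gr}},\ \varphi_0(d)=\delta d\}$. $\mathrm{Aut}(\Gamma_D)$ is the group of algebra automorphisms of $D$ that permute the homogeneous components; it acts naturally on $D^\times_{\mathrm{gr}}$, and $$A^+_{\varphi_0}(D)=\{(c,\psi_0)\in D^\times_{\mathrm{gr}}\rtimes\mathrm{Aut}(\Gamma_D)\mid \mathrm{Int}(c)\circ\psi_0\varphi_0\psi_0^{-1}=\varphi_0,\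 \varphi_0(c)=c\},$$ which is a subgroup acting on $X_{\varphi_0}(D,\delta)$ by $(c,\psi_0)\cdot\mathcal O(d)=\mathcal O(c\psi_0(d))$. $\widetilde\Sigma(\underline d)$ is the multiset $\{\mathcal O(d_1),\dots,\mathcal O(d_q)\}$ in $X_{\varphi_0}(D,\delta)$, and the group acts on such multisets elementwise. *)

theory Defs
  imports
    "HOL-Algebra.Free_Abelian_Groups"
    "HOL-Algebra.Group_Action"
    "HOL-Algebra.QuotRing"
    "HOL-Library.Multiset"
    "Jordan_Normal_Form.Matrix"
begin

section \<open>Graded-division algebras with involution\<close>

text \<open>
  The algebra is the whole type \<^typ>\<open>'d\<close>, with scalar multiplication \<open>scale\<close>;
  \<open>D t\<close> is the component of degree \<open>t\<close> for \<open>t\<close> in the carrier of the grading group \<open>G\<close>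
  (values of \<open>D\<close> outside the carrier are irrelevant).
\<close>

locale assoc_algebra = vector_space scale
  for scale :: "'f::field \<Rightarrow> 'd::ring_1 \<Rightarrow> 'd" +
  assumes scale_mult_left: "scale a (x * y) = scale a x * y"
    and scale_mult_right: "scale a (x * y) = x * scale a y"

locale graded_algebra = assoc_algebra scale + group G
  for scale :: "'f::field \<Rightarrow> 'd::ring_1 \<Rightarrow> 'd"
    and G :: "('g, 'm) monoid_scheme" (structure)
    and D :: "'g \<Rightarrow> 'd set" +
  assumes component_subspace: "t \<in> carrier G \<Longrightarrow> Modules.module.subspace scale (D t)"
    and direct_sum:
      "\<exists>!f. (\<forall>t \<in> carrier G. f t \<in> D t) \<and> (\<forall>t. t \<notin> carrier G \<longrightarrow> f t = 0)
            \<and> finite {t. f t \<noteq> 0} \<and> x = (\<Sum>t | f t \<noteq> 0. f t)"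
    and component_mult:
      "\<lbrakk>t \<in> carrier G; u \<in> carrier G; x \<in> D t; y \<in> D u\<rbrakk> \<Longrightarrow> x * y \<in> D (t \<otimes> u)"

definition support :: "('g, 'm) monoid_scheme \<Rightarrow> ('g \<Rightarrow> 'd::zero set) \<Rightarrow> 'g set" where
  "support G D = {t \<in> carrier G. D t \<noteq> {0}}"

definition gr_units :: "('g, 'm) monoid_scheme \<Rightarrow> ('g \<Rightarrow> 'd::zero set) \<Rightarrow> 'd set" where
  "gr_units G D = (\<Union>t \<in> carrier G. D t) - {0}"

definition degree_of :: "('g, 'm) monoid_scheme \<Rightarrow> ('g \<Rightarrow> 'd set) \<Rightarrow> 'd \<Rightarrow> 'g" where
  "degree_of G D d = (THE t. t \<in> carrier G \<and> d \<in> D t)"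

text \<open>The ring structure of a type, as a record; used for its units and inverses.\<close>

abbreviation type_ring :: "'d::ring_1 ring" where
  "type_ring \<equiv> \<lparr>carrier = UNIV, monoid.mult = (*), one = 1, zero = 0, add = (+)\<rparr>"

locale graded_division_algebra = graded_algebra scale G D
  for scale :: "'f::field \<Rightarrow> 'd::ring_1 \<Rightarrow> 'd"
    and G :: "('g, 'm) monoid_scheme" (structure)
    and D :: "'g \<Rightarrow> 'd set" +
  assumes homogeneous_invertible: "d \<in> gr_units G D \<Longrightarrow> d \<in> Units type_ring"

definition finite_dimensional :: "('f::field \<Rightarrow> 'd::ring_1 \<Rightarrow> 'd) \<Rightarrow> bool" where
  "finite_dimensional scale \<longleftrightarrow> (\<exists>B. finite B \<and> Modules.module.span scale B = UNIV)"

definition is_involution :: "('f::field \<Rightarrow> 'd::ring_1 \<Rightarrow> 'd) \<Rightarrow> ('d \<Rightarrow> 'd) \<Rightarrow> bool" where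
  "is_involution scale \<phi> \<longleftrightarrow>
     Vector_Spaces.linear scale scale \<phi> \<and> (\<forall>x y. \<phi> (x * y) = \<phi> y * \<phi> x) \<and> (\<forall>x. \<phi> (\<phi> x) = x)"

definition degree_preserving ::
  "('g, 'm) monoid_scheme \<Rightarrow> ('g \<Rightarrow> 'd set) \<Rightarrow> ('d \<Rightarrow> 'd) \<Rightarrow> bool" where
  "degree_preserving G D \<phi> \<longleftrightarrow> (\<forall>t \<in> carrier G. \<phi> ` D t = D t)"

definition center :: "'d::ring_1 set" where
  "center = {z. \<forall>x. z * x = x * z}"

definition scalars :: "('f::field \<Rightarrow> 'd::ring_1 \<Rightarrow> 'd) \<Rightarrow> 'd set" where
  "scalars scale = range (\<lambda>a. scale a 1)"

definition central_simple_inv :: "('f::field \<Rightarrow> 'd::ring_1 \<Rightarrow> 'd) \<Rightarrow> ('d \<Rightarrow> 'd) \<Rightarrow> bool" where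
  "central_simple_inv scale \<phi> \<longleftrightarrow>
     (\<forall>I. ideal I (type_ring :: 'd ring) \<and> \<phi> ` I \<subseteq> I \<longrightarrow> I = {0} \<or> I = UNIV)
     \<and> {z \<in> center. \<phi> z = z} = scalars scale"


section \<open>The graded algebras with involution \<open>\<M>(D, \<phi>\<^sub>0, q, s, d, \<delta>)\<close>\<close>

text \<open>
  The matrix indices and the tuple \<open>ds = (d\<^sub>1, \<dots>, d\<^sub>q)\<close> are numbered from 0.
  The scalar \<open>\<delta>\<close> is an element of the base field.
\<close>

definition M_data ::
  "('f::field \<Rightarrow> 'd::ring_1 \<Rightarrow> 'd) \<Rightarrow> ('g, 'm) monoid_scheme \<Rightarrow> ('g \<Rightarrow> 'd set) \<Rightarrow> ('d \<Rightarrow> 'd)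
   \<Rightarrow> nat \<Rightarrow> nat \<Rightarrow> 'd list \<Rightarrow> 'f \<Rightarrow> bool" where
  "M_data scale G D \<phi> q s ds \<delta> \<longleftrightarrow>
     \<not> (q = 0 \<and> s = 0) \<and> \<delta> \<in> {1, -1} \<and> length ds = q
     \<and> (\<forall>d \<in> set ds. d \<in> gr_units G D \<and> \<phi> d = scale \<delta> d)"

text \<open>
  The group \<open>F \<times> T\<close>. The free abelian group \<open>F\<close> is written additively, so
  \<open>g\<^sub>i g\<^sub>j\<inverse> t\<close> is the pair \<open>(frag_of i - frag_of j, t)\<close>.
\<close>

definition free_times_support ::
  "('g, 'm) monoid_scheme \<Rightarrow> ('g \<Rightarrow> 'd::zero set) \<Rightarrow> nat \<Rightarrow> ((nat \<Rightarrow>\<^sub>0 int) \<times> 'g) monoid" where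
  "free_times_support G D k = free_Abelian_group {..<k} \<times>\<times> (G\<lparr>carrier := support G D\<rparr>)"

text \<open>The elements of \<open>F \<times> T\<close> that become equal to each other in the quotient.\<close>

definition identified ::
  "('g, 'm) monoid_scheme \<Rightarrow> ('g \<Rightarrow> 'd::zero set) \<Rightarrow> nat \<Rightarrow> nat \<Rightarrow> 'd list
   \<Rightarrow> ((nat \<Rightarrow>\<^sub>0 int) \<times> 'g) set" where
  "identified G D q s ds =
     {(frag_of i + frag_of i, inv\<^bsub>G\<^esub> (degree_of G D (ds ! i))) | i. i < q}
     \<union> {(frag_of (q + 2 * j) + frag_of (q + 2 * j + 1), \<one>\<^bsub>G\<^esub>) | j. j < s}"

definition relation_subgroup ::
  "('g, 'm) monoid_scheme \<Rightarrow> ('g \<Rightarrow> 'd::zero set) \<Rightarrow> nat \<Rightarrow> nat \<Rightarrow> 'd list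
   \<Rightarrow> ((nat \<Rightarrow>\<^sub>0 int) \<times> 'g) set" where
  "relation_subgroup G D q s ds =
     (let P = free_times_support G D (q + 2 * s) in
      generate P {x \<otimes>\<^bsub>P\<^esub> inv\<^bsub>P\<^esub> y | x y. x \<in> identified G D q s ds \<and> y \<in> identified G D q s ds})"

definition G_tilde ::
  "('g, 'm) monoid_scheme \<Rightarrow> ('g \<Rightarrow> 'd::zero set) \<Rightarrow> nat \<Rightarrow> nat \<Rightarrow> 'd list
   \<Rightarrow> ((nat \<Rightarrow>\<^sub>0 int) \<times> 'g) set monoid" where
  "G_tilde G D q s ds = free_times_support G D (q + 2 * s) Mod relation_subgroup G D q s ds"

definition entry_degree ::
  "('g, 'm) monoid_scheme \<Rightarrow> ('g \<Rightarrow> 'd::zero set) \<Rightarrow> nat \<Rightarrow> nat \<Rightarrow> 'd list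
   \<Rightarrow> nat \<Rightarrow> nat \<Rightarrow> 'g \<Rightarrow> ((nat \<Rightarrow>\<^sub>0 int) \<times> 'g) set" where
  "entry_degree G D q s ds i j t =
     relation_subgroup G D q s ds #>\<^bsub>free_times_support G D (q + 2 * s)\<^esub> (frag_of i - frag_of j, t)"

text \<open>
  The component of degree \<open>g\<close> is the span of all \<open>E\<^sub>i\<^sub>j \<otimes> d\<close> such that \<open>d\<close> is homogeneous,
  of degree \<open>t\<close> say, and \<open>g\<^sub>i g\<^sub>j\<inverse> t = g\<close>; this span is described entry by entry.
\<close>

definition M_component ::
  "('f::field \<Rightarrow> 'd::ring_1 \<Rightarrow> 'd) \<Rightarrow> ('g, 'm) monoid_scheme \<Rightarrow> ('g \<Rightarrow> 'd set)
   \<Rightarrow> nat \<Rightarrow> nat \<Rightarrow> 'd list \<Rightarrow> ((nat \<Rightarrow>\<^sub>0 int) \<times> 'g) set \<Rightarrow> 'd mat set" where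
  "M_component scale G D q s ds g =
     {X \<in> carrier_mat (q + 2 * s) (q + 2 * s).
        \<forall>i < q + 2 * s. \<forall>j < q + 2 * s.
          X $$ (i, j) \<in> Modules.module.span scale
            (\<Union>t \<in> {t \<in> support G D. entry_degree G D q s ds i j t = g}. D t)}"

definition Phi :: "('f::field \<Rightarrow> 'd::ring_1 \<Rightarrow> 'd) \<Rightarrow> nat \<Rightarrow> 'd list \<Rightarrow> 'f \<Rightarrow> 'd mat" where
  "Phi scale s ds \<delta> =
     diag_block_mat (map (\<lambda>d. mat_of_rows_list 1 [[d]]) ds
                     @ replicate s (mat_of_rows_list 2 [[0, 1], [scale \<delta> 1, 0]]))"

definition M_involution ::
  "('f::field \<Rightarrow> 'd::ring_1 \<Rightarrow> 'd) \<Rightarrow> ('d \<Rightarrow> 'd) \<Rightarrow> nat \<Rightarrow> nat \<Rightarrow> 'd list \<Rightarrow> 'f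
   \<Rightarrow> 'd mat \<Rightarrow> 'd mat" where
  "M_involution scale \<phi> q s ds \<delta> X =
     inv\<^bsub>ring_mat TYPE('d) (q + 2 * s) ()\<^esub> (Phi scale s ds \<delta>)
       * map_mat \<phi> (transpose_mat X) * Phi scale s ds \<delta>"

record ('f, 'a, 'h) graded_inv_algebra = "('f, 'a) module" +
  grading_group :: "'h monoid"
  component :: "'h \<Rightarrow> 'a set"
  involution :: "'a \<Rightarrow> 'a"

definition M_algebra ::
  "('f::field \<Rightarrow> 'd::ring_1 \<Rightarrow> 'd) \<Rightarrow> ('g, 'm) monoid_scheme \<Rightarrow> ('g \<Rightarrow> 'd set) \<Rightarrow> ('d \<Rightarrow> 'd)
   \<Rightarrow> nat \<Rightarrow> nat \<Rightarrow> 'd list \<Rightarrow> 'f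
   \<Rightarrow> ('f, 'd mat, ((nat \<Rightarrow>\<^sub>0 int) \<times> 'g) set) graded_inv_algebra" where
  "M_algebra scale G D \<phi> q s ds \<delta> =
     \<lparr>carrier = carrier_mat (q + 2 * s) (q + 2 * s),
      monoid.mult = (*),
      one = 1\<^sub>m (q + 2 * s),
      zero = 0\<^sub>m (q + 2 * s) (q + 2 * s),
      add = (+),
      smult = (\<lambda>a. map_mat (scale a)),
      grading_group = G_tilde G D q s ds,
      component = M_component scale G D q s ds,
      involution = M_involution scale \<phi> q s ds \<delta>\<rparr>"

definition equivalence ::
  "('f, 'a, 'h) graded_inv_algebra \<Rightarrow> ('f, 'b, 'k) graded_inv_algebra \<Rightarrow> ('a \<Rightarrow> 'b) \<Rightarrow> bool" where
  "equivalence R S \<psi> \<longleftrightarrow>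
     \<psi> \<in> ring_iso R S
     \<and> (\<forall>a. \<forall>x \<in> carrier R. \<psi> (a \<odot>\<^bsub>R\<^esub> x) = a \<odot>\<^bsub>S\<^esub> \<psi> x)
     \<and> (\<forall>x \<in> carrier R. \<psi> (involution R x) = involution S (\<psi> x))
     \<and> (\<forall>g \<in> carrier (grading_group R). component R g \<noteq> {\<zero>\<^bsub>R\<^esub>} \<longrightarrow>
          (\<exists>h \<in> carrier (grading_group S). \<psi> ` component R g = component S h))"

definition equivalent ::
  "('f, 'a, 'h) graded_inv_algebra \<Rightarrow> ('f, 'b, 'k) graded_inv_algebra \<Rightarrow> bool" where
  "equivalent R S \<longleftrightarrow> (\<exists>\<psi>. equivalence R S \<psi>)"


section \<open>The invariants\<close>

definition gr_orbit ::
  "('g, 'm) monoid_scheme \<Rightarrow> ('g \<Rightarrow> 'd::ring_1 set) \<Rightarrow> ('d \<Rightarrow> 'd) \<Rightarrow> 'd \<Rightarrow> 'd set" where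
  "gr_orbit G D \<phi> d = {c * d * \<phi> c | c. c \<in> gr_units G D}"

definition orbit_space ::
  "('f::field \<Rightarrow> 'd::ring_1 \<Rightarrow> 'd) \<Rightarrow> ('g, 'm) monoid_scheme \<Rightarrow> ('g \<Rightarrow> 'd set) \<Rightarrow> ('d \<Rightarrow> 'd)
   \<Rightarrow> 'f \<Rightarrow> 'd set set" where
  "orbit_space scale G D \<phi> \<delta> = {gr_orbit G D \<phi> d | d. d \<in> gr_units G D \<and> \<phi> d = scale \<delta> d}"

definition Sigma_tilde ::
  "('g, 'm) monoid_scheme \<Rightarrow> ('g \<Rightarrow> 'd::ring_1 set) \<Rightarrow> ('d \<Rightarrow> 'd) \<Rightarrow> 'd list
   \<Rightarrow> 'd set multiset" where
  "Sigma_tilde G D \<phi> ds = image_mset (gr_orbit G D \<phi>) (mset ds)"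

definition Int_conj :: "'d::ring_1 \<Rightarrow> 'd \<Rightarrow> 'd" where
  "Int_conj c x = c * x * inv\<^bsub>type_ring\<^esub> c"

definition Aut_grading ::
  "('f::field \<Rightarrow> 'd::ring_1 \<Rightarrow> 'd) \<Rightarrow> ('g, 'm) monoid_scheme \<Rightarrow> ('g \<Rightarrow> 'd set)
   \<Rightarrow> ('d \<Rightarrow> 'd) set" where
  "Aut_grading scale G D =
     {\<psi>. \<psi> \<in> ring_iso type_ring type_ring \<and> Vector_Spaces.linear scale scale \<psi>
         \<and> bij_betw ((`) \<psi>) (D ` support G D) (D ` support G D)}"

definition semidirect ::
  "('f::field \<Rightarrow> 'd::ring_1 \<Rightarrow> 'd) \<Rightarrow> ('g, 'm) monoid_scheme \<Rightarrow> ('g \<Rightarrow> 'd set)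
   \<Rightarrow> ('d \<times> ('d \<Rightarrow> 'd)) monoid" where
  "semidirect scale G D =
     \<lparr>carrier = gr_units G D \<times> Aut_grading scale G D,
      monoid.mult = (\<lambda>(c, \<psi>) (c', \<psi>'). (c * \<psi> c', \<psi> \<circ> \<psi>')),
      one = (1, id)\<rparr>"

definition A_plus ::
  "('f::field \<Rightarrow> 'd::ring_1 \<Rightarrow> 'd) \<Rightarrow> ('g, 'm) monoid_scheme \<Rightarrow> ('g \<Rightarrow> 'd set) \<Rightarrow> ('d \<Rightarrow> 'd)
   \<Rightarrow> ('d \<times> ('d \<Rightarrow> 'd)) monoid" where
  "A_plus scale G D \<phi> =
     (semidirect scale G D)
       \<lparr>carrier := {(c, \<psi>) \<in> carrier (semidirect scale G D).
                      Int_conj c \<circ> (\<psi> \<circ> \<phi> \<circ> inv_into UNIV \<psi>) = \<phi> \<and> \<phi> c = c}\<rparr>"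

text \<open>
  The action \<open>(c, \<psi>) \<cdot> \<O>(d) = \<O>(c \<psi>(d))\<close>, defined without choosing a representative;
  see \<open>orbit_action_gr_orbit\<close> below.
\<close>

definition orbit_action ::
  "('g, 'm) monoid_scheme \<Rightarrow> ('g \<Rightarrow> 'd::ring_1 set) \<Rightarrow> ('d \<Rightarrow> 'd)
   \<Rightarrow> 'd \<times> ('d \<Rightarrow> 'd) \<Rightarrow> 'd set \<Rightarrow> 'd set" where
  "orbit_action G D \<phi> = (\<lambda>(c, \<psi>) Y. \<Union>d \<in> Y. gr_orbit G D \<phi> (c * \<psi> d))"

definition Sigma_orbit ::
  "('f::field \<Rightarrow> 'd::ring_1 \<Rightarrow> 'd) \<Rightarrow> ('g, 'm) monoid_scheme \<Rightarrow> ('g \<Rightarrow> 'd set) \<Rightarrow> ('d \<Rightarrow> 'd)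
   \<Rightarrow> 'd list \<Rightarrow> 'd set multiset set" where
  "Sigma_orbit scale G D \<phi> ds =
     orbit (A_plus scale G D \<phi>) (\<lambda>p. image_mset (orbit_action G D \<phi> p)) (Sigma_tilde G D \<phi> ds)"


section \<open>The action on orbits is well defined\<close>

context graded_algebra begin

lemma zero_in: "t \<in> carrier G \<Longrightarrow> 0 \<in> D t"
  using component_subspace subspace_0 by blast

lemma sum_in: "t \<in> carrier G \<Longrightarrow> (\<And>u. u \<in> A \<Longrightarrow> f u \<in> D t) \<Longrightarrow> sum f A \<in> D t"
  using component_subspace subspace_sum by blast

lemma decomp_unique:
  assumes A: "finite A" "A \<subseteq> carrier G" and f: "\<And>t. t \<in> A \<Longrightarrow> f t \<in> D t"
    and v: "v \<in> carrier G" and x: "(\<Sum>t\<in>A. f t) \<in> D v" and u: "u \<in> A" "u \<noteq> v"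
  shows "f u = 0"
proof -
  let ?x = "\<Sum>t\<in>A. f t"
  let ?P = "\<lambda>g. (\<forall>t \<in> carrier G. g t \<in> D t) \<and> (\<forall>t. t \<notin> carrier G \<longrightarrow> g t = 0)
            \<and> finite {t. g t \<noteq> 0} \<and> ?x = (\<Sum>t | g t \<noteq> 0. g t)"
  define g where "g t = (if t \<in> A then f t else 0)" for t
  define h where "h t = (if t = v then ?x else 0)" for t
  have sub: "{t. g t \<noteq> 0} \<subseteq> A" "{t. h t \<noteq> 0} \<subseteq> {v}" by (auto simp: g_def h_def)
  have "(\<Sum>t | g t \<noteq> 0. g t) = (\<Sum>t\<in>A. g t)"
    by (rule sum.mono_neutral_left) (use A sub in auto)
  also have "\<dots> = ?x" by (simp add: g_def)
  finally have "?P g" using f A zero_in finite_subset[OF sub(1) A(1)] by (auto simp: g_def)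
  moreover have "(\<Sum>t | h t \<noteq> 0. h t) = (\<Sum>t\<in>{v}. h t)"
    by (rule sum.mono_neutral_left) (use sub in auto)
  then have "?P h" using x v zero_in finite_subset[OF sub(2)] by (auto simp: h_def)
  ultimately have "g = h" using direct_sum[of ?x] by blast
  then show ?thesis using u by (metis g_def h_def)
qed

lemma obtain_decomp:
  obtains A f where "finite A" "A \<subseteq> carrier G" "\<And>t. t \<in> carrier G \<Longrightarrow> f t \<in> D t" "x = (\<Sum>t\<in>A. f t)"
    "\<And>t. t \<notin> A \<Longrightarrow> f t = 0"
proof -
  from direct_sum[of x] obtain f where f: "\<forall>t \<in> carrier G. f t \<in> D t" "\<forall>t. t \<notin> carrier G \<longrightarrow> f t = 0"
     "finite {t. f t \<noteq> 0}" "x = (\<Sum>t | f t \<noteq> 0. f t)" by blast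
  show ?thesis by (rule that[of "{t. f t \<noteq> 0}" f]) (use f in auto)
qed

lemma mult_component:
  assumes x: "x \<in> D t" "t \<in> carrier G" and A: "finite A" "A \<subseteq> carrier G" "\<And>u. u \<in> A \<Longrightarrow> f u \<in> D u"
    and xy: "x * (\<Sum>u\<in>A. f u) \<in> D v" "v \<in> carrier G" and u: "u \<in> A" "t \<otimes> u \<noteq> v"
  shows "x * f u = 0"
proof -
  let ?m = "\<lambda>w. inv t \<otimes> w"
  have inj: "inj_on (\<lambda>u. t \<otimes> u) A" using A x by (auto simp: inj_on_def subset_iff)
  have undo: "inv t \<otimes> (t \<otimes> u) = u" if "u \<in> A" for u
    using that A x by (metis inv_closed l_inv l_one m_assoc subsetD)
  have "(\<Sum>w \<in> (\<lambda>u. t \<otimes> u) ` A. x * f (?m w)) = (\<Sum>u\<in>A. x * f u)"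
    by (subst sum.reindex[OF inj]) (auto simp: undo intro!: sum.cong)
  also have "\<dots> = x * (\<Sum>u\<in>A. f u)" by (simp add: sum_distrib_left)
  finally have e: "(\<Sum>w\<in>(\<lambda>u. t \<otimes> u) ` A. x * f (?m w)) \<in> D v" using xy by simp
  have "x * f (?m (t \<otimes> u)) = 0"
    by (rule decomp_unique[OF _ _ _ xy(2) e])
      (use A x u in \<open>auto simp: undo intro!: component_mult\<close>)
  then show ?thesis using undo[OF u(1)] by simp
qed

lemma one_homogeneous: "1 \<in> D \<one>"
proof -
  obtain A e where A: "finite A" "A \<subseteq> carrier G" "\<And>t. t \<in> carrier G \<Longrightarrow> e t \<in> D t"
    and one: "1 = (\<Sum>t\<in>A. e t)" "\<And>t. t \<notin> A \<Longrightarrow> e t = 0" using obtain_decomp[of 1] by metis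
  have z: "x * e u = 0" if "x \<in> D t" "t \<in> carrier G" "u \<in> A" "u \<noteq> \<one>" for x t u
  proof -
    have "x * (\<Sum>t\<in>A. e t) \<in> D t" using that by (simp flip: one)
    then show ?thesis using that A by (intro mult_component[of x t A e t u]) (auto simp: subset_iff)
  qed
  have "e u = 0" if "u \<in> A" "u \<noteq> \<one>" for u
  proof -
    have "e u = (\<Sum>t\<in>A. e t) * e u" by (simp flip: one)
    also have "\<dots> = 0" unfolding sum_distrib_right using z[OF A(3)] that A(2) by (intro sum.neutral) (auto simp: subset_iff)
    finally show ?thesis .
  qed
  then have "(\<Sum>t\<in>A. e t) \<in> D \<one>"
    using A by (intro sum_in) (auto simp: zero_in, metis one_closed zero_in A(3))
  then show ?thesis by (simp flip: one)
qed

end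

context graded_division_algebra begin

lemma gr_units_inverse:
  assumes c: "c \<in> gr_units G D"
  obtains c' where "c' \<in> gr_units G D" "c * c' = 1" "c' * c = 1" "inv\<^bsub>type_ring\<^esub> c = c'"
proof -
  from homogeneous_invertible[OF c] obtain y where y: "c * y = 1" "y * c = 1"
    by (auto simp: Units_def)
  from c obtain t where t: "t \<in> carrier G" "c \<in> D t" by (auto simp: gr_units_def)
  obtain A f where A: "finite A" "A \<subseteq> carrier G" "\<And>t. t \<in> carrier G \<Longrightarrow> f t \<in> D t"
    and f: "y = (\<Sum>t\<in>A. f t)" "\<And>t. t \<notin> A \<Longrightarrow> f t = 0" using obtain_decomp[of y] by metis
  have "f u = 0" if "u \<in> A" "u \<noteq> inv t" for u
  proof -
    have u: "t \<otimes> u \<noteq> \<one>" using that A t by (metis inv_equality inv_inv subsetD)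
    have "c * f u = 0"
      by (rule mult_component[OF t(2) t(1) A(1,2) _ _ one_closed that(1) u])
        (use A one_homogeneous y in \<open>auto simp flip: f(1)\<close>)
    then have "y * c * f u = 0" by (simp add: mult.assoc)
    then show ?thesis by (simp add: y)
  qed
  then have "(\<Sum>t\<in>A. f t) \<in> D (inv t)"
    using A t by (intro sum_in) (auto, metis inv_closed zero_in A(3))
  then have "y \<in> gr_units G D" using t y by (auto simp: gr_units_def simp flip: f(1))
  moreover have "inv\<^bsub>type_ring\<^esub> c = y"
    unfolding m_inv_def using y by (auto intro!: the_equality) (metis mult.assoc mult.left_neutral mult.right_neutral)
  ultimately show ?thesis using that y by blast
qed

lemma gr_units_mult:
  assumes "a \<in> gr_units G D" "b \<in> gr_units G D" shows "a * b \<in> gr_units G D"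
proof -
  obtain a' where "a' * a = 1" by (metis gr_units_inverse assms(1))
  then have "a * b = 0 \<Longrightarrow> b = 0" by (metis mult.assoc mult.left_neutral mult_zero_right)
  then show ?thesis using assms component_mult by (fastforce simp: gr_units_def)
qed

lemma gr_orbit_eqI:
  assumes \<phi>: "is_involution scale \<phi>" and x: "x \<in> gr_orbit G D \<phi> d"
  shows "gr_orbit G D \<phi> x = gr_orbit G D \<phi> d"
proof -
  have anti: "\<phi> (a * b) = \<phi> b * \<phi> a" for a b using \<phi> by (simp add: is_involution_def)
  have one: "\<phi> 1 = 1" using \<phi> by (metis is_involution_def mult.left_neutral mult.right_neutral)
  obtain c where c: "c \<in> gr_units G D" "x = c * d * \<phi> c" using x by (auto simp: gr_orbit_def)
  obtain c' where c': "c' \<in> gr_units G D" "c' * c = 1" by (metis gr_units_inverse c(1))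
  have "d = c' * x * \<phi> c'"
  proof -
    have "c' * x * \<phi> c' = (c' * c) * d * \<phi> (c' * c)" by (simp add: c anti mult.assoc)
    then show ?thesis by (simp add: c' one)
  qed
  moreover have sub: "gr_orbit G D \<phi> (c * d * \<phi> c) \<subseteq> gr_orbit G D \<phi> d" if "c \<in> gr_units G D" for c d
  proof
    fix y assume "y \<in> gr_orbit G D \<phi> (c * d * \<phi> c)"
    then obtain b where b: "b \<in> gr_units G D" "y = b * (c * d * \<phi> c) * \<phi> b" by (auto simp: gr_orbit_def)
    then have "y = (b * c) * d * \<phi> (b * c)" by (simp add: anti mult.assoc)
    then show "y \<in> gr_orbit G D \<phi> d" using gr_units_mult[OF b(1) that] by (auto simp: gr_orbit_def)
  qed
  ultimately show ?thesis using c c' by (metis subset_antisym)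
qed

lemma Aut_gr:
  assumes \<psi>: "\<psi> \<in> ring_iso type_ring type_ring"
    "bij_betw ((`) \<psi>) (D ` support G D) (D ` support G D)" and a: "a \<in> gr_units G D"
  shows "\<psi> a \<in> gr_units G D"
proof -
  have mult: "\<psi> (a * b) = \<psi> a * \<psi> b" and one: "\<psi> 1 = 1" for a b
    using \<psi> by (auto simp: ring_iso_def Ring.ring_hom_def)
  from a obtain t where t: "t \<in> support G D" "a \<in> D t" by (auto simp: gr_units_def support_def)
  then have "\<psi> ` D t \<in> D ` support G D" using bij_betwE[OF \<psi>(2)] by blast
  then obtain u where u: "u \<in> support G D" "\<psi> ` D t = D u" by auto
  obtain a' where "a * a' = 1" by (metis gr_units_inverse a)
  then have "\<psi> a * \<psi> a' = 1" by (metis mult one)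
  then have "\<psi> a \<noteq> 0" by auto
  then show ?thesis using t u by (auto simp: gr_units_def support_def)
qed

lemma orbit_action_gr_orbit:
  assumes \<phi>: "is_involution scale \<phi>" and p: "(c, \<psi>) \<in> carrier (A_plus scale G D \<phi>)"
  shows "orbit_action G D \<phi> (c, \<psi>) (gr_orbit G D \<phi> d) = gr_orbit G D \<phi> (c * \<psi> d)"
proof -
  have c: "c \<in> gr_units G D" and \<psi>: "\<psi> \<in> ring_iso type_ring type_ring"
    "bij_betw ((`) \<psi>) (D ` support G D) (D ` support G D)" and
    I: "Int_conj c \<circ> (\<psi> \<circ> \<phi> \<circ> inv_into UNIV \<psi>) = \<phi>" and fc: "\<phi> c = c"
    using p by (auto simp: A_plus_def semidirect_def Aut_grading_def)
  have mult: "\<psi> (a * b) = \<psi> a * \<psi> b" and one: "\<psi> 1 = 1" and bij: "bij \<psi>" for a b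
    using \<psi> by (auto simp: ring_iso_def Ring.ring_hom_def)
  have anti: "\<phi> (a * b) = \<phi> b * \<phi> a" for a b using \<phi> by (simp add: is_involution_def)
  obtain c' where c': "c' \<in> gr_units G D" "c * c' = 1" "c' * c = 1" "inv\<^bsub>type_ring\<^esub> c = c'"
    by (metis gr_units_inverse c)
  have \<phi>1: "\<phi> 1 = 1" using \<phi> by (metis is_involution_def mult.left_neutral mult.right_neutral)
  have \<phi>c': "\<phi> c' = c'" by (metis c'(2,3) anti fc \<phi>1 mult.assoc mult.left_neutral mult.right_neutral)
  have tw: "\<phi> (\<psi> a) = c * \<psi> (\<phi> a) * c'" for a
    using fun_cong[OF I, of "\<psi> a"] bij by (simp add: Int_conj_def c' bij_is_inj)
  note gr = Aut_gr[OF \<psi>]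
  have eq: "gr_orbit G D \<phi> (c * \<psi> x) = gr_orbit G D \<phi> (c * \<psi> d)" if x: "x \<in> gr_orbit G D \<phi> d" for x
  proof (rule gr_orbit_eqI[OF \<phi>])
    obtain a where a: "a \<in> gr_units G D" "x = a * d * \<phi> a" using x by (auto simp: gr_orbit_def)
    let ?b = "c * \<psi> a * c'"
    have "?b * (c * \<psi> d) * \<phi> ?b = c * \<psi> a * (c' * c) * \<psi> d * (c' * c) * \<psi> (\<phi> a) * (c' * c)"
      by (simp add: anti tw fc \<phi>c' mult.assoc)
    also have "\<dots> = c * \<psi> x" by (simp add: c' a mult mult.assoc)
    finally have "c * \<psi> x = ?b * (c * \<psi> d) * \<phi> ?b" ..
    then show "c * \<psi> x \<in> gr_orbit G D \<phi> (c * \<psi> d)"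
      using gr_units_mult[OF gr_units_mult[OF c gr[OF a(1)]] c'(1)] by (auto simp: gr_orbit_def)
  qed
  have "1 \<in> gr_units G D" using one_homogeneous by (auto simp: gr_units_def)
  then have "d \<in> gr_orbit G D \<phi> d" using \<phi>1 by (force simp: gr_orbit_def)
  moreover have "orbit_action G D \<phi> (c, \<psi>) (gr_orbit G D \<phi> d)
      = (\<Union>x \<in> gr_orbit G D \<phi> d. gr_orbit G D \<phi> (c * \<psi> d))"
    unfolding orbit_action_def prod.case by (rule SUP_cong[OF refl eq])
  ultimately show ?thesis by (metis SUP_const empty_iff)
qed

lemma orbit_action_orbit_space:
  assumes \<phi>: "is_involution scale \<phi>" and p: "p \<in> carrier (A_plus scale G D \<phi>)"
    and Y: "Y \<in> orbit_space scale G D \<phi> \<delta>"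
  shows "orbit_action G D \<phi> p Y \<in> orbit_space scale G D \<phi> \<delta>"
proof -
  obtain c \<psi> where cp: "p = (c, \<psi>)" by (cases p)
  have c: "c \<in> gr_units G D" and \<psi>: "\<psi> \<in> ring_iso type_ring type_ring"
    "bij_betw ((`) \<psi>) (D ` support G D) (D ` support G D)" and
    lin: "Vector_Spaces.linear scale scale \<psi>" and
    I: "Int_conj c \<circ> (\<psi> \<circ> \<phi> \<circ> inv_into UNIV \<psi>) = \<phi>" and fc: "\<phi> c = c"
    using p by (auto simp: cp A_plus_def semidirect_def Aut_grading_def)
  obtain d where d: "d \<in> gr_units G D" "\<phi> d = scale \<delta> d" "Y = gr_orbit G D \<phi> d"
    using Y by (auto simp: orbit_space_def)
  obtain c' where c': "c' * c = 1" "inv\<^bsub>type_ring\<^esub> c = c'"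
    by (metis gr_units_inverse c)
  have "\<phi> (\<psi> d) = c * \<psi> (\<phi> d) * c'"
    using fun_cong[OF I, of "\<psi> d"] \<psi>(1) by (simp add: Int_conj_def c' bij_is_inj ring_iso_def)
  then have "\<phi> (c * \<psi> d) = c * \<psi> (scale \<delta> d)"
    using \<phi> c' by (simp add: is_involution_def fc d mult.assoc)
  also have "\<dots> = scale \<delta> (c * \<psi> d)"
    using module_hom.scale[of scale scale \<psi>] lin by (simp add: Vector_Spaces.linear_def module_hom_iff scale_mult_right)
  finally have "\<phi> (c * \<psi> d) = scale \<delta> (c * \<psi> d)" .
  moreover have "c * \<psi> d \<in> gr_units G D" by (intro gr_units_mult c Aut_gr[OF \<psi> d(1)])
  ultimately show ?thesis using orbit_action_gr_orbit[OF \<phi> p[unfolded cp]] d(3)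
    by (auto simp: cp orbit_space_def)
qed

end

lemma Sigma_tilde_in_orbit_space:
  assumes "M_data scale G D \<phi> q s ds \<delta>"
  shows "set_mset (Sigma_tilde G D \<phi> ds) \<subseteq> orbit_space scale G D \<phi> \<delta>"
  using assms by (auto simp: M_data_def Sigma_tilde_def orbit_space_def)

end

theory Submission
  imports Defs "HOL-Combinatorics.Permutations"
begin

text \<open>
  The identity component of \<open>\<M>(D, \<phi>\<^sub>0, q, s, d, \<delta>)\<close> consists of the diagonal matrices over the division
  algebra \<open>D\<^sub>e\<close>, so an equivalence permutes the diagonal matrix units. The involution fixes the first
  \<open>q\<close> of them and swaps the others in pairs, which recovers \<open>q\<close> and \<open>s\<close>. An equivalence has the form
  \<open>E\<^sub>i\<^sub>j \<otimes> d \<mapsto> E\<^bsub>\<pi> i, \<pi> j\<^esub> \<otimes> c\<^sub>i \<psi>\<^sub>0(d) c\<^sub>j\<inverse>\<close>, and commuting with the involutions means that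
  \<open>u = \<phi>\<^sub>0(c\<^sub>j) \<beta>'\<^bsub>\<pi> j\<^esub> c\<^bsub>\<sigma> j\<^esub> \<psi>\<^sub>0(\<beta>\<^sub>j)\<inverse>\<close> does not depend on \<open>j\<close> and that \<open>\<phi>\<^sub>0 \<psi>\<^sub>0 = Int(u) \<psi>\<^sub>0 \<phi>\<^sub>0\<close>, where
  \<open>\<beta>\<^sub>j\<close> is the only nonzero entry in row \<open>j\<close> of \<open>\<Phi>\<close> and \<open>\<sigma> j\<close> its column. It follows that
  \<open>\<phi>\<^sub>0(u) = \<delta> \<delta>' u\<close>. If \<open>Z(D)\<close> is the base field, then \<open>\<psi>\<^sub>0\<close> is inner by the Skolem-Noether theorem,
  which forces \<open>\<phi>\<^sub>0(u) = u\<close>; hence \<open>\<delta> = \<delta>'\<close> and \<open>(u, \<psi>\<^sub>0)\<close> lies in \<open>A\<^sup>+\<close> and moves one multiset to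
  the other. Conversely, an element of \<open>A\<^sup>+\<close> doing this provides the \<open>c\<^sub>i\<close> and \<open>\<pi>\<close> of an equivalence.
\<close>

section \<open>The Skolem-Noether theorem\<close>

text \<open>An equivalence is only required to send components onto components; no homomorphism of
  the universal groups comes with it. In one direction everything is therefore read off from the
  component of the identity matrix and from single matrix units. This needs control of the
  relations: an element of the relation subgroup has even exponents at the generators below
  \<open>q\<close>, equal exponents within each pair, and is trivial if its free part is. In the
  other direction the constructed map must hit whole components, so equality of degrees has to
  transfer both ways. An injective endomorphism of \<open>F x T\<close> carrying one relation
  subgroup onto the other achieves this; it shifts the elements to be identified by one common
  factor, the degree of \<open>u\<close>, which disappears in their quotients. In the central case,
  simplicity of \<open>D\<close> must still be deduced from simplicity of the pair, which by itself
  would allow two ideals exchanged by the involution.\<close>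

lemma ideal_type_ringI:
  fixes I :: "'d::ring_1 set"
  assumes "0 \<in> I" and "\<And>x y. x \<in> I \<Longrightarrow> y \<in> I \<Longrightarrow> x + y \<in> I"
    and "\<And>a x. x \<in> I \<Longrightarrow> a * x \<in> I" and "\<And>a x. x \<in> I \<Longrightarrow> x * a \<in> I"
  shows "ideal I (type_ring :: 'd ring)"
proof (rule idealI)
  show "ring (type_ring :: 'd ring)"
    by unfold_locales (auto simp: Units_def algebra_simps intro: exI[of _ "- _"] add.right_inverse)
next
  have inv: "inv\<^bsub>add_monoid (type_ring :: 'd ring)\<^esub> x = - x" for x :: 'd
    unfolding m_inv_def by (rule the_equality) (auto simp: eq_neg_iff_add_eq_0)
  have "- x \<in> I" if "x \<in> I" for x using assms(3)[OF that, of "-1"] by simp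
  then show "subgroup I (add_monoid (type_ring :: 'd ring))"
    by (intro subgroup.intro) (simp_all add: assms(1,2) inv[simplified])
qed (use assms in auto)

definition simple_ring :: "'d::ring_1 itself \<Rightarrow> bool" where
  "simple_ring _ \<longleftrightarrow> (\<forall>I. ideal I (type_ring :: 'd ring) \<longrightarrow> I = {0} \<or> I = UNIV)"

text \<open>A list of pairs stands for an element of the enveloping algebra, acting on the
  bimodule whose left action is twisted by \<open>\<psi>\<close>.\<close>

definition env_act :: "('d::ring_1 \<Rightarrow> 'd) \<Rightarrow> ('d \<times> 'd) list \<Rightarrow> 'd \<Rightarrow> 'd" where
  "env_act \<psi> ps x = (\<Sum>(u, v)\<leftarrow>ps. \<psi> u * x * v)"

lemma env_act_simps [simp]:
  "env_act \<psi> [] x = 0"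
  "env_act \<psi> ((u, v) # ps) x = \<psi> u * x * v + env_act \<psi> ps x"
  "env_act \<psi> (ps @ qs) x = env_act \<psi> ps x + env_act \<psi> qs x"
  by (simp_all add: env_act_def)

lemma env_act_scaled:
  assumes "\<And>x y. \<psi> (x * y) = \<psi> x * \<psi> y"
  shows "env_act \<psi> (map (\<lambda>(u, v). (a * u, v * b)) ps) x = \<psi> a * env_act \<psi> ps x * b"
  by (induction ps) (auto simp: assms algebra_simps)

lemma env_act_add: "env_act \<psi> ps (x + y) = env_act \<psi> ps x + env_act \<psi> ps y"
  by (induction ps) (auto simp: algebra_simps)

lemma env_act_zero [simp]: "env_act \<psi> ps 0 = 0"
  by (induction ps) auto

text \<open>The enveloping algebra acts on all left coefficients of a relation at once: left factors
  come out of the sum, and right factors are absorbed into \<open>x\<close>.\<close>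

lemma env_act_mult_sum:
  assumes "\<And>x. (\<Sum>i\<in>I. a i * x * b i) = 0"
  shows "(\<Sum>i\<in>I. env_act id ps (a i) * x * b i) = 0"
proof (induction ps)
  case (Cons p ps)
  have "(\<Sum>i\<in>I. fst p * a i * snd p * x * b i) = fst p * (\<Sum>i\<in>I. a i * (snd p * x) * b i)"
    by (simp add: sum_distrib_left mult.assoc)
  also have "\<dots> = 0" by (simp add: assms)
  finally show ?case using Cons by (cases p) (simp add: distrib_right sum.distrib)
qed auto

text \<open>The elements annihilating \<open>X\<close> form a left ideal of the enveloping algebra,
  so their values at \<open>y\<close> form a sub-bimodule of the ring, which is a two-sided ideal.
  For empty \<open>X\<close> it is the ideal generated by \<open>y\<close>.\<close>

lemma env_act_orbit_ideal:
  fixes X y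
  defines "J \<equiv> {env_act id ps y | ps. \<forall>x \<in> X. env_act id ps x = 0}"
  shows "ideal J type_ring"
proof (rule ideal_type_ringI)
  show "0 \<in> J" unfolding J_def by (rule CollectI, rule exI[of _ "[]"]) auto
next
  fix x z assume "x \<in> J" "z \<in> J"
  then obtain ps qs where "x = env_act id ps y" "\<forall>x \<in> X. env_act id ps x = 0"
    "z = env_act id qs y" "\<forall>x \<in> X. env_act id qs x = 0" by (auto simp: J_def)
  then show "x + z \<in> J" unfolding J_def by (intro CollectI exI[of _ "ps @ qs"]) auto
next
  fix a x assume "x \<in> J"
  then obtain ps where p: "x = env_act id ps y" "\<forall>x \<in> X. env_act id ps x = 0"
    by (auto simp: J_def)
  from p show "a * x \<in> J" unfolding J_def
    by (intro CollectI exI[of _ "map (\<lambda>(u, v). (a * u, v * 1)) ps"])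
      (simp only: env_act_scaled id_apply, simp)
  from p show "x * a \<in> J" unfolding J_def
    by (intro CollectI exI[of _ "map (\<lambda>(u, v). (1 * u, v * a)) ps"])
      (simp only: env_act_scaled id_apply, simp)
qed

lemma simple_ring_env_act:
  fixes a :: "'d::ring_1"
  assumes "simple_ring TYPE('d)" "a \<noteq> 0"
  obtains ps where "env_act id ps a = 1"
proof -
  let ?J = "{env_act id ps a | ps. \<forall>x \<in> {}. env_act id ps x = 0}"
  have "ideal ?J type_ring" by (rule env_act_orbit_ideal)
  moreover have "a \<in> ?J" by (rule CollectI, rule exI[of _ "[(1, 1)]"]) auto
  ultimately have "?J = UNIV" using assms by (auto simp: simple_ring_def)
  then have "1 \<in> ?J" by blast
  then show ?thesis using that by (smt (verit, best) mem_Collect_eq)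
qed

context assoc_algebra
begin

lemma scale_one_mult: "scale a 1 * x = scale a x" "x * scale a 1 = scale a x"
  using scale_mult_left[of a 1 x] scale_mult_right[of a x 1] by simp_all

text \<open>Shortest-relation argument. Simplicity normalises one coefficient to 1. If all
  coefficients are then central, they are scalars, and \<open>x = 1\<close> gives the dependence;
  otherwise a commutator yields a shorter nontrivial relation.\<close>

lemma central_simple_dependent:
  fixes a b :: "'i \<Rightarrow> 'd"
  assumes "simple_ring TYPE('d)" and "center = scalars scale"
  shows "finite I \<Longrightarrow> (\<And>x. (\<Sum>i\<in>I. a i * x * b i) = 0) \<Longrightarrow> j \<in> I \<Longrightarrow> a j \<noteq> 0
    \<Longrightarrow> \<exists>l. (\<exists>i\<in>I. l i \<noteq> 0) \<and> (\<Sum>i\<in>I. scale (l i) (b i)) = 0"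
proof (induction "card I" arbitrary: I a j rule: less_induct)
  case less
  obtain ps where ps: "env_act id ps (a j) = 1"
    using simple_ring_env_act[OF assms(1) \<open>a j \<noteq> 0\<close>] .
  define a' where "a' i = env_act id ps (a i)" for i
  have rel: "(\<Sum>i\<in>I. a' i * x * b i) = 0" for x
    unfolding a'_def by (rule env_act_mult_sum) (rule less.prems(2))
  show ?case
  proof (cases "\<forall>i\<in>I. a' i \<in> center")
    case True
    then have "\<forall>i\<in>I. \<exists>l. a' i = scale l 1" using assms(2) by (auto simp: scalars_def)
    then obtain l where l: "\<And>i. i \<in> I \<Longrightarrow> a' i = scale (l i) 1" by metis
    have "scale (l j) 1 = 1" using l[OF less.prems(3)] ps by (simp add: a'_def)
    then have "l j \<noteq> 0" by auto
    moreover have "(\<Sum>i\<in>I. scale (l i) (b i)) = 0"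
      using rel[of 1] l by (simp add: scale_one_mult)
    ultimately show ?thesis using less.prems(3) by blast
  next
    case False
    then obtain i c where i: "i \<in> I" "a' i * c \<noteq> c * a' i" by (auto simp: center_def)
    define a'' where "a'' i = a' i * c - c * a' i" for i
    have a''j: "a'' j = 0" using ps by (simp add: a''_def a'_def)
    \<comment> \<open>The relation at \<open>c * x\<close> minus \<open>c\<close> times the relation
      at \<open>x\<close>; the term at \<open>j\<close> drops out because its coefficient is
      1.\<close>
    have "(\<Sum>i\<in>I. a'' i * x * b i) = (\<Sum>i\<in>I. a' i * (c * x) * b i) - c * (\<Sum>i\<in>I. a' i * x * b i)" for x
      by (simp add: a''_def sum_subtractf sum_distrib_left algebra_simps)
    then have "(\<Sum>i\<in>I. a'' i * x * b i) = 0" for x by (simp add: rel)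
    then have rel'': "(\<Sum>i\<in>I - {j}. a'' i * x * b i) = 0" for x
      using less.prems(1,3) a''j by (simp add: sum.remove[of I j])
    have "i \<in> I - {j}" "a'' i \<noteq> 0" using i a''j by (auto simp: a''_def)
    then obtain l where l: "\<exists>i\<in>I - {j}. l i \<noteq> 0" "(\<Sum>i\<in>I - {j}. scale (l i) (b i)) = 0"
      using less.hyps[of "I - {j}" a'' i] less.prems(1,3) rel'' card_Diff1_less[of I j] by auto
    have "(\<Sum>i\<in>I. scale ((l(j := 0)) i) (b i)) = (\<Sum>i\<in>I - {j}. scale ((l(j := 0)) i) (b i))"
      using less.prems(1,3) by (simp add: sum.remove[of I j])
    also have "\<dots> = (\<Sum>i\<in>I - {j}. scale (l i) (b i))" by (rule sum.cong) auto
    finally show ?thesis using l by (intro exI[of _ "l(j := 0)"]) auto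
  qed
qed

text \<open>A relation in the enveloping algebra can only come from a linear dependence between
  the \<open>b i\<close>, and hence survives twisting.\<close>

lemma central_simple_faithful:
  fixes a b :: "'i \<Rightarrow> 'd"
  assumes "simple_ring TYPE('d)" and "center = scalars scale"
    and \<psi>: "Vector_Spaces.linear scale scale \<psi>"
  shows "finite I \<Longrightarrow> (\<And>x. (\<Sum>i\<in>I. a i * x * b i) = 0) \<Longrightarrow> (\<Sum>i\<in>I. \<psi> (a i) * b i) = 0"
proof (induction "card I" arbitrary: I a rule: less_induct)
  case less
  interpret \<psi>: Vector_Spaces.linear scale scale \<psi> by (rule \<psi>)
  show ?case
  proof (cases "\<exists>j\<in>I. a j \<noteq> 0")
    case False
    then show ?thesis by simp
  next
    case True
    then obtain l j where j: "j \<in> I" "l j \<noteq> 0" and l: "(\<Sum>i\<in>I. scale (l i) (b i)) = 0"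
      using central_simple_dependent[OF assms(1,2) less.prems] by blast
    define m where "m i = - l i / l j" for i
    have "0 = scale (1 / l j) (\<Sum>i\<in>I. scale (l i) (b i))" by (simp add: l)
    also have "\<dots> = b j - (\<Sum>i\<in>I - {j}. scale (m i) (b i))"
      using less.prems(1) j
      by (simp add: sum.remove[of I j] scale_right_distrib scale_sum_right m_def sum_negf)
    finally have bj: "b j = (\<Sum>i\<in>I - {j}. scale (m i) (b i))" by simp
    \<comment> \<open>Coefficients left after substituting the expression for \<open>b j\<close>;
      the relation loses a term, and by linearity of \<open>\<psi>\<close> the twisted sum changes
      in the same way.\<close>
    define a' where "a' i = a i + scale (m i) (a j)" for i
    have "(\<Sum>i\<in>I - {j}. a' i * x * b i) = (\<Sum>i\<in>I. a i * x * b i)" for x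
    proof -
      have "a j * x * b j = (\<Sum>i\<in>I - {j}. scale (m i) (a j) * x * b i)"
        by (subst bj) (simp add: sum_distrib_left flip: scale_mult_left scale_mult_right)
      then show ?thesis using less.prems(1) j
        by (simp add: sum.remove[of I j] a'_def distrib_right sum.distrib add.commute)
    qed
    then have "(\<Sum>i\<in>I - {j}. \<psi> (a' i) * b i) = 0"
      using less.hyps[of "I - {j}" a'] less.prems card_Diff1_less[of I j] j by auto
    moreover have "\<psi> (a j) * b j = (\<Sum>i\<in>I - {j}. \<psi> (scale (m i) (a j)) * b i)"
      by (subst bj) (simp add: sum_distrib_left \<psi>.scale flip: scale_mult_left scale_mult_right)
    ultimately show ?thesis using less.prems(1) j
      by (simp add: sum.remove[of I j] a'_def \<psi>.add distrib_right sum.distrib add.commute)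
  qed
qed

text \<open>If the twisted bimodule were not isomorphic to the untwisted one, then
  elements of the enveloping algebra annihilating larger and larger finite subsets of the
  latter could be found that do not annihilate the former.\<close>

lemma intertwiner_or_annihilator:
  assumes simple: "simple_ring TYPE('d)" and lin: "Vector_Spaces.linear scale scale \<psi>"
    and mult: "\<And>x y. \<psi> (x * y) = \<psi> x * \<psi> y" and one: "\<psi> 1 = 1"
    and X: "finite X"
    and none: "\<nexists>w. w \<noteq> 0 \<and> (\<forall>c. \<psi> c * w = w * c)"
  shows "\<exists>ps. (\<forall>x \<in> X. env_act id ps x = 0) \<and> env_act \<psi> ps 1 \<noteq> 0"
  using X
proof induction
  case empty
  show ?case by (rule exI[of _ "[(1, 1)]"]) (simp add: one)
next
  case (insert y X)
  interpret \<psi>: Vector_Spaces.linear scale scale \<psi> by (rule lin)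
  obtain p0 where p0: "\<forall>x \<in> X. env_act id p0 x = 0" "env_act \<psi> p0 1 \<noteq> 0"
    using insert by blast
  define sc where "sc a b ps = map (\<lambda>(u, v). (a * u, v * b)) ps" for a b :: 'd and ps
  have sc: "env_act id (sc a b ps) x = a * env_act id ps x * b"
    "env_act \<psi> (sc a b ps) x = \<psi> a * env_act \<psi> ps x * b" for a b ps x
    by (simp_all add: sc_def env_act_scaled mult)
  show ?case
  proof (rule ccontr)
    assume "\<not> ?thesis"
    then have A: "env_act \<psi> ps 1 = 0" if "\<forall>x \<in> X. env_act id ps x = 0" "env_act id ps y = 0" for ps
      using that by blast
    let ?J = "{env_act id ps y | ps. \<forall>x \<in> X. env_act id ps x = 0}"
    have "env_act id p0 y \<noteq> 0" using A p0 by blast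
    moreover have "env_act id p0 y \<in> ?J" using p0 by blast
    ultimately have "?J = UNIV" using simple env_act_orbit_ideal by (auto simp: simple_ring_def)
    then have "1 \<in> ?J" by blast
    then obtain p1 where p1: "1 = env_act id p1 y" "\<forall>x \<in> X. env_act id p1 x = 0"
      by blast
    \<comment> \<open>By \<open>A\<close>, sending \<open>env_act id ps y\<close> to
      \<open>env_act \<psi> ps 1\<close> is a well-defined bimodule map on the values at
      \<open>y\<close> of the annihilator of \<open>X\<close>, and these are the whole ring.
      \<open>w\<close> is the image of 1 under it.\<close>
    define w where "w = env_act \<psi> p1 1"
    have "\<psi> c * w = w * c" for c
    proof -
      \<comment> \<open>The list stands for \<open>c\<close> times \<open>p1\<close> minus
        \<open>p1\<close> times \<open>c\<close> on the right; it kills \<open>y\<close> because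
        \<open>p1\<close> sends \<open>y\<close> to 1.\<close>
      have "env_act \<psi> (sc c 1 p1 @ sc (-1) c p1) 1 = 0"
        by (rule A) (use p1 in \<open>auto simp: sc\<close>)
      then show ?thesis by (simp add: sc w_def one \<psi>.neg)
    qed
    moreover have "w \<noteq> 0"
    proof
      assume "w = 0"
      \<comment> \<open>A multiple of \<open>p1\<close> corrects \<open>p0\<close> so that it kills
        \<open>y\<close> as well. With \<open>w = 0\<close> the correction would not affect the
        twisted value, contrary to \<open>A\<close>.\<close>
      then have "env_act \<psi> (p0 @ sc (- env_act id p0 y) 1 p1) 1 \<noteq> 0"
        using p0 by (simp add: sc w_def)
      moreover have "env_act \<psi> (p0 @ sc (- env_act id p0 y) 1 p1) 1 = 0"
        by (rule A) (use p0 p1 in \<open>auto simp: sc\<close>)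
      ultimately show False by contradiction
    qed
    ultimately show False using none by blast
  qed
qed

text \<open>An element of the enveloping algebra that kills a finite spanning set kills everything,
  so by \<open>central_simple_faithful\<close> its twisted value at 1 vanishes too. This excludes
  the second alternative of \<open>intertwiner_or_annihilator\<close> and leaves a nonzero
  intertwiner \<open>w\<close>.\<close>

theorem skolem_noether:
  assumes simple: "simple_ring TYPE('d)" and central: "center = scalars scale"
    and fd: "finite_dimensional scale"
    and lin: "Vector_Spaces.linear scale scale \<psi>"
    and mult: "\<And>x y. \<psi> (x * y) = \<psi> x * \<psi> y" and one: "\<psi> 1 = 1" and surj: "surj \<psi>"
  obtains w w' where "w * w' = 1" "w' * w = 1" "\<And>c. \<psi> c * w = w * c"
proof -
  have "\<exists>w. w \<noteq> 0 \<and> (\<forall>c. \<psi> c * w = w * c)"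
  proof (rule ccontr)
    assume none: "\<not> ?thesis"
    obtain B where B: "finite B" "span B = UNIV" using fd by (auto simp: finite_dimensional_def)
    obtain ps where ps: "\<And>x. x \<in> B \<Longrightarrow> env_act id ps x = 0" "env_act \<psi> ps 1 \<noteq> 0"
      using intertwiner_or_annihilator[OF simple lin mult one B(1) none] by blast
    have sc: "env_act id ps (scale c x) = scale c (env_act id ps x)" for c x
      by (induction ps) (auto simp: scale_right_distrib simp flip: scale_mult_left scale_mult_right)
    have zero: "env_act id ps x = 0" for x
    proof -
      have "x \<in> span B" using B by simp
      then show ?thesis
      proof (induction rule: span_induct_alt)
        case (step c x y)
        then show ?case using ps(1)[of x] by (simp only: env_act_add sc) simp
      qed (rule env_act_zero)
    qed
    have idx: "env_act f ps x = (\<Sum>i<length ps. f (fst (ps ! i)) * x * snd (ps ! i))" for f x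
      by (simp add: env_act_def sum_list_sum_nth case_prod_unfold atLeast0LessThan)
    have "(\<Sum>i<length ps. \<psi> (fst (ps ! i)) * snd (ps ! i)) = 0"
      by (rule central_simple_faithful[OF simple central lin]) (use zero in \<open>auto simp: idx\<close>)
    with ps(2) show False by (simp add: idx)
  qed
  then obtain w where w: "w \<noteq> 0" "\<And>c. \<psi> c * w = w * c" by blast
  \<comment> \<open>The left ideal generated by \<open>w\<close> is two-sided because
    \<open>w * c = \<psi> c * w\<close>; by simplicity \<open>w\<close> is left invertible.\<close>
  have "ideal (range (\<lambda>a. a * w)) type_ring"
  proof (rule ideal_type_ringI)
    show "0 \<in> range (\<lambda>a. a * w)" by (metis mult_zero_left rangeI)
    show "x + y \<in> range (\<lambda>a. a * w)" if "x \<in> range (\<lambda>a. a * w)" "y \<in> range (\<lambda>a. a * w)" for x y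
      using that by (auto simp flip: distrib_right)
    show "a * x \<in> range (\<lambda>a. a * w)" if "x \<in> range (\<lambda>a. a * w)" for a x
      using that by (auto simp flip: mult.assoc)
    show "x * a \<in> range (\<lambda>a. a * w)" if "x \<in> range (\<lambda>a. a * w)" for a x
      using that by (auto simp: mult.assoc) (auto simp flip: w(2) mult.assoc)
  qed
  moreover have "w \<in> range (\<lambda>a. a * w)" by (metis mult_1_left rangeI)
  ultimately have "range (\<lambda>a. a * w) = UNIV" using simple w(1) by (auto simp: simple_ring_def)
  then obtain w' where w': "w' * w = 1" by (metis UNIV_I imageE)
  \<comment> \<open>Surjectivity of \<open>\<psi>\<close> converts the left inverse into a right
    inverse.\<close>
  obtain c where c: "\<psi> c = w'" using surj by (metis surjD)
  have "w * c = 1" using w(2)[of c] c w' by simp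
  then have "w * w' = 1" using w' by (metis mult.assoc mult_1_left mult_1_right)
  with w' w(2) that show ?thesis by blast
qed

end

section \<open>Homogeneous units and degrees\<close>

locale graded_division_inv = graded_division_algebra scale G D
  for scale :: "'f::field \<Rightarrow> 'd::ring_1 \<Rightarrow> 'd"
    and G :: "('g, 'm) monoid_scheme" (structure)
    and D :: "'g \<Rightarrow> 'd set"
    and \<phi> :: "'d \<Rightarrow> 'd" +
  assumes support_comm: "t \<in> support G D \<Longrightarrow> u \<in> support G D \<Longrightarrow> t \<otimes> u = u \<otimes> t"
    and involution: "is_involution scale \<phi>"
    and degree_preserving: "degree_preserving G D \<phi>"
begin

abbreviation "T \<equiv> support G D"
abbreviation "TG \<equiv> G\<lparr>carrier := T\<rparr>"
abbreviation "U \<equiv> gr_units G D"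
abbreviation "deg \<equiv> degree_of G D"
abbreviation "inve (x :: 'd) \<equiv> inv\<^bsub>type_ring\<^esub> x"

lemma support_carrier: "t \<in> T \<Longrightarrow> t \<in> carrier G"
  by (simp add: support_def)

lemma components_disjoint:
  assumes "t \<in> carrier G" "u \<in> carrier G" "x \<in> D t" "x \<in> D u" "x \<noteq> 0"
  shows "t = u"
  using decomp_unique[of "{t}" "\<lambda>_. x" u t] assms by auto

lemma gr_unitsI: "t \<in> carrier G \<Longrightarrow> x \<in> D t \<Longrightarrow> x \<noteq> 0 \<Longrightarrow> x \<in> U"
  by (auto simp: gr_units_def)

lemma gr_units_nonzero: "x \<in> U \<Longrightarrow> x \<noteq> 0"
  by (auto simp: gr_units_def)

lemma deg_eqI: "t \<in> carrier G \<Longrightarrow> x \<in> D t \<Longrightarrow> x \<noteq> 0 \<Longrightarrow> deg x = t"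
  unfolding degree_of_def by (rule the_equality) (auto intro: components_disjoint)

lemma deg_mem:
  assumes "x \<in> U" shows "deg x \<in> T" "x \<in> D (deg x)"
proof -
  obtain t where t: "t \<in> carrier G" "x \<in> D t" "x \<noteq> 0" using assms by (auto simp: gr_units_def)
  then show "x \<in> D (deg x)" "deg x \<in> T" using deg_eqI[OF t] by (auto simp: support_def)
qed

lemma gr_units_obtain:
  assumes "t \<in> T" obtains x where "x \<in> U" "x \<in> D t" "deg x = t"
proof -
  have "t \<in> carrier G" using assms by (simp add: support_def)
  moreover have "\<exists>x\<in>D t. x \<noteq> 0" using assms zero_in[of t] by (auto simp: support_def)
  ultimately show ?thesis using that by (meson deg_eqI gr_unitsI)
qed

lemma one_gr_units: "1 \<in> U" and deg_one: "deg 1 = \<one>"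
  using one_homogeneous by (auto intro: gr_unitsI deg_eqI)

lemma inve:
  assumes "x \<in> U" shows "inve x \<in> U" "x * inve x = 1" "inve x * x = 1"
  using gr_units_inverse[OF assms] by metis+

lemma inve_eqI:
  assumes "x \<in> U" "y * x = 1" shows "inve x = y"
  using inve[OF assms(1)] assms(2) by (metis mult.assoc mult_1_left mult_1_right)

lemma inve_assoc:
  assumes "x \<in> U" shows "x * (inve x * y) = y" "inve x * (x * y) = y"
  using inve[OF assms] by (simp_all flip: mult.assoc)

lemma gr_units_cancel:
  assumes "x \<in> U" shows "x * y = x * z \<longleftrightarrow> y = z" "y * x = z * x \<longleftrightarrow> y = z"
  using inve[OF assms] by (metis mult.assoc mult_1_left, metis mult.assoc mult_1_right)

lemma inve_mult: "x \<in> U \<Longrightarrow> y \<in> U \<Longrightarrow> inve (x * y) = inve y * inve x"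
  by (rule inve_eqI) (auto simp: gr_units_mult mult.assoc inve_assoc inve)

lemma inve_inve: "x \<in> U \<Longrightarrow> inve (inve x) = x"
  by (rule inve_eqI) (auto simp: inve)

lemma inve_one: "inve 1 = 1"
  by (rule inve_eqI) (auto simp: one_gr_units)

lemma deg_mult:
  assumes "x \<in> U" "y \<in> U" shows "deg (x * y) = deg x \<otimes> deg y"
  using assms deg_mem support_carrier gr_units_nonzero[OF gr_units_mult[OF assms]]
  by (intro deg_eqI component_mult) auto

lemma support_subgroup: "subgroup T G"
proof
  show "T \<subseteq> carrier G" by (auto simp: support_def)
  show "\<one> \<in> T" using deg_mem[OF one_gr_units] deg_one by simp
next
  fix t u assume "t \<in> T" "u \<in> T"
  then show "t \<otimes> u \<in> T" by (metis deg_mem(1) deg_mult gr_units_mult gr_units_obtain)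
next
  fix t assume "t \<in> T"
  then obtain x where x: "x \<in> U" "deg x = t" by (metis gr_units_obtain)
  then have "t \<otimes> deg (inve x) = \<one>"
    by (metis deg_mult deg_one inve(1,2))
  moreover have "deg (inve x) \<in> T" using deg_mem inve x by blast
  ultimately show "inv t \<in> T"
    using \<open>t \<in> T\<close> by (metis inv_equality inv_inv support_carrier)
qed

sublocale TG: comm_group TG
  using group.group_comm_groupI[OF subgroup.subgroup_is_group[OF support_subgroup is_group]]
  by (simp add: support_comm)

lemma TG_inv: "t \<in> T \<Longrightarrow> inv\<^bsub>TG\<^esub> t = inv t"
  using m_inv_consistent[OF support_subgroup] by simp

lemma T_inv_closed: "t \<in> T \<Longrightarrow> inv t \<in> T"
  and T_mult_closed: "t \<in> T \<Longrightarrow> u \<in> T \<Longrightarrow> t \<otimes> u \<in> T"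
  and T_one_closed: "\<one> \<in> T"
  using support_subgroup by (auto dest: subgroup.m_inv_closed subgroup.m_closed subgroup.one_closed)

lemma deg_inve: "x \<in> U \<Longrightarrow> deg (inve x) = inv (deg x)"
  by (metis deg_mem(1) deg_mult deg_one inv_equality inve(1,3) support_carrier)

lemma phi_linear: "Vector_Spaces.linear scale scale \<phi>"
  and phi_mult: "\<phi> (x * y) = \<phi> y * \<phi> x" and phi_phi: "\<phi> (\<phi> x) = x"
  using involution by (auto simp: is_involution_def)

sublocale phi: Vector_Spaces.linear scale scale \<phi>
  by (rule phi_linear)

lemma phi_one: "\<phi> 1 = 1"
  by (metis phi_mult phi_phi mult_1_left mult_1_right)

lemma phi_component: "t \<in> carrier G \<Longrightarrow> x \<in> D t \<Longrightarrow> \<phi> x \<in> D t"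
  using degree_preserving by (auto simp: degree_preserving_def)

lemma phi_eq_0: "\<phi> x = 0 \<longleftrightarrow> x = 0"
  by (metis phi.zero phi_phi)

lemma
  assumes "x \<in> U"
  shows phi_gr_units: "\<phi> x \<in> U" and deg_phi: "deg (\<phi> x) = deg x"
proof -
  have x: "deg x \<in> carrier G" "\<phi> x \<in> D (deg x)" "\<phi> x \<noteq> 0"
    using deg_mem[OF assms] gr_units_nonzero[OF assms] support_carrier
    by (auto simp: phi_eq_0 intro: phi_component)
  show "\<phi> x \<in> U" "deg (\<phi> x) = deg x" by (rule gr_unitsI[OF x] deg_eqI[OF x])+
qed

lemma phi_inve: "x \<in> U \<Longrightarrow> \<phi> (inve x) = inve (\<phi> x)"
  using inve_eqI[OF phi_gr_units] by (metis inve(2) phi_mult phi_one)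

lemma scale_gr_units:
  assumes "a \<noteq> 0" "x \<in> U" shows "scale a x \<in> U"
proof (rule gr_unitsI)
  show "deg x \<in> carrier G" using deg_mem[OF assms(2)] support_carrier by blast
  then show "scale a x \<in> D (deg x)"
    using deg_mem[OF assms(2)] subspace_scale[OF component_subspace] by blast
  show "scale a x \<noteq> 0" using assms gr_units_nonzero by simp
qed

lemma span_component: "t \<in> carrier G \<Longrightarrow> span (D t) = D t"
  using component_subspace span_eq_iff by blast

end

section \<open>The universal grading group\<close>

text \<open>This is the index map called \<sigma> in the overview. Its fixed points are the blocks
  of size 1, and it exchanges the two indices of each block of size 2.\<close>

definition partner :: "nat \<Rightarrow> nat \<Rightarrow> nat" where
  "partner q i = (if i < q then i else if even (i - q) then i + 1 else i - 1)"

lemma partner_simps: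
  "i < q \<Longrightarrow> partner q i = i" "partner q (q + 2 * j) = Suc (q + 2 * j)"
  "partner q (Suc (q + 2 * j)) = q + 2 * j"
  by (simp_all add: partner_def Suc_diff_le)

lemma index_cases:
  obtains "i < q" | j where "i = q + 2 * j" | j where "i = Suc (q + 2 * j)"
proof (cases "i < q")
  case False
  then have "i = q + (i - q)" by simp
  moreover have "i - q = 2 * ((i - q) div 2) \<or> i - q = Suc (2 * ((i - q) div 2))" by arith
  ultimately show ?thesis using that by (metis add_Suc_right)
qed (use that in auto)

lemma partner_partner: "partner q (partner q i) = i"
  by (cases i q rule: index_cases) (simp_all add: partner_simps)

lemma partner_eq_iff: "partner q i = partner q j \<longleftrightarrow> i = j"
  by (metis partner_partner)

lemma partner_fixed: "partner q i = i \<longleftrightarrow> i < q"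
  by (cases i q rule: index_cases) (simp_all add: partner_simps)

lemma partner_less: "partner q i < q + 2 * s \<longleftrightarrow> i < q + 2 * s"
  by (cases i q rule: index_cases) (simp_all add: partner_simps, presburger+)

lemma (in group) rcos_eq_iff:
  assumes "subgroup H G" "x \<in> carrier G" "y \<in> carrier G"
  shows "H #> x = H #> y \<longleftrightarrow> x \<otimes> inv y \<in> H"
proof
  assume "H #> x = H #> y"
  then have "x \<in> H #> y" using rcos_self[OF assms(2,1)] by simp
  then obtain h where "h \<in> H" "x = h \<otimes> y" by (auto simp: r_coset_def)
  then show "x \<otimes> inv y \<in> H"
    using assms subgroup.mem_carrier[OF assms(1)] by (simp add: m_assoc)
next
  assume "x \<otimes> inv y \<in> H"
  then have "x \<otimes> inv y \<otimes> y \<in> H #> y" by (auto simp: r_coset_def)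
  then have "x \<in> H #> y" using assms by (simp add: m_assoc)
  then show "H #> x = H #> y" using repr_independence assms by metis
qed

lemma (in comm_group) cancel_common:
  assumes "a \<in> carrier G" "b \<in> carrier G" "w \<in> carrier G"
  shows "a \<otimes> w \<otimes> inv (b \<otimes> w) = a \<otimes> inv b"
proof -
  have "a \<otimes> w \<otimes> inv (b \<otimes> w) = a \<otimes> inv b \<otimes> (w \<otimes> inv w)"
    using assms by (simp only: inv_mult m_ac inv_closed m_closed)
  then show ?thesis using assms by simp
qed

section \<open>The group \<open>F x T\<close> and its injective endomorphisms\<close>

context graded_division_inv
begin

sublocale FT: comm_group "free_times_support G D k" for k
proof -
  interpret F: comm_group "free_Abelian_group {..<k}" by (rule abelian_free_Abelian_group)
  have "group (free_times_support G D k)"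
    unfolding free_times_support_def
    by (intro DirProd_group F.group_axioms TG.group_axioms)
  then show "comm_group (free_times_support G D k)"
    by (rule group.group_comm_groupI)
      (auto simp: free_times_support_def support_comm add.commute)
qed

lemma FT_carrier: "carrier (free_times_support G D k) = {f. Poly_Mapping.keys f \<subseteq> {..<k}} \<times> T"
  by (auto simp: free_times_support_def)

lemma FT_mult: "(f, t) \<otimes>\<^bsub>free_times_support G D k\<^esub> (g, u) = (f + g, t \<otimes> u)"
  by (simp add: free_times_support_def)

lemma FT_one: "\<one>\<^bsub>free_times_support G D k\<^esub> = (0, \<one>)"
  by (simp add: free_times_support_def)

lemma FT_inv:
  assumes "Poly_Mapping.keys f \<subseteq> {..<k}" "t \<in> T"
  shows "inv\<^bsub>free_times_support G D k\<^esub> (f, t) = (- f, inv t)"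
  by (rule FT.inv_equality)
    (use assms in \<open>auto simp: FT_carrier FT_mult FT_one T_inv_closed support_carrier\<close>)

lemma frag_diff_keys:
  "i < k \<Longrightarrow> j < k \<Longrightarrow> Poly_Mapping.keys (frag_of i - frag_of j) \<subseteq> {..<k}"
  "i < k \<Longrightarrow> j < k \<Longrightarrow> Poly_Mapping.keys (frag_of i + frag_of j) \<subseteq> {..<k}"
  by (auto dest!: subsetD[OF keys_diff] subsetD[OF keys_add])

text \<open>Designed for the effect on degrees of the monomial maps of the overview:
  \<open>v i\<close> plays the degree of \<open>c i\<close>, and \<open>\<tau>\<close> the action of
  the twist on \<open>T\<close>. The formula with a difference treats degrees of matrix units, the
  one with a sum treats the elements to be identified.\<close>

lemma FT_automorphism:
  assumes \<pi>: "bij_betw \<pi> {..<k} {..<k}" and v: "\<And>i. i < k \<Longrightarrow> v i \<in> T"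
    and \<tau>: "\<tau> \<in> hom TG TG" "inj_on \<tau> T"
  obtains \<theta> where "\<theta> \<in> hom (free_times_support G D k) (free_times_support G D k)"
    "inj_on \<theta> (carrier (free_times_support G D k))"
    "\<And>i j t. i < k \<Longrightarrow> j < k \<Longrightarrow> t \<in> T \<Longrightarrow>
       \<theta> (frag_of i - frag_of j, t) = (frag_of (\<pi> i) - frag_of (\<pi> j), v i \<otimes> inv (v j) \<otimes> \<tau> t)"
    "\<And>i j t. i < k \<Longrightarrow> j < k \<Longrightarrow> t \<in> T \<Longrightarrow>
       \<theta> (frag_of i + frag_of j, t) = (frag_of (\<pi> i) + frag_of (\<pi> j), v i \<otimes> v j \<otimes> \<tau> t)"
proof -
  let ?P = "free_times_support G D k"
  have "v ` {..<k} \<subseteq> carrier TG" using v by auto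
  then obtain \<kappa> where \<kappa>: "\<kappa> \<in> hom (free_Abelian_group {..<k}) TG"
    and \<kappa>v: "\<And>i. i \<in> {..<k} \<Longrightarrow> \<kappa> (frag_of i) = v i"
    by (rule TG.free_Abelian_group_universal) blast
  interpret \<kappa>: group_hom "free_Abelian_group {..<k}" TG \<kappa>
    by (intro group_hom.intro group_hom_axioms.intro group_free_Abelian_group TG.group_axioms \<kappa>)
  interpret \<tau>: group_hom TG TG \<tau> by unfold_locales (rule \<tau>)
  have \<kappa>T: "\<kappa> f \<in> T" if "Poly_Mapping.keys f \<subseteq> {..<k}" for f
    using \<kappa>.hom_closed[of f] that by simp
  have \<tau>T: "\<tau> t \<in> T" if "t \<in> T" for t using \<tau>.hom_closed that by simp
  have \<kappa>_add: "\<kappa> (f + g) = \<kappa> f \<otimes> \<kappa> g"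
    if "Poly_Mapping.keys f \<subseteq> {..<k}" "Poly_Mapping.keys g \<subseteq> {..<k}" for f g
    using \<kappa>.hom_mult[of f g] that by simp
  have \<kappa>_minus: "\<kappa> (- f) = inv (\<kappa> f)" if "Poly_Mapping.keys f \<subseteq> {..<k}" for f
    using \<kappa>.hom_inv[of f] that TG_inv \<kappa>T by simp
  \<comment> \<open>\<open>E\<close> relabels the generators and \<open>\<kappa>\<close> collects
    the factors \<open>v i\<close>. The free part of an image is a pure relabelling, which makes
    injectivity visible.\<close>
  define E where "E = frag_extend (\<lambda>i. frag_of (\<pi> i))"
  define \<theta> where "\<theta> = (\<lambda>(f, t). (E f, \<kappa> f \<otimes> \<tau> t))"
  have Ekeys: "Poly_Mapping.keys (E f) \<subseteq> {..<k}" if "Poly_Mapping.keys f \<subseteq> {..<k}" for f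
    using that \<pi> unfolding E_def
    by (intro order_trans[OF keys_frag_extend]) (auto simp: bij_betw_def)
  have hom: "\<theta> \<in> hom ?P ?P"
  proof (rule homI)
    fix x assume "x \<in> carrier ?P"
    then show "\<theta> x \<in> carrier ?P"
      using Ekeys \<kappa>T \<tau>T by (auto simp: \<theta>_def FT_carrier T_mult_closed)
  next
    fix x y assume xy: "x \<in> carrier ?P" "y \<in> carrier ?P"
    obtain f t g u where e: "x = (f, t)" "y = (g, u)" by (cases x, cases y)
    then have c: "Poly_Mapping.keys f \<subseteq> {..<k}" "t \<in> T" "Poly_Mapping.keys g \<subseteq> {..<k}" "u \<in> T"
      using xy by (auto simp: FT_carrier)
    have "\<kappa> f \<otimes> \<kappa> g \<otimes> (\<tau> t \<otimes> \<tau> u) = \<kappa> f \<otimes> \<tau> t \<otimes> (\<kappa> g \<otimes> \<tau> u)"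
      using TG.m_ac[simplified] \<kappa>T c \<tau>T T_mult_closed by simp
    then show "\<theta> (x \<otimes>\<^bsub>?P\<^esub> y) = \<theta> x \<otimes>\<^bsub>?P\<^esub> \<theta> y"
      using \<tau>.hom_mult[of t u] c
      by (simp add: e FT_mult \<theta>_def \<kappa>_add E_def frag_extend_add)
  qed
  have "inj_on \<theta> (carrier ?P)"
  proof (rule inj_onI)
    fix x y assume xy: "x \<in> carrier ?P" "y \<in> carrier ?P" and eq: "\<theta> x = \<theta> y"
    obtain f t g u where e: "x = (f, t)" "y = (g, u)" by (cases x, cases y)
    then have c: "Poly_Mapping.keys f \<subseteq> {..<k}" "t \<in> T" "Poly_Mapping.keys g \<subseteq> {..<k}" "u \<in> T"
      using xy by (auto simp: FT_carrier)
    have undo: "frag_extend (\<lambda>i. frag_of (inv_into {..<k} \<pi> i)) (E f) = f"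
      if "Poly_Mapping.keys f \<subseteq> {..<k}" for f
    proof -
      have "frag_extend (\<lambda>i. frag_of (inv_into {..<k} \<pi> i)) (E f)
          = frag_extend (\<lambda>i. frag_of (inv_into {..<k} \<pi> (\<pi> i))) f"
        using frag_extend_compose[of "\<lambda>i. frag_of (inv_into {..<k} \<pi> i)" \<pi> f]
        by (simp add: E_def comp_def)
      also have "\<dots> = frag_extend frag_of f"
        by (rule frag_extend_eq) (use that \<pi> in \<open>auto simp: bij_betw_def\<close>)
      finally show ?thesis by (simp flip: frag_expansion)
    qed
    have "E f = E g" using eq by (simp add: e \<theta>_def)
    then have fg: "f = g" using undo c by metis
    then have "\<tau> t = \<tau> u"
      using eq c \<kappa>T \<tau>T support_carrier by (auto simp: e \<theta>_def)
    then show "x = y" using \<tau>(2) c fg by (auto simp: e inj_on_def)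
  qed
  moreover have "\<theta> (frag_of i - frag_of j, t) = (frag_of (\<pi> i) - frag_of (\<pi> j), v i \<otimes> inv (v j) \<otimes> \<tau> t)"
    if "i < k" "j < k" "t \<in> T" for i j t
    using \<kappa>_add[of "frag_of i" "- frag_of j"] \<kappa>_minus[of "frag_of j"] that \<kappa>v
    by (simp add: \<theta>_def E_def frag_extend_diff)
  moreover have "\<theta> (frag_of i + frag_of j, t) = (frag_of (\<pi> i) + frag_of (\<pi> j), v i \<otimes> v j \<otimes> \<tau> t)"
    if "i < k" "j < k" "t \<in> T" for i j t
    using \<kappa>_add[of "frag_of i" "frag_of j"] that \<kappa>v
    by (simp add: \<theta>_def E_def frag_extend_add)
  ultimately show ?thesis using that hom by blast
qed

end

section \<open>The relation subgroup and the degrees of matrix units\<close>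

locale M_algebra_data = graded_division_inv scale G D \<phi>
  for scale :: "'f::field \<Rightarrow> 'd::ring_1 \<Rightarrow> 'd"
    and G :: "('g, 'm) monoid_scheme" (structure)
    and D :: "'g \<Rightarrow> 'd set"
    and \<phi> :: "'d \<Rightarrow> 'd" +
  fixes q s :: nat and ds :: "'d list" and \<delta> :: 'f
  assumes data: "M_data scale G D \<phi> q s ds \<delta>"
begin

abbreviation "k \<equiv> q + 2 * s"
abbreviation "N \<equiv> relation_subgroup G D q s ds"
abbreviation "ed \<equiv> entry_degree G D q s ds"
abbreviation "Mc \<equiv> M_component scale G D q s ds"
abbreviation "\<sigma> \<equiv> partner q"

definition \<beta> :: "nat \<Rightarrow> 'd" where
  "\<beta> i = (if i < q then ds ! i else if even (i - q) then 1 else scale \<delta> 1)"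

lemma beta_simps:
  "i < q \<Longrightarrow> \<beta> i = ds ! i" "\<beta> (q + 2 * j) = 1" "\<beta> (Suc (q + 2 * j)) = scale \<delta> 1"
  by (simp_all add: \<beta>_def Suc_diff_le)

lemma k_pos: "0 < k"
  using data by (auto simp: M_data_def)

lemma delta: "\<delta> * \<delta> = 1" "\<delta> \<noteq> 0"
  using data by (auto simp: M_data_def)

lemma ds_props: "i < q \<Longrightarrow> ds ! i \<in> U" "i < q \<Longrightarrow> \<phi> (ds ! i) = scale \<delta> (ds ! i)" "length ds = q"
  using data by (auto simp: M_data_def)

lemma scalar_one_mem: "scale a 1 \<in> D \<one>"
  using one_homogeneous subspace_scale[OF component_subspace] by simp

lemma beta_gr_units: "\<beta> i \<in> U"
  using delta by (auto simp: \<beta>_def ds_props one_gr_units scale_gr_units)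

lemma deg_beta_pair: "\<not> i < q \<Longrightarrow> deg (\<beta> i) = \<one>"
  using delta gr_units_nonzero[OF beta_gr_units[of i]] scalar_one_mem[of 1] scalar_one_mem[of \<delta>]
  by (intro deg_eqI) (auto simp: \<beta>_def)

text \<open>Entrywise form of the fact that \<open>Phi\<close> equals \<delta> times its conjugate
  transpose; on blocks of size 2 it rests on the square of \<delta> being 1.\<close>

lemma phi_beta: "\<phi> (\<beta> i) = scale \<delta> (\<beta> (\<sigma> i))"
  using delta by (cases i q rule: index_cases)
    (simp_all add: beta_simps partner_simps ds_props phi_one phi.scale)

text \<open>One formula for both kinds of relations: the two indices of a block of size 2 name the
  same element, and there \<open>\<beta> i\<close> has trivial degree.\<close>

lemma identified_eq:
  "identified G D q s ds = (\<lambda>i. (frag_of i + frag_of (\<sigma> i), inv (deg (\<beta> i)))) ` {..<k}"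
  (is "_ = ?f ` _")
proof
  show "identified G D q s ds \<subseteq> ?f ` {..<k}"
  proof
    fix x assume "x \<in> identified G D q s ds"
    then consider i where "i < q" "x = (frag_of i + frag_of i, inv (deg (ds ! i)))"
      | j where "j < s" "x = (frag_of (q + 2 * j) + frag_of (q + 2 * j + 1), \<one>)"
      by (auto simp: identified_def)
    then show "x \<in> ?f ` {..<k}"
    proof cases
      case 1 then show ?thesis by (intro image_eqI[of _ _ i]) (auto simp: beta_simps partner_simps)
    next
      case 2 then show ?thesis
        by (intro image_eqI[of _ _ "q + 2 * j"]) (auto simp: deg_beta_pair partner_simps)
    qed
  qed
  show "?f ` {..<k} \<subseteq> identified G D q s ds"
  proof clarsimp
    fix i assume i: "i < k"
    show "(frag_of i + frag_of (\<sigma> i), inv deg (\<beta> i)) \<in> identified G D q s ds"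
    proof (cases i q rule: index_cases)
      case 1
      then show ?thesis by (auto simp: identified_def partner_simps beta_simps)
    next
      case (2 j)
      then show ?thesis using i deg_beta_pair[of i]
        by (auto simp: identified_def partner_simps)
    next
      case (3 j)
      then show ?thesis using i deg_beta_pair[of i]
        by (auto simp: identified_def partner_simps add.commute)
    qed
  qed
qed

lemma identified_carrier: "identified G D q s ds \<subseteq> carrier (free_times_support G D k)"
  unfolding identified_eq
  by (auto simp: FT_carrier partner_less T_inv_closed deg_mem(1)[OF beta_gr_units]
      dest!: subsetD[OF frag_diff_keys(2)[of _ k], rotated -1])

lemma N_generators:
  "{x \<otimes>\<^bsub>free_times_support G D k\<^esub> inv\<^bsub>free_times_support G D k\<^esub> y | x y.
      x \<in> identified G D q s ds \<and> y \<in> identified G D q s ds} \<subseteq> carrier (free_times_support G D k)"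
  using identified_carrier by (blast intro: FT.m_closed FT.inv_closed)

lemma N_subgroup: "subgroup N (free_times_support G D k)"
  unfolding relation_subgroup_def Let_def by (rule FT.generate_is_subgroup[OF N_generators])

text \<open>The relations lie in an explicit subgroup whose elements are determined by their
  first component.\<close>

lemma N_elements:
  assumes "(f, t) \<in> N"
  shows "\<forall>i<k. Poly_Mapping.lookup f (\<sigma> i) = Poly_Mapping.lookup f i"
    and "\<forall>i<q. even (Poly_Mapping.lookup f i)" and "f = 0 \<Longrightarrow> t = \<one>"
proof -
  let ?P = "free_times_support G D k"
  have "(\<lambda>i. inv (deg (\<beta> i))) ` {..<k} \<subseteq> carrier TG"
    by (auto simp: T_inv_closed deg_mem beta_gr_units)
  then obtain \<kappa> where \<kappa>: "\<kappa> \<in> hom (free_Abelian_group {..<k}) TG"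
    and \<kappa>v: "\<And>i. i \<in> {..<k} \<Longrightarrow> \<kappa> (frag_of i) = inv (deg (\<beta> i))"
    by (rule TG.free_Abelian_group_universal) blast
  interpret \<kappa>: group_hom "free_Abelian_group {..<k}" TG \<kappa>
    by (intro group_hom.intro group_hom_axioms.intro group_free_Abelian_group TG.group_axioms \<kappa>)
  have \<kappa>T: "\<kappa> f \<in> T" if "Poly_Mapping.keys f \<subseteq> {..<k}" for f
    using \<kappa>.hom_closed[of f] that by simp
  have \<kappa>_add: "\<kappa> (f + g) = \<kappa> f \<otimes> \<kappa> g"
    if "Poly_Mapping.keys f \<subseteq> {..<k}" "Poly_Mapping.keys g \<subseteq> {..<k}" for f g
    using \<kappa>.hom_mult[of f g] that by simp
  have \<kappa>_minus: "\<kappa> (- f) = inv (\<kappa> f)" if "Poly_Mapping.keys f \<subseteq> {..<k}" for f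
    using \<kappa>.hom_inv[of f] that TG_inv \<kappa>T by simp
  have \<kappa>0: "\<kappa> 0 = \<one>" using \<kappa>.hom_one by simp
  \<comment> \<open>\<open>m\<close> is half of the exponents of \<open>f\<close> below
    \<open>q\<close>, and \<open>t\<close> is the corresponding product of powers of the inverse
    degrees of the \<open>ds ! i\<close>. If \<open>f = 0\<close>, then \<open>m = 0\<close>, hence
    \<open>t\<close> is trivial.\<close>
  define R where "R f t m \<longleftrightarrow> (\<forall>i<k. Poly_Mapping.lookup f (\<sigma> i) = Poly_Mapping.lookup f i)
    \<and> Poly_Mapping.keys m \<subseteq> {..<q}
    \<and> (\<forall>i<q. Poly_Mapping.lookup f i = 2 * Poly_Mapping.lookup m i) \<and> t = \<kappa> m" for f t and m :: "nat \<Rightarrow>\<^sub>0 int"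
  define V where "V = {(f, t). Poly_Mapping.keys f \<subseteq> {..<k} \<and> (\<exists>m. R f t m)}"
  have mk: "Poly_Mapping.keys m \<subseteq> {..<k}" if "R f t m" for f t m
    using that by (auto simp: R_def)
  have "subgroup V ?P"
  proof
    show "V \<subseteq> carrier ?P" using \<kappa>T mk by (auto simp: V_def FT_carrier R_def)
    show "\<one>\<^bsub>?P\<^esub> \<in> V" by (auto simp: V_def FT_one R_def \<kappa>0 intro!: exI[of _ 0])
  next
    fix x y assume "x \<in> V" "y \<in> V"
    then obtain f t m g u n where x: "x = (f, t)" "y = (g, u)" "R f t m" "R g u n"
      "Poly_Mapping.keys f \<subseteq> {..<k}" "Poly_Mapping.keys g \<subseteq> {..<k}"
      by (auto simp: V_def)
    have "R (f + g) (t \<otimes> u) (m + n)"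
      using x(3,4) \<kappa>_add[OF mk[OF x(3)] mk[OF x(4)]]
      by (auto simp: R_def lookup_add dest!: subsetD[OF keys_add])
    then show "x \<otimes>\<^bsub>?P\<^esub> y \<in> V"
      using x(5,6) order_trans[OF keys_add[of f g], of "{..<k}"] by (auto simp: V_def x FT_mult)
  next
    fix x assume "x \<in> V"
    then obtain f t m where x: "x = (f, t)" "R f t m" "Poly_Mapping.keys f \<subseteq> {..<k}"
      by (auto simp: V_def)
    have "R (- f) (inv t) (- m)"
      using x(2) \<kappa>_minus[OF mk[OF x(2)]] by (auto simp: R_def)
    moreover have "t \<in> T" using x(2) \<kappa>T[OF mk[OF x(2)]] by (simp add: R_def)
    ultimately show "inv\<^bsub>?P\<^esub> x \<in> V" using x(3) by (auto simp: V_def x FT_inv)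
  qed
  \<comment> \<open>\<open>V\<close> contains the elements to be identified themselves, hence all
    their quotients, which generate \<open>N\<close>.\<close>
  moreover have "identified G D q s ds \<subseteq> V"
  proof (unfold identified_eq, clarsimp)
    fix i assume i: "i < k"
    have \<sigma>: "\<sigma> j = i \<longleftrightarrow> j = \<sigma> i" for j using partner_partner[of q] by auto
    have L: "Poly_Mapping.lookup (frag_of i + frag_of (\<sigma> i)) j
      = (if j = i then 1 else 0) + (if j = \<sigma> i then 1 else 0)" for j
      by (simp add: lookup_add)
    have "R (frag_of i + frag_of (\<sigma> i)) (inv (deg (\<beta> i))) (if i < q then frag_of i else 0)"
    proof (cases "i < q")
      case True
      then have "\<sigma> i = i" by (simp add: partner_simps)
      then show ?thesis using True i \<kappa>v[of i]
        unfolding R_def L by (auto simp: \<sigma>)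
    next
      case False
      then have "\<not> \<sigma> i < q" using partner_fixed partner_partner by metis
      then have "\<forall>j<q. j \<noteq> i \<and> j \<noteq> \<sigma> i" using False by blast
      then show ?thesis using False \<kappa>0 deg_beta_pair[OF False]
        unfolding R_def L by (auto simp: \<sigma> partner_eq_iff)
    qed
    then show "(frag_of i + frag_of (\<sigma> i), inv deg (\<beta> i)) \<in> V"
      using i frag_diff_keys(2)[of i k "\<sigma> i"] by (auto simp: V_def partner_less)
  qed
  ultimately have "N \<subseteq> V"
    unfolding relation_subgroup_def Let_def
    by (intro FT.generate_subgroup_incl)
       (auto intro!: subgroup.m_closed subgroup.m_inv_closed)
  then have "(f, t) \<in> V" using assms by blast
  then obtain m where m: "R f t m" by (auto simp: V_def)
  then show "\<forall>i<k. Poly_Mapping.lookup f (\<sigma> i) = Poly_Mapping.lookup f i"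
    "\<forall>i<q. even (Poly_Mapping.lookup f i)" by (auto simp: R_def)
  assume "f = 0"
  then have "Poly_Mapping.lookup m i = 0" for i
    using m by (cases "i < q") (auto simp: R_def in_keys_iff)
  then have "m = 0" by (intro poly_mapping_eqI) simp
  then show "t = \<one>" using m \<kappa>0 by (simp add: R_def)
qed

lemma ed_eq_iff:
  assumes "i < k" "j < k" "t \<in> T" "i' < k" "j' < k" "t' \<in> T"
  shows "ed i j t = ed i' j' t'
    \<longleftrightarrow> (frag_of i - frag_of j - (frag_of i' - frag_of j'), t \<otimes> inv t') \<in> N"
  unfolding entry_degree_def
  using assms frag_diff_keys(1)[of i k j] frag_diff_keys(1)[of i' k j']
  by (subst FT.rcos_eq_iff[OF N_subgroup]) (auto simp: FT_carrier FT_inv FT_mult algebra_simps)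

text \<open>The support embeds into the universal group, because \<open>N\<close> contains no
  element of \<open>T\<close> other than the identity.\<close>

lemma ed_inj:
  assumes "i < k" "j < k" "t \<in> T" "t' \<in> T" "ed i j t = ed i j t'"
  shows "t = t'"
proof -
  have "(0, t \<otimes> inv t') \<in> N" using assms by (simp add: ed_eq_iff)
  then have "t \<otimes> inv t' = \<one>" using N_elements(3) by blast
  then show ?thesis using assms(3,4) support_carrier by (metis inv_equality inv_inv inv_closed)
qed

text \<open>Off the diagonal no degree lies in the image of \<open>T\<close>: the exponents 1 and -1
  at distinct \<open>i\<close> and \<open>j\<close> violate evenness if one of the indices is below
  \<open>q\<close>, and otherwise the symmetry under \<open>\<sigma>\<close> at
  \<open>i\<close>.\<close>

lemma ed_diag:
  assumes "i < k" "j < k" "l < k" "t \<in> T" "t' \<in> T" "ed i j t = ed l l t'"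
  shows "i = j" "t = t'"
proof -
  have "(frag_of i - frag_of j, t \<otimes> inv t') \<in> N" using assms by (simp add: ed_eq_iff)
  note n = N_elements(1,2)[OF this]
  show "i = j"
  proof (rule ccontr)
    assume ij: "i \<noteq> j"
    have "\<not> i < q" "\<not> j < q" using n(2) ij by (auto simp: lookup_minus dest: spec[of _ i] spec[of _ j])
    then have "\<sigma> i \<noteq> i" "\<sigma> i < k" using assms(1) by (auto simp: partner_fixed partner_less)
    then show False using n(1) assms(1) ij
      by (auto simp: lookup_minus dest!: spec[of _ i] split: if_splits)
  qed
  then have "(0, t \<otimes> inv t') \<in> N" using assms by (simp add: ed_eq_iff)
  then have "t \<otimes> inv t' = \<one>" using N_elements(3) by blast
  then show "t = t'" using assms(4,5) support_carrier by (metis inv_equality inv_inv inv_closed)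
qed

lemma ed_diag_eq: "i < k \<Longrightarrow> j < k \<Longrightarrow> t \<in> T \<Longrightarrow> ed i i t = ed j j t"
  by (simp add: ed_eq_iff subgroup.one_closed[OF N_subgroup, unfolded FT_one] support_carrier)

text \<open>By \<open>ed_inj\<close> at most one \<open>t\<close> belongs to a given position and
  degree, so the span in the definition is a single component of \<open>D\<close> or zero.\<close>

lemma comp_iff:
  "X \<in> Mc g \<longleftrightarrow> X \<in> carrier_mat k k \<and>
     (\<forall>i<k. \<forall>j<k. X $$ (i, j) = 0 \<or> (\<exists>t\<in>T. ed i j t = g \<and> X $$ (i, j) \<in> D t))"
proof -
  have "x \<in> span (\<Union>t \<in> {t \<in> T. ed i j t = g}. D t) \<longleftrightarrow> x = 0 \<or> (\<exists>t\<in>T. ed i j t = g \<and> x \<in> D t)"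
    if "i < k" "j < k" for x i j
  proof (cases "\<exists>t\<in>T. ed i j t = g")
    case True
    then obtain t where t: "t \<in> T" "ed i j t = g" by blast
    then have "{t \<in> T. ed i j t = g} = {t}" using ed_inj[OF that] by auto
    then show ?thesis using t ed_inj[OF that] support_carrier[OF t(1)] zero_in[of t]
      by (auto simp: span_component)
  next
    case False
    then have "{t \<in> T. ed i j t = g} = {}" by auto
    then have "span (\<Union>t \<in> {t \<in> T. ed i j t = g}. D t) = {0}" by (simp only: SUP_empty span_empty Union_empty image_empty)
    then show ?thesis using False by blast
  qed
  then show ?thesis by (auto simp: M_component_def)
qed

lemma comp_zero: "0\<^sub>m k k \<in> Mc g"
  by (auto simp: comp_iff)

lemma ed_carrier:
  assumes "i < k" "j < k" "t \<in> T" shows "ed i j t \<in> carrier (G_tilde G D q s ds)"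
proof -
  have "(frag_of i - frag_of j, t) \<in> carrier (free_times_support G D k)"
    using assms frag_diff_keys(1)[OF assms(1,2)] by (simp add: FT_carrier)
  then show ?thesis
    unfolding G_tilde_def FactGroup_def entry_degree_def
    by (simp add: FT.rcosetsI[OF subgroup.subset[OF N_subgroup]])
qed

end

text \<open>Shifting all identified elements by a common factor \<open>w\<close> does not change the
  relations between them.\<close>

lemma (in graded_division_inv) entry_degree_transfer:
  assumes M: "M_algebra_data scale G D \<phi> q s ds \<delta>" and M': "M_algebra_data scale G D \<phi> q s ds' \<delta>'"
    and \<pi>: "bij_betw \<pi> {..<q + 2 * s} {..<q + 2 * s}"
    and \<pi>\<sigma>: "\<And>i. i < q + 2 * s \<Longrightarrow> \<pi> (partner q i) = partner q (\<pi> i)"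
    and v: "\<And>i. i < q + 2 * s \<Longrightarrow> v i \<in> T" and w: "w \<in> T"
    and \<tau>: "\<tau> \<in> hom TG TG" "inj_on \<tau> T"
    and shift: "\<And>i. i < q + 2 * s \<Longrightarrow>
      w \<otimes> \<tau> (deg (M_algebra_data.\<beta> scale q ds \<delta> i))
      = v i \<otimes> deg (M_algebra_data.\<beta> scale q ds' \<delta>' (\<pi> i)) \<otimes> v (partner q i)"
    and ij: "i < q + 2 * s" "j < q + 2 * s" "t \<in> T" "i' < q + 2 * s" "j' < q + 2 * s" "t' \<in> T"
  shows "entry_degree G D q s ds i j t = entry_degree G D q s ds i' j' t' \<longleftrightarrow>
    entry_degree G D q s ds' (\<pi> i) (\<pi> j) (v i \<otimes> inv (v j) \<otimes> \<tau> t)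
    = entry_degree G D q s ds' (\<pi> i') (\<pi> j') (v i' \<otimes> inv (v j') \<otimes> \<tau> t')"
proof -
  interpret M: M_algebra_data scale G D \<phi> q s ds \<delta> by (rule M)
  interpret M': M_algebra_data scale G D \<phi> q s ds' \<delta>' by (rule M')
  let ?P = "free_times_support G D M.k"
  obtain \<theta> where \<theta>: "\<theta> \<in> hom ?P ?P" "inj_on \<theta> (carrier ?P)"
    and \<theta>_diff: "\<And>i j t. i < M.k \<Longrightarrow> j < M.k \<Longrightarrow> t \<in> T \<Longrightarrow>
       \<theta> (frag_of i - frag_of j, t) = (frag_of (\<pi> i) - frag_of (\<pi> j), v i \<otimes> inv (v j) \<otimes> \<tau> t)"
    and \<theta>_add: "\<And>i j t. i < M.k \<Longrightarrow> j < M.k \<Longrightarrow> t \<in> T \<Longrightarrow>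
       \<theta> (frag_of i + frag_of j, t) = (frag_of (\<pi> i) + frag_of (\<pi> j), v i \<otimes> v j \<otimes> \<tau> t)"
    using FT_automorphism[OF \<pi> _ \<tau>, of v] v by blast
  interpret \<theta>: group_hom ?P ?P \<theta> by unfold_locales (rule \<theta>)
  interpret \<tau>: group_hom TG TG \<tau> by unfold_locales (rule \<tau>)
  have \<tau>T: "\<tau> t \<in> T" if "t \<in> T" for t using \<tau>.hom_closed that by simp
  have \<pi>k: "\<pi> i < M.k" if "i < M.k" for i using \<pi> that by (auto simp: bij_betw_def)
  define x where "x i = (frag_of i + frag_of (partner q i), inv (deg (M.\<beta> i)))" for i
  define y where "y i = (frag_of i + frag_of (partner q i), inv (deg (M'.\<beta> i)))" for i
  have xc: "x i \<in> carrier ?P" and yc: "y i \<in> carrier ?P" if "i < M.k" for i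
    using that M.identified_carrier M'.identified_carrier
    by (auto simp: M.identified_eq M'.identified_eq x_def y_def)
  have wc: "(0, w) \<in> carrier ?P" using w by (simp add: FT_carrier)
  \<comment> \<open>The hypothesis \<open>shift\<close> is this equation read in \<open>T\<close>:
    the element for \<open>i\<close> goes to the element for \<open>\<pi> i\<close> times
    \<open>w\<close>.\<close>
  have \<theta>x: "\<theta> (x i) = y (\<pi> i) \<otimes>\<^bsub>?P\<^esub> (0, w)" if i: "i < M.k" for i
  proof -
    have i': "partner q i < M.k" using i by (simp add: partner_less)
    have T: "deg (M.\<beta> i) \<in> T" "deg (M'.\<beta> (\<pi> i)) \<in> T" "v i \<in> T" "v (partner q i) \<in> T"
      using deg_mem(1) M.beta_gr_units M'.beta_gr_units v i i' by auto
    have "\<tau> (inv (deg (M.\<beta> i))) = inv (\<tau> (deg (M.\<beta> i)))"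
      using \<tau>.hom_inv[of "deg (M.\<beta> i)"] T \<tau>T TG_inv by simp
    moreover have "v i \<otimes> v (partner q i) \<otimes> inv (\<tau> (deg (M.\<beta> i))) = inv (deg (M'.\<beta> (\<pi> i))) \<otimes> w"
    proof -
      define a b c d e where "a = \<tau> (deg (M.\<beta> i))" "b = deg (M'.\<beta> (\<pi> i))" "c = v i"
        "d = v (partner q i)" "e = w"
      note abc = this
      have S: "a \<in> T" "b \<in> T" "c \<in> T" "d \<in> T" "e \<in> T" "inv a \<in> T" "inv b \<in> T"
        using T \<tau>T w T_inv_closed by (auto simp: abc)
      have e: "e \<otimes> a = c \<otimes> b \<otimes> d" using shift[OF i] by (simp add: abc)
      have "c \<otimes> d \<otimes> inv a = inv b \<otimes> (c \<otimes> b \<otimes> d) \<otimes> inv a"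
        using S support_carrier support_comm T_mult_closed by (metis m_assoc l_inv l_one)
      also have "\<dots> = inv b \<otimes> e"
        unfolding e[symmetric] using S support_carrier T_mult_closed
        by (metis m_assoc r_inv r_one)
      finally show ?thesis by (simp add: abc)
    qed
    ultimately show ?thesis
      using \<theta>_add[OF i i', of "inv (deg (M.\<beta> i))"] T T_inv_closed
      by (simp add: x_def y_def FT_mult \<pi>\<sigma>[OF i])
  qed
  define X where "X = {x i \<otimes>\<^bsub>?P\<^esub> inv\<^bsub>?P\<^esub> x j | i j. i < M.k \<and> j < M.k}"
  define Y where "Y = {y i \<otimes>\<^bsub>?P\<^esub> inv\<^bsub>?P\<^esub> y j | i j. i < M.k \<and> j < M.k}"
  have NX: "M.N = generate ?P X" "M'.N = generate ?P Y"
    unfolding relation_subgroup_def Let_def M.identified_eq M'.identified_eq X_def Y_def x_def y_def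
    by (intro arg_cong[of _ _ "generate ?P"]; blast)+
  \<comment> \<open>Both elements carry the same factor \<open>w\<close>, which cancels; so
    generators of one relation subgroup go to generators of the other.\<close>
  have \<theta>xx: "\<theta> (x i \<otimes>\<^bsub>?P\<^esub> inv\<^bsub>?P\<^esub> x j) = y (\<pi> i) \<otimes>\<^bsub>?P\<^esub> inv\<^bsub>?P\<^esub> y (\<pi> j)"
    if "i < M.k" "j < M.k" for i j
    using that xc yc \<pi>k wc by (simp add: \<theta>x FT.cancel_common)
  have "\<theta> ` X = Y"
  proof
    show "\<theta> ` X \<subseteq> Y"
    proof
      fix z assume "z \<in> \<theta> ` X"
      then obtain i j where ij: "i < M.k" "j < M.k" "z = \<theta> (x i \<otimes>\<^bsub>?P\<^esub> inv\<^bsub>?P\<^esub> x j)"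
        by (auto simp: X_def)
      then show "z \<in> Y" unfolding Y_def ij(3) \<theta>xx[OF ij(1,2)] using \<pi>k by blast
    qed
    show "Y \<subseteq> \<theta> ` X"
    proof
      fix z assume "z \<in> Y"
      then obtain i j where ij: "i < M.k" "j < M.k" "z = y i \<otimes>\<^bsub>?P\<^esub> inv\<^bsub>?P\<^esub> y j"
        by (auto simp: Y_def)
      have "\<pi> ` {..<M.k} = {..<M.k}" using \<pi> by (simp add: bij_betw_def)
      then have "i \<in> \<pi> ` {..<M.k}" "j \<in> \<pi> ` {..<M.k}" using ij by auto
      then obtain i' j' where "i' < M.k" "\<pi> i' = i" "j' < M.k" "\<pi> j' = j" by auto
      then show "z \<in> \<theta> ` X" using \<theta>xx[of i' j'] ij
        unfolding X_def by (intro image_eqI[of _ _ "x i' \<otimes>\<^bsub>?P\<^esub> inv\<^bsub>?P\<^esub> x j'"]) (simp, blast)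
    qed
  qed
  moreover have "X \<subseteq> carrier ?P" using xc by (auto simp: X_def)
  ultimately have \<theta>N: "\<theta> ` M.N = M'.N"
    using \<theta>.generate_img[of X] by (simp add: NX)
  define a where "a = (frag_of i - frag_of j, t)"
  define b where "b = (frag_of i' - frag_of j', t')"
  have ab: "a \<in> carrier ?P" "b \<in> carrier ?P"
    using ij frag_diff_keys(1) by (auto simp: FT_carrier a_def b_def)
  have "M.ed i j t = M.ed i' j' t' \<longleftrightarrow> a \<otimes>\<^bsub>?P\<^esub> inv\<^bsub>?P\<^esub> b \<in> M.N"
    unfolding entry_degree_def using FT.rcos_eq_iff[OF M.N_subgroup ab] by (simp add: a_def b_def)
  \<comment> \<open>Injectivity gives the direction from right to left, so that distinct degrees
    stay distinct.\<close>
  also have "\<dots> \<longleftrightarrow> \<theta> (a \<otimes>\<^bsub>?P\<^esub> inv\<^bsub>?P\<^esub> b) \<in> \<theta> ` M.N"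
    by (rule inj_on_image_mem_iff[symmetric, OF \<theta>(2) _ subgroup.subset[OF M.N_subgroup]])
      (use ab in simp)
  also have "\<dots> \<longleftrightarrow> \<theta> a \<otimes>\<^bsub>?P\<^esub> inv\<^bsub>?P\<^esub> \<theta> b \<in> M'.N"
    using ab by (simp add: \<theta>N)
  also have "\<dots> \<longleftrightarrow> M'.N #>\<^bsub>?P\<^esub> \<theta> a = M'.N #>\<^bsub>?P\<^esub> \<theta> b"
    using FT.rcos_eq_iff[OF M'.N_subgroup] ab by simp
  also have "\<dots> \<longleftrightarrow> M'.ed (\<pi> i) (\<pi> j) (v i \<otimes> inv (v j) \<otimes> \<tau> t)
      = M'.ed (\<pi> i') (\<pi> j') (v i' \<otimes> inv (v j') \<otimes> \<tau> t')"
    unfolding entry_degree_def using \<theta>_diff ij by (simp add: a_def b_def)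
  finally show ?thesis .
qed

section \<open>Matrices and the involution\<close>

lemma mat_mult_entry:
  assumes "A \<in> carrier_mat n m" "B \<in> carrier_mat m p" "i < n" "j < p"
  shows "(A * B) $$ (i, j) = (\<Sum>l<m. A $$ (i, l) * B $$ (l, j))"
  using assms by (auto simp: scalar_prod_def atLeast0LessThan intro!: sum.cong)

text \<open>\<open>Phi\<close> and its inverse have one nonzero entry in each row and column, so
  every product with them collapses to a single term.\<close>

lemma mat_mult_monomial_left:
  fixes A B :: "'a::semiring_0 mat"
  assumes "A \<in> carrier_mat n m" "B \<in> carrier_mat m p" "i < n" "j < p" "r < m"
    and "\<And>l. l < m \<Longrightarrow> l \<noteq> r \<Longrightarrow> A $$ (i, l) = 0"
  shows "(A * B) $$ (i, j) = A $$ (i, r) * B $$ (r, j)"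
proof -
  have "(\<Sum>l<m. A $$ (i, l) * B $$ (l, j)) = (\<Sum>l\<in>{r}. A $$ (i, l) * B $$ (l, j))"
    using assms(5,6) by (intro sum.mono_neutral_right) auto
  then show ?thesis using mat_mult_entry[OF assms(1-4)] by simp
qed

lemma mat_mult_monomial_right:
  fixes A B :: "'a::semiring_0 mat"
  assumes "A \<in> carrier_mat n m" "B \<in> carrier_mat m p" "i < n" "j < p" "r < m"
    and "\<And>l. l < m \<Longrightarrow> l \<noteq> r \<Longrightarrow> B $$ (l, j) = 0"
  shows "(A * B) $$ (i, j) = A $$ (i, r) * B $$ (r, j)"
proof -
  have "(\<Sum>l<m. A $$ (i, l) * B $$ (l, j)) = (\<Sum>l\<in>{r}. A $$ (i, l) * B $$ (l, j))"
    using assms(5,6) by (intro sum.mono_neutral_right) auto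
  then show ?thesis using mat_mult_entry[OF assms(1-4)] by simp
qed

definition mat_unit :: "nat \<Rightarrow> nat \<Rightarrow> nat \<Rightarrow> 'a::zero \<Rightarrow> 'a mat" where
  "mat_unit n i j d = mat n n (\<lambda>(a, b). if a = i \<and> b = j then d else 0)"

lemma mat_unit_carrier [simp]: "mat_unit n i j d \<in> carrier_mat n n"
  "dim_row (mat_unit n i j d) = n" "dim_col (mat_unit n i j d) = n"
  by (simp_all add: mat_unit_def)

lemma mat_unit_index [simp]:
  "a < n \<Longrightarrow> b < n \<Longrightarrow> mat_unit n i j d $$ (a, b) = (if a = i \<and> b = j then d else 0)"
  by (simp add: mat_unit_def)

lemma mat_unit_inject:
  assumes "i < n" "j < n" shows "mat_unit n i j d = mat_unit n i j e \<longleftrightarrow> d = e"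
  using assms by (metis mat_unit_index)

lemma mat_unit_zero: "mat_unit n i j 0 = 0\<^sub>m n n"
  by (rule eq_matI) auto

lemma mat_unit_eq_zero: "i < n \<Longrightarrow> j < n \<Longrightarrow> mat_unit n i j d = 0\<^sub>m n n \<longleftrightarrow> d = 0"
  by (metis mat_unit_inject mat_unit_zero)

lemma mat_unit_mult_left:
  fixes X :: "'a::semiring_0 mat"
  assumes "X \<in> carrier_mat n n" "i < n" "j < n"
  shows "mat_unit n i j d * X = mat n n (\<lambda>(a, b). if a = i then d * X $$ (j, b) else 0)"
proof (rule eq_matI)
  fix a b assume "a < dim_row (mat n n (\<lambda>(a, b). if a = i then d * X $$ (j, b) else 0))"
    "b < dim_col (mat n n (\<lambda>(a, b). if a = i then d * X $$ (j, b) else 0))"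
  then have ab: "a < n" "b < n" by auto
  have "(mat_unit n i j d * X) $$ (a, b) = mat_unit n i j d $$ (a, j) * X $$ (j, b)"
    by (rule mat_mult_monomial_left[OF mat_unit_carrier(1) assms(1) ab assms(3)]) (use ab in auto)
  then show "(mat_unit n i j d * X) $$ (a, b)
      = mat n n (\<lambda>(a, b). if a = i then d * X $$ (j, b) else 0) $$ (a, b)"
    using ab assms by simp
qed (use assms in auto)

lemma mat_unit_mult_right:
  fixes X :: "'a::semiring_0 mat"
  assumes "X \<in> carrier_mat n n" "i < n" "j < n"
  shows "X * mat_unit n i j d = mat n n (\<lambda>(a, b). if b = j then X $$ (a, i) * d else 0)"
proof (rule eq_matI)
  fix a b assume "a < dim_row (mat n n (\<lambda>(a, b). if b = j then X $$ (a, i) * d else 0))"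
    "b < dim_col (mat n n (\<lambda>(a, b). if b = j then X $$ (a, i) * d else 0))"
  then have ab: "a < n" "b < n" by auto
  have "(X * mat_unit n i j d) $$ (a, b) = X $$ (a, i) * mat_unit n i j d $$ (i, b)"
    by (rule mat_mult_monomial_right[OF assms(1) mat_unit_carrier(1) ab assms(2)]) (use ab in auto)
  then show "(X * mat_unit n i j d) $$ (a, b)
      = mat n n (\<lambda>(a, b). if b = j then X $$ (a, i) * d else 0) $$ (a, b)"
    using ab assms by simp
qed (use assms in auto)

lemma mat_unit_mult:
  fixes d e :: "'a::semiring_0"
  assumes "i < n" "j < n" "l < n" "m < n"
  shows "mat_unit n i j d * mat_unit n l m e = (if j = l then mat_unit n i m (d * e) else 0\<^sub>m n n)"
  using assms by (subst mat_unit_mult_left) (auto intro!: eq_matI)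

lemma mat_unit_sandwich:
  fixes X :: "'a::semiring_1 mat"
  assumes "X \<in> carrier_mat n n" "i < n" "j < n"
  shows "mat_unit n i i 1 * X * mat_unit n j j 1 = mat_unit n i j (X $$ (i, j))"
  using assms by (subst mat_unit_mult_left; simp?; subst mat_unit_mult_right; simp?)
    (auto intro!: eq_matI)

lemma mat_unit_add:
  fixes d e :: "'a::monoid_add"
  shows "mat_unit n i j d + mat_unit n i j e = mat_unit n i j (d + e)"
  by (rule eq_matI) auto

lemma diag_block_mat_pairs_index:
  fixes a b :: "'a::zero"
  assumes "i < 2 * s" "j < 2 * s"
  shows "diag_block_mat (replicate s (mat_of_rows_list 2 [[0, a], [b, 0]])) $$ (i, j)
    = (if j = partner 0 i then if even i then a else b else 0)"
  using assms
proof (induction s arbitrary: i j)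
  case (Suc s)
  have d: "dim_row (diag_block_mat (replicate s (mat_of_rows_list 2 [[0, a], [b, 0]]))) = 2 * s"
    "dim_col (diag_block_mat (replicate s (mat_of_rows_list 2 [[0, a], [b, 0]]))) = 2 * s"
    by (simp_all add: dim_diag_block_mat mat_of_rows_list_def sum_list_replicate)
  have B: "mat_of_rows_list 2 [[0, a], [b, 0]] $$ (i, j) = [[0, a], [b, 0]] ! i ! j"
    if "i < 2" "j < 2" for i j using that by (simp add: mat_of_rows_list_def)
  have dB: "dim_row (mat_of_rows_list 2 [[0, a], [b, 0]]) = 2"
    "dim_col (mat_of_rows_list 2 [[0, a], [b, 0]]) = 2"
    by (simp_all add: mat_of_rows_list_def)
  consider "i < 2" "j < 2" | "i < 2" "\<not> j < 2" | "\<not> i < 2" "j < 2" | "\<not> i < 2" "\<not> j < 2" by blast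
  then show ?case
  proof cases
    case 1
    then have "i = 0 \<or> i = 1" "j = 0 \<or> j = 1" by auto
    then show ?thesis by (auto simp: Let_def d dB B partner_def)
  next
    case 2
    then have "i = 0 \<or> i = 1" by auto
    then show ?thesis using 2 Suc.prems by (auto simp: Let_def d dB partner_def)
  next
    case 3
    have "2 \<le> partner 0 i"
      using 3(1) by (cases i "0::nat" rule: index_cases) (auto simp: partner_def)
    then show ?thesis using 3 Suc.prems by (auto simp: Let_def d dB)
  next
    case 4
    define i' j' where "i' = i - 2" "j' = j - 2"
    then have ij: "i = Suc (Suc i')" "j = Suc (Suc j')" using 4 by auto
    have "j = partner 0 i \<longleftrightarrow> j' = partner 0 i'"
      by (cases i' "0::nat" rule: index_cases) (auto simp: ij partner_def)
    then show ?thesis using 4 Suc.prems Suc.IH[of i' j'] by (simp add: Let_def d dB ij)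
  qed
qed auto

lemma Phi_carrier: "Phi scale s ds \<delta> \<in> carrier_mat (length ds + 2 * s) (length ds + 2 * s)"
  by (rule carrier_matI)
    (simp_all add: Phi_def dim_diag_block_mat mat_of_rows_list_def comp_def sum_list_replicate
      sum_list_triv)

lemma Phi_index:
  assumes "i < length ds + 2 * s" "j < length ds + 2 * s"
  shows "Phi scale s ds \<delta> $$ (i, j) =
    (if j = partner (length ds) i
     then if i < length ds then ds ! i else if even (i - length ds) then 1 else scale \<delta> 1 else 0)"
  using assms
proof (induction ds arbitrary: i j)
  case Nil
  then show ?case by (simp add: Phi_def diag_block_mat_pairs_index)
next
  case (Cons d ds)
  have P: "Phi scale s (d # ds) \<delta> =
    four_block_mat (mat_of_rows_list 1 [[d]]) (0\<^sub>m 1 (length ds + 2 * s))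
      (0\<^sub>m (length ds + 2 * s) 1) (Phi scale s ds \<delta>)"
    using Phi_carrier[of scale s ds \<delta>]
    by (simp add: Phi_def Let_def mat_of_rows_list_def)
  \<comment> \<open>Removing the leading block of size 1 lowers \<open>q\<close> and all indices by
    one, and \<open>partner\<close> shifts along.\<close>
  have p: "partner (Suc n) 0 = 0" "partner (Suc n) (Suc a) = Suc (partner n a)" for n a
    by (auto simp: partner_def) (metis Suc_pred diff_0_eq_0 even_zero neq0_conv)
  show ?case
    using Cons Phi_carrier[of scale s ds \<delta>]
    by (cases i; cases j) (auto simp: P p mat_of_rows_list_def)
qed

section \<open>The involution and the components in coordinates\<close>

context M_algebra_data
begin

lemma map_mat_scale_unit: "map_mat (scale a) (mat_unit n i j d) = mat_unit n i j (scale a d)"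
  by (rule eq_matI) auto

lemma Phi_entry:
  assumes "i < k" "j < k"
  shows "Phi scale s ds \<delta> $$ (i, j) = (if j = \<sigma> i then \<beta> i else 0)"
  using Phi_index[of i ds s j scale \<delta>] assms ds_props(3) by (simp add: \<beta>_def)

lemma Phi_carrier_k: "Phi scale s ds \<delta> \<in> carrier_mat k k"
  using Phi_carrier[of scale s ds \<delta>] ds_props(3) by simp

definition Phi_inverse :: "'d mat" where
  "Phi_inverse = mat k k (\<lambda>(i, j). if j = \<sigma> i then inve (\<beta> j) else 0)"

lemma inv_Phi: "inv\<^bsub>ring_mat TYPE('d) k ()\<^esub> (Phi scale s ds \<delta>) = Phi_inverse"
proof -
  interpret R: semiring "ring_mat TYPE('d) k ()" by (rule semiring_mat)
  have P: "Phi_inverse \<in> carrier_mat k k" by (simp add: Phi_inverse_def)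
  have "Phi scale s ds \<delta> * Phi_inverse = 1\<^sub>m k"
  proof (rule eq_matI)
    fix i j assume "i < dim_row (1\<^sub>m k :: 'd mat)" "j < dim_col (1\<^sub>m k :: 'd mat)"
    then have ij: "i < k" "j < k" by auto
    have "(Phi scale s ds \<delta> * Phi_inverse) $$ (i, j)
        = Phi scale s ds \<delta> $$ (i, \<sigma> i) * Phi_inverse $$ (\<sigma> i, j)"
      by (rule mat_mult_monomial_left[OF Phi_carrier_k P ij])
        (use ij in \<open>simp_all add: Phi_entry partner_less\<close>)
    then show "(Phi scale s ds \<delta> * Phi_inverse) $$ (i, j) = 1\<^sub>m k $$ (i, j)"
      using ij by (auto simp: Phi_entry partner_less Phi_inverse_def partner_partner
          inve[OF beta_gr_units])
  qed (use P Phi_carrier_k in auto)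
  moreover have "Phi_inverse * Phi scale s ds \<delta> = 1\<^sub>m k"
  proof (rule eq_matI)
    fix i j assume "i < dim_row (1\<^sub>m k :: 'd mat)" "j < dim_col (1\<^sub>m k :: 'd mat)"
    then have ij: "i < k" "j < k" by auto
    have "(Phi_inverse * Phi scale s ds \<delta>) $$ (i, j)
        = Phi_inverse $$ (i, \<sigma> i) * Phi scale s ds \<delta> $$ (\<sigma> i, j)"
      by (rule mat_mult_monomial_left[OF P Phi_carrier_k ij])
        (use ij in \<open>simp_all add: Phi_inverse_def partner_less\<close>)
    then show "(Phi_inverse * Phi scale s ds \<delta>) $$ (i, j) = 1\<^sub>m k $$ (i, j)"
      using ij by (auto simp: Phi_entry partner_less Phi_inverse_def partner_partner
          inve[OF beta_gr_units])
  qed (use P Phi_carrier_k in auto)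
  ultimately show ?thesis
    using R.inv_unique'[of "Phi scale s ds \<delta>" Phi_inverse] P Phi_carrier_k
    by (simp add: ring_mat_simps)
qed

abbreviation "Mi \<equiv> M_involution scale \<phi> q s ds \<delta>"

lemma Mi_carrier: "X \<in> carrier_mat k k \<Longrightarrow> Mi X \<in> carrier_mat k k"
  unfolding M_involution_def inv_Phi using Phi_carrier_k
  by (auto simp: Phi_inverse_def intro!: mult_carrier_mat)

lemma Mi_entry:
  assumes X: "X \<in> carrier_mat k k" and ab: "a < k" "b < k"
  shows "Mi X $$ (a, b) = inve (\<beta> (\<sigma> a)) * \<phi> (X $$ (\<sigma> b, \<sigma> a)) * \<beta> (\<sigma> b)"
proof -
  let ?Y = "map_mat \<phi> (transpose_mat X)"
  have s: "\<sigma> a < k" "\<sigma> b < k" using ab by (simp_all add: partner_less)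
  have P: "Phi_inverse \<in> carrier_mat k k" by (simp add: Phi_inverse_def)
  have Y: "?Y \<in> carrier_mat k k" using X by auto
  have PY: "Phi_inverse * ?Y \<in> carrier_mat k k" using P Y by (rule mult_carrier_mat)
  have "Mi X $$ (a, b) = (Phi_inverse * ?Y) $$ (a, \<sigma> b) * Phi scale s ds \<delta> $$ (\<sigma> b, b)"
    unfolding M_involution_def inv_Phi
    by (rule mat_mult_monomial_right[OF PY Phi_carrier_k ab s(2)])
      (use ab in \<open>auto simp: Phi_entry partner_partner\<close>)
  also have "(Phi_inverse * ?Y) $$ (a, \<sigma> b) = Phi_inverse $$ (a, \<sigma> a) * ?Y $$ (\<sigma> a, \<sigma> b)"
    by (rule mat_mult_monomial_left[OF P Y ab(1) s(2) s(1)])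
      (use ab s in \<open>auto simp: Phi_inverse_def\<close>)
  finally show ?thesis using ab s X
    by (simp add: Phi_entry partner_partner Phi_inverse_def)
qed

lemma Mi_mat_unit:
  assumes "i < k" "j < k"
  shows "Mi (mat_unit k i j d) = mat_unit k (\<sigma> j) (\<sigma> i) (inve (\<beta> j) * \<phi> d * \<beta> i)"
proof (rule eq_matI)
  fix a b assume "a < dim_row (mat_unit k (\<sigma> j) (\<sigma> i) (inve (\<beta> j) * \<phi> d * \<beta> i))"
    "b < dim_col (mat_unit k (\<sigma> j) (\<sigma> i) (inve (\<beta> j) * \<phi> d * \<beta> i))"
  then have ab: "a < k" "b < k" by simp_all
  have e: "\<sigma> b = i \<longleftrightarrow> b = \<sigma> i" "\<sigma> a = j \<longleftrightarrow> a = \<sigma> j" using partner_partner by metis+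
  show "Mi (mat_unit k i j d) $$ (a, b)
      = mat_unit k (\<sigma> j) (\<sigma> i) (inve (\<beta> j) * \<phi> d * \<beta> i) $$ (a, b)"
    using ab by (auto simp: Mi_entry partner_less e partner_partner phi.zero)
qed (use Mi_carrier[OF mat_unit_carrier(1)] in auto)

text \<open>By \<open>ed_diag\<close> only diagonal positions can have a degree coming from
  \<open>T\<close>, and by \<open>ed_diag_eq\<close> all of them share it. For the neutral
  \<open>t\<close> this is the identity component.\<close>

lemma comp_diag_iff:
  assumes "t \<in> T"
  shows "X \<in> Mc (ed 0 0 t) \<longleftrightarrow> X \<in> carrier_mat k k
    \<and> (\<forall>i<k. \<forall>j<k. if i = j then X $$ (i, j) \<in> D t else X $$ (i, j) = 0)"
proof -
  have "(x = 0 \<or> (\<exists>u\<in>T. ed i j u = ed 0 0 t \<and> x \<in> D u)) \<longleftrightarrow> (if i = j then x \<in> D t else x = 0)"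
    if "i < k" "j < k" for i j x
    using that ed_diag[OF that k_pos _ assms] ed_diag_eq[OF that(1) k_pos assms] assms
      zero_in[OF support_carrier[OF assms]] by (auto split: if_splits)
  then show ?thesis unfolding comp_iff by blast
qed

lemma mat_unit_comp:
  assumes "i < k" "j < k" "t \<in> T" "d \<in> D t" shows "mat_unit k i j d \<in> Mc (ed i j t)"
  using assms by (auto simp: comp_iff)

lemma comp_entry:
  assumes "X \<in> Mc g" "i < k" "j < k" "X $$ (i, j) \<noteq> 0"
  shows "X $$ (i, j) \<in> U" "ed i j (deg (X $$ (i, j))) = g"
proof -
  obtain t where t: "t \<in> T" "ed i j t = g" "X $$ (i, j) \<in> D t" using assms comp_iff by blast
  then show "X $$ (i, j) \<in> U" "ed i j (deg (X $$ (i, j))) = g"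
    using gr_unitsI[OF support_carrier[OF t(1)] t(3) assms(4)]
      deg_eqI[OF support_carrier[OF t(1)] t(3) assms(4)] by simp_all
qed

lemma comp_iff_deg:
  "X \<in> Mc g \<longleftrightarrow> X \<in> carrier_mat k k \<and> (\<forall>i<k. \<forall>j<k. X $$ (i, j) = 0 \<or>
    (X $$ (i, j) \<in> U \<and> ed i j (deg (X $$ (i, j))) = g))"
proof
  assume X: "X \<in> Mc g"
  then show "X \<in> carrier_mat k k \<and> (\<forall>i<k. \<forall>j<k. X $$ (i, j) = 0 \<or>
      (X $$ (i, j) \<in> U \<and> ed i j (deg (X $$ (i, j))) = g))"
    using comp_entry[OF X] comp_iff[of X g] by blast
next
  assume "X \<in> carrier_mat k k \<and> (\<forall>i<k. \<forall>j<k. X $$ (i, j) = 0 \<or>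
      (X $$ (i, j) \<in> U \<and> ed i j (deg (X $$ (i, j))) = g))"
  then show "X \<in> Mc g" unfolding comp_iff using deg_mem by blast
qed

end

section \<open>Central simplicity\<close>

lemma ideal_type_ringD:
  fixes I :: "'d::ring_1 set"
  assumes "ideal I (type_ring :: 'd ring)"
  shows "0 \<in> I" "x \<in> I \<Longrightarrow> y \<in> I \<Longrightarrow> x + y \<in> I" "x \<in> I \<Longrightarrow> a * x \<in> I" "x \<in> I \<Longrightarrow> x * a \<in> I"
  using additive_subgroup.zero_closed[OF ideal.axioms(1)[OF assms]]
    additive_subgroup.a_closed[OF ideal.axioms(1)[OF assms], of x y]
    ideal.I_l_closed[OF assms, of x a] ideal.I_r_closed[OF assms, of x a]
  by auto

context graded_division_inv
begin

text \<open>Without simplicity, \<open>D\<close> would be the sum of a proper ideal and its image under the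
  involution, and the corresponding idempotent would be a nontrivial central element.\<close>

lemma simple_if_central:
  assumes cs: "central_simple_inv scale \<phi>" and central: "(center :: 'd set) = scalars scale"
  shows "simple_ring TYPE('d)"
  unfolding simple_ring_def
proof (intro allI impI)
  fix I assume I: "ideal I (type_ring :: 'd ring)"
  note D = ideal_type_ringD[OF I]
  have full: "I = UNIV" if "1 \<in> I" using D(3)[OF that] by auto
  have sub: "J = {0} \<or> J = UNIV" if "ideal J type_ring" "\<phi> ` J \<subseteq> J" for J
    using cs that by (auto simp: central_simple_inv_def)
  have \<phi>I: "a * \<phi> y \<in> \<phi> ` I" "\<phi> y * a \<in> \<phi> ` I" if "y \<in> I" for a y
  proof -
    have "\<phi> (y * \<phi> a) \<in> \<phi> ` I" "\<phi> (\<phi> a * y) \<in> \<phi> ` I" using D(3,4) that by auto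
    then show "a * \<phi> y \<in> \<phi> ` I" "\<phi> y * a \<in> \<phi> ` I" by (simp_all add: phi_mult phi_phi)
  qed
  \<comment> \<open>The intersection and the sum of \<open>I\<close> and its image are both
    invariant, so each of them is zero or everything.\<close>
  have "ideal (I \<inter> \<phi> ` I) type_ring"
  proof (rule ideal_type_ringI)
    show "0 \<in> I \<inter> \<phi> ` I" using D(1) phi.zero by (metis IntI imageI)
    show "x + y \<in> I \<inter> \<phi> ` I" if "x \<in> I \<inter> \<phi> ` I" "y \<in> I \<inter> \<phi> ` I" for x y
      using that D(2) by (auto simp flip: phi.add)
  qed (use D \<phi>I in auto)
  moreover have "\<phi> ` (I \<inter> \<phi> ` I) \<subseteq> I \<inter> \<phi> ` I" by (auto simp: phi_phi)
  ultimately have "I \<inter> \<phi> ` I = {0} \<or> I \<inter> \<phi> ` I = UNIV" by (rule sub)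
  then show "I = {0} \<or> I = UNIV"
  proof
    assume disj: "I \<inter> \<phi> ` I = {0}"
    let ?S = "{x + \<phi> y | x y. x \<in> I \<and> y \<in> I}"
    have "ideal ?S type_ring"
    proof (rule ideal_type_ringI)
      show "0 \<in> ?S" using D(1) phi.zero by force
      fix x y assume "x \<in> ?S" "y \<in> ?S"
      then obtain a b c d where *: "x = a + \<phi> b" "y = c + \<phi> d" "a \<in> I" "b \<in> I" "c \<in> I" "d \<in> I"
        by blast
      then have "x + y = (a + c) + \<phi> (b + d)" by (simp add: phi.add)
      then show "x + y \<in> ?S" using * D(2) by blast
    next
      fix a x assume "x \<in> ?S"
      then obtain b c where *: "x = b + \<phi> c" "b \<in> I" "c \<in> I" by blast
      have "a * x = a * b + \<phi> (c * \<phi> a)" "x * a = b * a + \<phi> (\<phi> a * c)"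
        by (simp_all add: * phi_mult phi_phi algebra_simps)
      then show "a * x \<in> ?S" "x * a \<in> ?S" using * D(3,4) by blast+
    qed
    moreover have "\<phi> ` ?S \<subseteq> ?S"
    proof
      fix z assume "z \<in> \<phi> ` ?S"
      then obtain b c where "z = \<phi> (b + \<phi> c)" "b \<in> I" "c \<in> I" by blast
      then have "z = c + \<phi> b" "b \<in> I" "c \<in> I" by (simp_all add: phi.add phi_phi add.commute)
      then show "z \<in> ?S" by blast
    qed
    ultimately have "?S = {0} \<or> ?S = UNIV" by (rule sub)
    then show ?thesis
    proof
      assume S: "?S = {0}"
      have "x \<in> ?S" if "x \<in> I" for x
        using that D(1) phi.zero by (intro CollectI exI[of _ x] exI[of _ 0]) simp
      then show ?thesis using S D(1) by blast
    next
      assume "?S = UNIV"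
      then have "1 \<in> ?S" by blast
      then obtain x y where xy: "1 = x + \<phi> y" "x \<in> I" "y \<in> I" by blast
      \<comment> \<open>Such products lie in \<open>I\<close> and in its image, hence in the zero
        intersection.\<close>
      have z: "a * \<phi> y = 0" "\<phi> y * a = 0" if "a \<in> I" for a
        using \<phi>I[OF xy(3), of a] D(3,4)[OF that, of "\<phi> y"] disj by blast+
      have "x * z = z * x" for z
      proof -
        have "x * z = x * z * (x + \<phi> y)" by (simp flip: xy(1))
        also have "\<dots> = x * z * x" using z(1)[OF D(4)[OF xy(2)]] by (simp add: distrib_left)
        also have "\<dots> = (x + \<phi> y) * (z * x)"
          using z(2)[OF D(3)[OF xy(2)]] by (simp add: distrib_right mult.assoc)
        finally show ?thesis by (simp flip: xy(1))
      qed
      then have "x \<in> scalars scale" unfolding central[symmetric] by (simp add: center_def)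
      \<comment> \<open>Since \<open>x\<close> is a scalar, either \<open>x\<close> vanishes and
        \<open>y\<close> is 1, or \<open>x\<close> is invertible; both put 1 into
        \<open>I\<close>.\<close>
      then obtain a where a: "x = scale a 1" by (auto simp: scalars_def)
      show ?thesis
      proof (cases "a = 0")
        case True
        then have "1 = y" using xy a phi_one phi_phi by (metis add_0 scale_zero_left)
        then show ?thesis using full xy by blast
      next
        case False
        then have "1 = scale (1 / a) 1 * x" by (simp add: a scale_one_mult)
        then show ?thesis using full D(3) xy(2) by metis
      qed
    qed
  qed auto
qed

text \<open>By the Skolem-Noether theorem \<open>\<psi>\<close> is conjugation by some \<open>w\<close>, and then
  \<open>\<phi>(w) u w\<close> is central, hence symmetric.\<close>

lemma twist_symmetric:
  assumes cs: "central_simple_inv scale \<phi>" and central: "(center :: 'd set) = scalars scale"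
    and fd: "finite_dimensional scale"
    and \<psi>: "Vector_Spaces.linear scale scale \<psi>" "\<And>x y. \<psi> (x * y) = \<psi> x * \<psi> y" "\<psi> 1 = 1" "surj \<psi>"
    and u: "u \<in> U" and twist: "\<And>x. \<phi> (\<psi> x) = u * \<psi> (\<phi> x) * inve u"
  shows "\<phi> u = u"
proof -
  obtain w w' where w: "w * w' = 1" "w' * w = 1" "\<And>c. \<psi> c * w = w * c"
    using skolem_noether[OF simple_if_central[OF cs central] central fd \<psi>] by metis
  have \<psi>w: "\<psi> c = w * c * w'" for c
    using w(3)[of c] w(1) by (metis mult.assoc mult_1_right)
  have \<phi>w: "\<phi> w * \<phi> w' = 1" "\<phi> w' * \<phi> w = 1" using w phi_mult phi_one by metis+
  define z where "z = \<phi> w * u * w"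
  have "z * y = y * z" for y
  proof -
    \<comment> \<open>The twist relation at \<open>\<phi> y\<close> with \<open>\<psi>\<close>
      replaced by conjugation with \<open>w\<close>. Multiplying by \<open>\<phi> w\<close> on the
      left and \<open>u * w\<close> on the right turns it into the commutation of \<open>z\<close>
      and \<open>y\<close>.\<close>
    have "\<phi> w' * y * \<phi> w = u * w * y * w' * inve u"
      using twist[of "\<phi> y"] by (simp add: \<psi>w phi_mult phi_phi mult.assoc)
    then have "\<phi> w * (\<phi> w' * y * \<phi> w) * (u * w) = \<phi> w * (u * w * y * w' * inve u) * (u * w)"
      by simp
    also have "\<dots> = z * y * (w' * (inve u * (u * w)))" by (simp add: z_def mult.assoc)
    also have "\<dots> = z * y" by (simp add: inve_assoc[OF u] w)
    also have "\<phi> w * (\<phi> w' * y * \<phi> w) * (u * w) = (\<phi> w * \<phi> w') * (y * z)"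
      by (simp add: z_def mult.assoc)
    finally show ?thesis by (simp add: \<phi>w)
  qed
  then have "z \<in> scalars scale" unfolding central[symmetric] by (simp add: center_def)
  then obtain a where "z = scale a 1" by (auto simp: scalars_def)
  \<comment> \<open>The involution is linear and fixes 1, hence fixes scalars. Cancelling the outer
    factors of \<open>z\<close> leaves the claim for \<open>u\<close>.\<close>
  then have "\<phi> z = z" by (simp add: phi.scale phi_one)
  then have "\<phi> w * \<phi> u * w = \<phi> w * u * w" by (simp add: z_def phi_mult phi_phi mult.assoc)
  then have "\<phi> w' * (\<phi> w * \<phi> u * w) * w' = \<phi> w' * (\<phi> w * u * w) * w'" by simp
  then have "(\<phi> w' * \<phi> w) * \<phi> u * (w * w') = (\<phi> w' * \<phi> w) * u * (w * w')"
    by (simp only: mult.assoc)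
  then show ?thesis by (simp add: \<phi>w w)
qed

text \<open>Surjectivity on components: compare the homogeneous parts of a preimage of a
  homogeneous element.\<close>

lemma permutes_components:
  assumes lin: "Vector_Spaces.linear scale scale \<psi>" and bij: "bij \<psi>"
    and comp: "\<And>t. t \<in> T \<Longrightarrow> \<exists>u\<in>T. \<psi> ` D t = D u"
  shows "bij_betw ((`) \<psi>) (D ` T) (D ` T)"
proof -
  interpret \<psi>: Vector_Spaces.linear scale scale \<psi> by (rule lin)
  have inj: "inj_on ((`) \<psi>) A" for A using bij by (simp add: inj_on_def inj_image_eq_iff[OF bij_is_inj[OF bij]])
  obtain \<tau> where \<tau>: "\<And>t. t \<in> T \<Longrightarrow> \<tau> t \<in> T" "\<And>t. t \<in> T \<Longrightarrow> \<psi> ` D t = D (\<tau> t)"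
    using comp by metis
  have \<tau>_inj: "t = u" if "t \<in> T" "u \<in> T" "\<tau> t = \<tau> u" for t u
  proof -
    have "\<psi> ` D t = \<psi> ` D u" using that \<tau> by simp
    then have "D t = D u" by (simp add: inj_image_eq_iff[OF bij_is_inj[OF bij]])
    then show ?thesis using gr_units_obtain[OF that(1)] components_disjoint[of t u]
      by (metis gr_units_nonzero support_carrier that(1,2))
  qed
  have "D u \<in> (`) \<psi> ` (D ` T)" if u: "u \<in> T" for u
  proof -
    obtain y where y: "y \<in> U" "y \<in> D u" using gr_units_obtain[OF u] by blast
    obtain x where x: "y = \<psi> x" using bij by (metis bij_pointE)
    obtain A f where A: "finite A" "A \<subseteq> carrier G" "\<And>t. t \<in> carrier G \<Longrightarrow> f t \<in> D t"
      "x = (\<Sum>t\<in>A. f t)" using obtain_decomp[of x] by metis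
    \<comment> \<open>Homogeneous parts in degrees outside the support are zero, and
      \<open>\<tau>\<close> is controlled on the support only.\<close>
    define B where "B = A \<inter> T"
    have f0: "f t = 0" if "t \<in> A - B" for t
      using that A(2) A(3)[of t] by (auto simp: B_def support_def)
    have "x = (\<Sum>t\<in>B. f t)"
      unfolding A(4) using A(1) f0 by (intro sum.mono_neutral_right) (auto simp: B_def)
    then have yB: "y = (\<Sum>t\<in>B. \<psi> (f t))" by (simp add: x \<psi>.sum)
    have injB: "inj_on \<tau> B" using \<tau>_inj by (auto simp: inj_on_def B_def)
    have yt: "y = (\<Sum>v\<in>\<tau> ` B. \<psi> (f (inv_into B \<tau> v)))"
      unfolding yB using injB by (subst sum.reindex) auto
    \<comment> \<open>Distinct parts of \<open>x\<close> land in distinct components. If none of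
      these had degree \<open>u\<close>, uniqueness of the decomposition of \<open>y\<close> would
      make all of them vanish.\<close>
    have "u \<in> \<tau> ` B"
    proof (rule ccontr)
      assume nu: "u \<notin> \<tau> ` B"
      have "\<psi> (f (inv_into B \<tau> v)) = 0" if v: "v \<in> \<tau> ` B" for v
      proof (rule decomp_unique[of "\<tau> ` B" "\<lambda>v. \<psi> (f (inv_into B \<tau> v))" u v])
        show "finite (\<tau> ` B)" using A(1) by (simp add: B_def)
        show "\<tau> ` B \<subseteq> carrier G" using \<tau>(1) support_carrier by (auto simp: B_def)
        show "\<psi> (f (inv_into B \<tau> t)) \<in> D t" if "t \<in> \<tau> ` B" for t
        proof -
          obtain b where b: "b \<in> B" "t = \<tau> b" using \<open>t \<in> \<tau> ` B\<close> by blast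
          have "f b \<in> D b" using A(2,3) b(1) by (auto simp: B_def)
          then have "\<psi> (f b) \<in> D (\<tau> b)" using \<tau>(2)[of b] b(1) by (auto simp: B_def)
          then show ?thesis using inv_into_f_f[OF injB b(1)] b by simp
        qed
        show "u \<in> carrier G" using u support_carrier by blast
        show "(\<Sum>v\<in>\<tau> ` B. \<psi> (f (inv_into B \<tau> v))) \<in> D u" using y(2) yt by simp
        show "v \<noteq> u" using nu v by blast
      qed (rule v)
      then have "y = 0" using yt by simp
      then show False using y(1) gr_units_nonzero by blast
    qed
    then obtain t where "t \<in> T" "u = \<tau> t" by (auto simp: B_def)
    then show ?thesis using \<tau>(2)[of t] by auto
  qed
  then have "D ` T \<subseteq> (`) \<psi> ` (D ` T)" by blast
  moreover have "(`) \<psi> ` (D ` T) \<subseteq> D ` T" using comp by blast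
  ultimately have "(`) \<psi> ` (D ` T) = D ` T" by (rule equalityI[rotated])
  then show ?thesis using inj by (simp add: bij_betw_def)
qed

end

section \<open>The data of an equivalence\<close>

locale M_equivalence = graded_division_inv scale G D \<phi>
  + M: M_algebra_data scale G D \<phi> q s ds \<delta>
  + M': M_algebra_data scale G D \<phi> q' s' ds' \<delta>'
  for scale :: "'f::field \<Rightarrow> 'd::ring_1 \<Rightarrow> 'd"
    and G :: "('g, 'm) monoid_scheme" (structure)
    and D :: "'g \<Rightarrow> 'd set"
    and \<phi> :: "'d \<Rightarrow> 'd"
    and q s ds \<delta> q' s' ds' \<delta>' +
  fixes \<psi> :: "'d mat \<Rightarrow> 'd mat"
  assumes equiv: "equivalence (M_algebra scale G D \<phi> q s ds \<delta>) (M_algebra scale G D \<phi> q' s' ds' \<delta>') \<psi>"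
begin

abbreviation "C \<equiv> carrier_mat M.k M.k"
abbreviation "C' \<equiv> carrier_mat M'.k M'.k"
abbreviation "E \<equiv> mat_unit M.k"
abbreviation "E' \<equiv> mat_unit M'.k"

lemma psi_bij: "bij_betw \<psi> C C'"
  and psi_mult: "X \<in> C \<Longrightarrow> Y \<in> C \<Longrightarrow> \<psi> (X * Y) = \<psi> X * \<psi> Y"
  and psi_add: "X \<in> C \<Longrightarrow> Y \<in> C \<Longrightarrow> \<psi> (X + Y) = \<psi> X + \<psi> Y"
  and psi_one: "\<psi> (1\<^sub>m M.k) = 1\<^sub>m M'.k"
  and psi_scale: "X \<in> C \<Longrightarrow> \<psi> (map_mat (scale a) X) = map_mat (scale a) (\<psi> X)"
  and psi_Mi: "X \<in> C \<Longrightarrow> \<psi> (M.Mi X) = M'.Mi (\<psi> X)"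
  using equiv by (auto simp: equivalence_def M_algebra_def ring_iso_def Ring.ring_hom_def)

lemma psi_component:
  assumes "g \<in> carrier (G_tilde G D q s ds)" "M.Mc g \<noteq> {0\<^sub>m M.k M.k}"
  shows "\<exists>h. \<psi> ` M.Mc g = M'.Mc h"
proof -
  have "\<forall>g \<in> carrier (G_tilde G D q s ds). M.Mc g \<noteq> {0\<^sub>m M.k M.k} \<longrightarrow>
      (\<exists>h \<in> carrier (G_tilde G D q' s' ds'). \<psi> ` M.Mc g = M'.Mc h)"
    using equiv by (simp add: equivalence_def M_algebra_def)
  then show ?thesis using assms by blast
qed

lemma psi_C: "X \<in> C \<Longrightarrow> \<psi> X \<in> C'"
  using psi_bij by (auto simp: bij_betw_def)

lemma psi_inj: "X \<in> C \<Longrightarrow> Y \<in> C \<Longrightarrow> \<psi> X = \<psi> Y \<longleftrightarrow> X = Y"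
  using psi_bij by (auto simp: bij_betw_def inj_on_def)

lemma psi_zero: "\<psi> (0\<^sub>m M.k M.k) = 0\<^sub>m M'.k M'.k"
proof -
  have "\<psi> (0\<^sub>m M.k M.k) + \<psi> (0\<^sub>m M.k M.k) = \<psi> (0\<^sub>m M.k M.k)"
    using psi_add[of "0\<^sub>m M.k M.k" "0\<^sub>m M.k M.k"] by simp
  moreover have "\<psi> (0\<^sub>m M.k M.k) \<in> C'" by (rule psi_C) simp
  ultimately have "\<psi> (0\<^sub>m M.k M.k) $$ (i, j) = 0" if "i < M'.k" "j < M'.k" for i j
    using that by (metis add_cancel_right_left carrier_matD index_add_mat(1))
  then show ?thesis using \<open>\<psi> (0\<^sub>m M.k M.k) \<in> C'\<close> by (intro eq_matI) auto
qed

lemma psi_ed: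
  assumes "i < M.k" "j < M.k" "t \<in> T"
  obtains h where "\<psi> ` M.Mc (M.ed i j t) = M'.Mc h"
proof -
  obtain x where x: "x \<in> U" "x \<in> D t" using gr_units_obtain[OF assms(3)] by blast
  then have "E i j x \<in> M.Mc (M.ed i j t)" "E i j x \<noteq> 0\<^sub>m M.k M.k"
    using M.mat_unit_comp[OF assms] mat_unit_eq_zero[OF assms(1,2)] gr_units_nonzero by auto
  then show ?thesis using psi_component[OF M.ed_carrier[OF assms]] that by blast
qed

text \<open>The component containing the identity matrix goes to some component, which must contain
  the identity matrix again; a diagonal entry 1 determines its degree.\<close>

lemma psi_identity_component: "\<psi> ` M.Mc (M.ed 0 0 \<one>) = M'.Mc (M'.ed 0 0 \<one>)"
proof -
  obtain h where h: "\<psi> ` M.Mc (M.ed 0 0 \<one>) = M'.Mc h"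
    using psi_ed[OF M.k_pos M.k_pos T_one_closed] .
  have "1\<^sub>m M.k \<in> M.Mc (M.ed 0 0 \<one>)"
    using one_homogeneous by (subst M.comp_diag_iff[OF T_one_closed]) auto
  then have "1\<^sub>m M'.k \<in> M'.Mc h" using h psi_one by (metis imageI)
  then have "M'.ed 0 0 \<one> = h"
    using M'.comp_entry(2)[of "1\<^sub>m M'.k" h 0 0] M'.k_pos deg_one by auto
  then show ?thesis using h by simp
qed

section \<open>Diagonal idempotents and the permutation of the indices\<close>

lemma idempotent_in_identity_component:
  assumes x: "x \<in> D \<one>" "x * x = x" "x \<noteq> 0" shows "x = 1"
  using gr_units_cancel(1)[OF gr_unitsI[OF one_closed x(1,3)], of x 1] x(2) by simp

text \<open>The preimage \<open>Y\<close> is a nonzero diagonal idempotent over a division ring, so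
  some diagonal entry is 1. The matrix unit there lies below \<open>Y\<close>, so its image is a
  nonzero idempotent of the identity component below \<open>E' p p 1\<close>, which leaves only
  \<open>E' p p 1\<close> itself.\<close>

lemma psi_idempotent_preimage:
  assumes p: "p < M'.k" obtains i where "i < M.k" "\<psi> (E i i 1) = E' p p 1"
proof -
  have "E' p p 1 \<in> M'.Mc (M'.ed 0 0 \<one>)"
    using M'.mat_unit_comp[OF p p T_one_closed one_homogeneous] M'.ed_diag_eq[OF p M'.k_pos T_one_closed]
    by simp
  then obtain Y where Y: "Y \<in> M.Mc (M.ed 0 0 \<one>)" "\<psi> Y = E' p p 1"
    using psi_identity_component by (metis imageE)
  have YC: "Y \<in> C" and Yd: "\<And>i. i < M.k \<Longrightarrow> Y $$ (i, i) \<in> D \<one>"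
    and Y0: "\<And>i j. i < M.k \<Longrightarrow> j < M.k \<Longrightarrow> i \<noteq> j \<Longrightarrow> Y $$ (i, j) = 0"
    using Y(1) unfolding M.comp_diag_iff[OF T_one_closed] by auto
  have "\<psi> (Y * Y) = \<psi> Y" using p by (simp add: psi_mult YC Y(2) mat_unit_mult)
  then have YY: "Y * Y = Y" using psi_inj YC mult_carrier_mat by blast
  have "Y \<noteq> 0\<^sub>m M.k M.k" using Y(2) psi_zero p by (metis mat_unit_eq_zero zero_neq_one)
  then obtain i where i: "i < M.k" "Y $$ (i, i) \<noteq> 0"
    using YC Y0 by (metis carrier_matD eq_matI index_zero_mat)
  have "(Y * Y) $$ (i, i) = Y $$ (i, i) * Y $$ (i, i)"
    by (rule mat_mult_monomial_left[OF YC YC i(1) i(1) i(1)]) (use Y0 i in auto)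
  then have Yii: "Y $$ (i, i) = 1"
    using idempotent_in_identity_component[OF Yd[OF i(1)]] YY i(2) by simp
  have "E i i 1 * Y = E i i 1"
    using YC i Y0 Yii by (subst mat_unit_mult_left) (auto intro!: eq_matI)
  \<comment> \<open>This kills all columns except \<open>p\<close>; being diagonal, the image is
    then concentrated at \<open>(p, p)\<close>.\<close>
  then have Z: "\<psi> (E i i 1) = \<psi> (E i i 1) * E' p p 1"
    using psi_mult[of "E i i 1" Y] YC Y(2) by simp
  let ?Z = "\<psi> (E i i 1)"
  have ZC: "?Z \<in> C'" by (rule psi_C) simp
  have "E i i 1 \<in> M.Mc (M.ed 0 0 \<one>)"
    using M.mat_unit_comp[OF i(1) i(1) T_one_closed one_homogeneous] M.ed_diag_eq[OF i(1) M.k_pos T_one_closed]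
    by simp
  then have "?Z \<in> M'.Mc (M'.ed 0 0 \<one>)" using psi_identity_component by blast
  then have Zd: "?Z $$ (p, p) \<in> D \<one>" and Z0: "\<And>a b. a < M'.k \<Longrightarrow> b < M'.k \<Longrightarrow> a \<noteq> b \<Longrightarrow> ?Z $$ (a, b) = 0"
    unfolding M'.comp_diag_iff[OF T_one_closed] using p by auto
  have Zp: "?Z = E' p p (?Z $$ (p, p))"
  proof (rule eq_matI)
    fix a b assume "a < dim_row (E' p p (?Z $$ (p, p)))" "b < dim_col (E' p p (?Z $$ (p, p)))"
    then have ab: "a < M'.k" "b < M'.k" by simp_all
    have "?Z $$ (a, b) = (if b = p then ?Z $$ (a, p) else 0)"
      by (subst Z) (use ab p ZC in \<open>simp add: mat_unit_mult_right\<close>)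
    then show "?Z $$ (a, b) = E' p p (?Z $$ (p, p)) $$ (a, b)" using ab Z0[of a b] by auto
  qed (use ZC in auto)
  have ZZ: "?Z * ?Z = ?Z" using psi_mult[of "E i i 1" "E i i 1"] i by (simp add: mat_unit_mult)
  have "(?Z * ?Z) $$ (p, p) = ?Z $$ (p, p) * ?Z $$ (p, p)"
    by (rule mat_mult_monomial_left[OF ZC ZC p p p]) (use Z0 p in auto)
  moreover have "?Z $$ (p, p) \<noteq> 0"
  proof
    assume "?Z $$ (p, p) = 0"
    then have "?Z = 0\<^sub>m M'.k M'.k" using Zp by (simp add: mat_unit_zero)
    then have "E i i 1 = (0\<^sub>m M.k M.k :: 'd mat)" using psi_zero psi_inj[of "E i i 1" "0\<^sub>m M.k M.k"] by simp
    then show False using i(1) by (simp add: mat_unit_eq_zero)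
  qed
  ultimately have "?Z $$ (p, p) = 1"
    using idempotent_in_identity_component[OF Zd] ZZ by simp
  then show ?thesis using that[OF i(1)] Zp by simp
qed

text \<open>The map \<open>\<rho>\<close> is built backwards, from target to source indices. A
  diagonal unit missed by it would be orthogonal to all units hit, so its image would be annihilated
  by every \<open>E' p p 1\<close> and vanish. This also shows that both matrix sizes agree.\<close>

lemma obtain_permutation:
  obtains \<pi> where "bij_betw \<pi> {..<M.k} {..<M'.k}" "\<And>i. i < M.k \<Longrightarrow> \<psi> (E i i 1) = E' (\<pi> i) (\<pi> i) 1"
proof -
  have "\<forall>p. \<exists>i. p < M'.k \<longrightarrow> i < M.k \<and> \<psi> (E i i 1) = E' p p 1"
    using psi_idempotent_preimage by metis
  then obtain \<rho> where \<rho>: "\<And>p. p < M'.k \<Longrightarrow> \<rho> p < M.k"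
    "\<And>p. p < M'.k \<Longrightarrow> \<psi> (E (\<rho> p) (\<rho> p) 1) = E' p p 1" by metis
  have neq: "E' a a 1 \<noteq> (E' b b 1 :: 'd mat)" if "a < M'.k" "b < M'.k" "a \<noteq> b" for a b
  proof
    assume "E' a a 1 = (E' b b 1 :: 'd mat)"
    then have "E' a a 1 $$ (a, a) = (E' b b 1 :: 'd mat) $$ (a, a)" by simp
    then show False using that by simp
  qed
  have "bij_betw \<rho> {..<M'.k} {..<M.k}"
  proof (rule bij_betwI')
    show "\<rho> x = \<rho> y \<longleftrightarrow> x = y" if "x \<in> {..<M'.k}" "y \<in> {..<M'.k}" for x y
    proof
      assume "\<rho> x = \<rho> y"
      then have "E' x x 1 = (E' y y 1 :: 'd mat)" using that \<rho>(2)[of x] \<rho>(2)[of y] by simp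
      then show "x = y" using neq[of x y] that by blast
    qed simp
    show "\<rho> x \<in> {..<M.k}" if "x \<in> {..<M'.k}" for x using that \<rho> by simp
    show "\<exists>p\<in>{..<M'.k}. i = \<rho> p" if "i \<in> {..<M.k}" for i
    proof (rule ccontr)
      assume none: "\<not> ?thesis"
      have i: "i < M.k" using that by simp
      let ?Z = "\<psi> (E i i 1)"
      have ZC: "?Z \<in> C'" by (rule psi_C) simp
      have "?Z $$ (a, p) = 0" if ap: "a < M'.k" "p < M'.k" for a p
      proof -
        have "E i i 1 * E (\<rho> p) (\<rho> p) 1 = (0\<^sub>m M.k M.k :: 'd mat)"
          using none ap \<rho>(1)[of p] i by (subst mat_unit_mult) auto
        then have "?Z * E' p p 1 = 0\<^sub>m M'.k M'.k"
          using psi_mult[of "E i i 1" "E (\<rho> p) (\<rho> p) 1"] \<rho>(2)[OF ap(2)] psi_zero by simp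
        then have "(?Z * E' p p 1) $$ (a, p) = 0" using ap by simp
        then show ?thesis using mat_unit_mult_right[OF ZC ap(2,2), of 1] ap by simp
      qed
      then have "?Z = 0\<^sub>m M'.k M'.k" using ZC by (intro eq_matI) auto
      then have "E i i 1 = (0\<^sub>m M.k M.k :: 'd mat)" using psi_zero psi_inj[of "E i i 1" "0\<^sub>m M.k M.k"] by simp
      then show False using i by (simp add: mat_unit_eq_zero)
    qed
  qed
  note b = this
  show ?thesis
  proof (rule that[of "inv_into {..<M'.k} \<rho>"])
    show "bij_betw (inv_into {..<M'.k} \<rho>) {..<M.k} {..<M'.k}" by (rule bij_betw_inv_into[OF b])
    fix i assume i: "i < M.k"
    then have "inv_into {..<M'.k} \<rho> i < M'.k" "\<rho> (inv_into {..<M'.k} \<rho> i) = i"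
      using b bij_betw_inv_into_right[OF b, of i] bij_betwE[OF bij_betw_inv_into[OF b]] by auto
    then show "\<psi> (E i i 1) = E' (inv_into {..<M'.k} \<rho> i) (inv_into {..<M'.k} \<rho> i) 1"
      using \<rho>(2)[of "inv_into {..<M'.k} \<rho> i"] by simp
  qed
qed

definition \<pi> :: "nat \<Rightarrow> nat" where
  "\<pi> = (SOME \<pi>. bij_betw \<pi> {..<M.k} {..<M'.k} \<and> (\<forall>i<M.k. \<psi> (E i i 1) = E' (\<pi> i) (\<pi> i) 1))"

lemma pi_bij: "bij_betw \<pi> {..<M.k} {..<M'.k}" and psi_idem: "i < M.k \<Longrightarrow> \<psi> (E i i 1) = E' (\<pi> i) (\<pi> i) 1"
proof -
  have "\<exists>\<pi>. bij_betw \<pi> {..<M.k} {..<M'.k} \<and> (\<forall>i<M.k. \<psi> (E i i 1) = E' (\<pi> i) (\<pi> i) 1)"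
    using obtain_permutation by metis
  from someI_ex[OF this, folded \<pi>_def]
  show "bij_betw \<pi> {..<M.k} {..<M'.k}" "i < M.k \<Longrightarrow> \<psi> (E i i 1) = E' (\<pi> i) (\<pi> i) 1" by auto
qed

lemma pi_less: "i < M.k \<Longrightarrow> \<pi> i < M'.k"
  using pi_bij by (auto simp: bij_betw_def)

lemma pi_inj: "i < M.k \<Longrightarrow> j < M.k \<Longrightarrow> \<pi> i = \<pi> j \<longleftrightarrow> i = j"
  using pi_bij by (auto simp: bij_betw_def inj_on_def)

lemma k_eq: "M.k = M'.k"
  using bij_betw_same_card[OF pi_bij] by simp

lemma pi_sigma: assumes i: "i < M.k" shows "\<pi> (M.\<sigma> i) = M'.\<sigma> (\<pi> i)"
proof -
  have si: "M.\<sigma> i < M.k" using i by (simp add: partner_less)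
  have "M.Mi (E i i 1) = E (M.\<sigma> i) (M.\<sigma> i) 1"
    using i inve[OF M.beta_gr_units] by (simp add: M.Mi_mat_unit phi_one)
  then have "\<psi> (M.Mi (E i i 1)) = E' (\<pi> (M.\<sigma> i)) (\<pi> (M.\<sigma> i)) 1" using psi_idem[OF si] by simp
  moreover have "M'.Mi (E' (\<pi> i) (\<pi> i) 1) = E' (M'.\<sigma> (\<pi> i)) (M'.\<sigma> (\<pi> i)) 1"
    using pi_less[OF i] inve[OF M'.beta_gr_units] by (simp add: M'.Mi_mat_unit phi_one)
  ultimately have "E' (\<pi> (M.\<sigma> i)) (\<pi> (M.\<sigma> i)) 1 = (E' (M'.\<sigma> (\<pi> i)) (M'.\<sigma> (\<pi> i)) 1 :: 'd mat)"
    using psi_Mi[of "E i i 1"] psi_idem[OF i] by simp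
  then have "E' (\<pi> (M.\<sigma> i)) (\<pi> (M.\<sigma> i)) 1 $$ (\<pi> (M.\<sigma> i), \<pi> (M.\<sigma> i))
    = (E' (M'.\<sigma> (\<pi> i)) (M'.\<sigma> (\<pi> i)) 1 :: 'd mat) $$ (\<pi> (M.\<sigma> i), \<pi> (M.\<sigma> i))" by simp
  then show ?thesis using pi_less[OF si] by (simp split: if_splits)
qed

lemma pi_less_q: assumes "i < M.k" shows "\<pi> i < q' \<longleftrightarrow> i < q"
proof -
  have "\<pi> i < q' \<longleftrightarrow> M'.\<sigma> (\<pi> i) = \<pi> i" by (simp add: partner_fixed)
  also have "\<dots> \<longleftrightarrow> M.\<sigma> i = i"
    using pi_inj[of "M.\<sigma> i" i] assms by (simp add: partner_less flip: pi_sigma)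
  finally show ?thesis by (simp add: partner_fixed)
qed

lemma pi_bij_q: "bij_betw \<pi> {..<q} {..<q'}"
proof (rule bij_betw_subset[OF pi_bij])
  show "{..<q} \<subseteq> {..<M.k}" by auto
  show "\<pi> ` {..<q} = {..<q'}"
  proof
    show "\<pi> ` {..<q} \<subseteq> {..<q'}" using pi_less_q by auto
    show "{..<q'} \<subseteq> \<pi> ` {..<q}"
    proof
      fix p assume p: "p \<in> {..<q'}"
      then have "p \<in> \<pi> ` {..<M.k}" using pi_bij by (auto simp: bij_betw_def)
      then show "p \<in> \<pi> ` {..<q}" using p pi_less_q by auto
    qed
  qed
qed

lemma q_eq: "q = q'" and s_eq: "s = s'"
  using bij_betw_same_card[OF pi_bij_q] k_eq by auto

section \<open>Coordinates of an equivalence\<close>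

definition entry :: "nat \<Rightarrow> nat \<Rightarrow> 'd \<Rightarrow> 'd" where
  "entry i j d = \<psi> (E i j d) $$ (\<pi> i, \<pi> j)"

lemma psi_mat_unit:
  assumes ij: "i < M.k" "j < M.k"
  shows "\<psi> (E i j d) = E' (\<pi> i) (\<pi> j) (entry i j d)"
proof -
  have "E i i 1 * E i j d * E j j 1 = E i j d" using ij by (simp add: mat_unit_mult)
  then have "\<psi> (E i j d) = E' (\<pi> i) (\<pi> i) 1 * \<psi> (E i j d) * E' (\<pi> j) (\<pi> j) 1"
    using psi_mult[of "E i i 1 * E i j d" "E j j 1"] psi_mult[of "E i i 1" "E i j d"] psi_idem ij
      mult_carrier_mat[of "E i i 1" M.k M.k "E i j d" M.k]
    by simp
  then show ?thesis
    unfolding entry_def using mat_unit_sandwich[OF psi_C pi_less[OF ij(1)] pi_less[OF ij(2)]] by simp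
qed

lemma entry_eq_iff: "i < M.k \<Longrightarrow> j < M.k \<Longrightarrow> entry i j d = entry i j e \<longleftrightarrow> d = e"
  using psi_inj[of "E i j d" "E i j e"] psi_mat_unit mat_unit_inject pi_less mat_unit_carrier(1) by metis

lemma entry_mult:
  assumes "i < M.k" "j < M.k" "l < M.k"
  shows "entry i j d * entry j l e = entry i l (d * e)"
proof -
  have "\<psi> (E i j d * E j l e) = \<psi> (E i j d) * \<psi> (E j l e)" by (rule psi_mult) simp_all
  then show ?thesis
    using assms pi_less by (simp add: mat_unit_mult psi_mat_unit mat_unit_inject)
qed

lemma entry_add:
  assumes "i < M.k" "j < M.k"
  shows "entry i j (d + e) = entry i j d + entry i j e"
proof -
  have "\<psi> (E i j d + E i j e) = \<psi> (E i j d) + \<psi> (E i j e)" by (rule psi_add) simp_all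
  then show ?thesis
    using assms pi_less by (simp add: mat_unit_add psi_mat_unit mat_unit_inject)
qed

lemma entry_scale:
  assumes "i < M.k" "j < M.k"
  shows "entry i j (scale a d) = scale a (entry i j d)"
proof -
  have "\<psi> (map_mat (scale a) (E i j d)) = map_mat (scale a) (\<psi> (E i j d))" by (rule psi_scale) simp
  then show ?thesis
    using assms pi_less by (simp add: M.map_mat_scale_unit psi_mat_unit mat_unit_inject)
qed

lemma entry_one: "i < M.k \<Longrightarrow> entry i i 1 = 1"
  using psi_idem[of i] psi_mat_unit[of i i 1] pi_less by (metis mat_unit_inject)

definition \<psi>\<^sub>0 :: "'d \<Rightarrow> 'd" where "\<psi>\<^sub>0 = entry 0 0"

text \<open>The index 0 serves as base point, so \<open>c 0\<close> is 1; the formula for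
  \<open>entry\<close> comes from factoring a matrix unit through the position
  \<open>(0, 0)\<close>.\<close>

definition c :: "nat \<Rightarrow> 'd" where "c i = entry i 0 1"

lemma psi0_mult: "\<psi>\<^sub>0 (x * y) = \<psi>\<^sub>0 x * \<psi>\<^sub>0 y" and psi0_one: "\<psi>\<^sub>0 1 = 1"
  by (simp_all add: \<psi>\<^sub>0_def entry_mult[OF M.k_pos M.k_pos M.k_pos] entry_one[OF M.k_pos])

lemma psi0_linear: "Vector_Spaces.linear scale scale \<psi>\<^sub>0"
  by unfold_locales (simp_all add: \<psi>\<^sub>0_def entry_add[OF M.k_pos M.k_pos] entry_scale[OF M.k_pos M.k_pos])

text \<open>Compressing by \<open>E 0 0 1\<close> corresponds to compressing the image by its image.
  This lets \<open>\<psi>\<^sub>0\<close> be read off from preimages that are not known to be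
  concentrated at one position.\<close>

lemma psi0_entry:
  assumes "\<psi> X = Y" "X \<in> C" shows "Y $$ (\<pi> 0, \<pi> 0) = \<psi>\<^sub>0 (X $$ (0, 0))"
proof -
  note k0 = M.k_pos pi_less[OF M.k_pos]
  have "E' (\<pi> 0) (\<pi> 0) 1 * Y * E' (\<pi> 0) (\<pi> 0) 1 = \<psi> (E 0 0 1 * X * E 0 0 1)"
    using assms psi_mult[of "E 0 0 1 * X" "E 0 0 1"] psi_mult[of "E 0 0 1" X] psi_idem k0 by simp
  then show ?thesis
    using assms k0 psi_C[OF assms(2)]
    by (simp add: mat_unit_sandwich psi_mat_unit mat_unit_inject \<psi>\<^sub>0_def)
qed

lemma psi0_bij: "bij \<psi>\<^sub>0"
proof (rule bijI)
  show "inj \<psi>\<^sub>0" using entry_eq_iff[OF M.k_pos M.k_pos] by (auto simp: inj_def \<psi>\<^sub>0_def)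
  show "surj \<psi>\<^sub>0"
  proof (rule surjI)
    fix y
    have "\<psi> ` C = C'" using psi_bij by (simp add: bij_betw_def)
    then have "E' (\<pi> 0) (\<pi> 0) y \<in> \<psi> ` C" by simp
    then obtain X where X: "X \<in> C" "\<psi> X = E' (\<pi> 0) (\<pi> 0) y" by (metis imageE)
    then have "\<psi>\<^sub>0 (X $$ (0, 0)) = y" using psi0_entry[OF X(2,1)] pi_less[OF M.k_pos] by simp
    then have "\<exists>x. \<psi>\<^sub>0 x = y" by blast
    then show "\<psi>\<^sub>0 (SOME x. \<psi>\<^sub>0 x = y) = y" by (rule someI_ex)
  qed
qed

lemma entry_formula:
  assumes "i < M.k" "j < M.k" shows "entry i j d = c i * \<psi>\<^sub>0 d * entry 0 j 1"
  using assms M.k_pos entry_mult[OF assms(1) M.k_pos M.k_pos, of 1 d] entry_mult[OF assms(1) M.k_pos assms(2), of d 1]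
  by (simp add: c_def \<psi>\<^sub>0_def)

lemma c_gr_units: assumes i: "i < M.k" shows "c i \<in> U"
proof -
  obtain h where h: "\<psi> ` M.Mc (M.ed i 0 \<one>) = M'.Mc h"
    using psi_ed[OF i M.k_pos T_one_closed] .
  have "E i 0 1 \<in> M.Mc (M.ed i 0 \<one>)"
    using M.mat_unit_comp[OF i M.k_pos T_one_closed one_homogeneous] .
  then have "E' (\<pi> i) (\<pi> 0) (c i) \<in> M'.Mc h"
    using h psi_mat_unit[OF i M.k_pos, of 1] by (metis c_def imageI)
  moreover have "c i \<noteq> 0"
    using entry_mult[OF M.k_pos i M.k_pos, of 1 1] entry_one[OF M.k_pos] by (auto simp: c_def)
  ultimately show ?thesis
    using M'.comp_entry(1)[of "E' (\<pi> i) (\<pi> 0) (c i)" h "\<pi> i" "\<pi> 0"] pi_less i M.k_pos by simp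
qed

lemma entry_inverse: "i < M.k \<Longrightarrow> entry 0 i 1 = inve (c i)"
  using entry_mult[OF M.k_pos _ M.k_pos, of i 1 1] entry_one[OF M.k_pos]
  by (intro inve_eqI[symmetric] c_gr_units) (auto simp: c_def)

lemma psi0_component:
  assumes t: "t \<in> T" shows "\<exists>u\<in>T. \<psi>\<^sub>0 ` D t = D u"
proof -
  note k0 = M.k_pos pi_less[OF M.k_pos]
  obtain h where h: "\<psi> ` M.Mc (M.ed 0 0 t) = M'.Mc h"
    using psi_ed[OF M.k_pos M.k_pos t] .
  have unit: "E' (\<pi> 0) (\<pi> 0) (\<psi>\<^sub>0 d) \<in> M'.Mc h" if "d \<in> D t" for d
    using h M.mat_unit_comp[OF M.k_pos M.k_pos t that] psi_mat_unit[OF M.k_pos M.k_pos, of d]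
    by (metis \<psi>\<^sub>0_def imageI)
  obtain x where x: "x \<in> U" "x \<in> D t" using gr_units_obtain[OF t] by blast
  \<comment> \<open>One nonzero element of \<open>D t\<close> fixes the target degree;
    \<open>ed_inj\<close> forces the same degree on all others.\<close>
  define u where "u = deg (\<psi>\<^sub>0 x)"
  have "\<psi>\<^sub>0 x \<noteq> 0"
    using entry_eq_iff[OF M.k_pos M.k_pos, of x 0] entry_add[OF M.k_pos M.k_pos, of 0 0] gr_units_nonzero[OF x(1)]
    by (simp add: \<psi>\<^sub>0_def)
  then have \<psi>x: "\<psi>\<^sub>0 x \<in> U" and u: "M'.ed (\<pi> 0) (\<pi> 0) u = h"
    using M'.comp_entry[OF unit[OF x(2)] k0(2) k0(2)] k0(2) by (simp_all add: u_def)
  have uT: "u \<in> T" using deg_mem(1)[OF \<psi>x] by (simp add: u_def)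
  have "\<psi>\<^sub>0 ` D t = D u"
  proof
    show "\<psi>\<^sub>0 ` D t \<subseteq> D u"
    proof
      fix y assume "y \<in> \<psi>\<^sub>0 ` D t"
      then obtain d where d: "d \<in> D t" "y = \<psi>\<^sub>0 d" by blast
      show "y \<in> D u"
      proof (cases "y = 0")
        case True then show ?thesis using zero_in[OF support_carrier[OF uT]] by simp
      next
        case False
        then have "y \<in> U" "M'.ed (\<pi> 0) (\<pi> 0) (deg y) = h"
          using M'.comp_entry[OF unit[OF d(1)] k0(2) k0(2)] k0(2) d(2) by simp_all
        then have "deg y = u" using M'.ed_inj[OF k0(2) k0(2) _ uT] u deg_mem(1) by metis
        then show ?thesis using deg_mem(2) \<open>y \<in> U\<close> by metis
      qed
    qed
    show "D u \<subseteq> \<psi>\<^sub>0 ` D t"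
    proof
      fix y assume "y \<in> D u"
      then have "E' (\<pi> 0) (\<pi> 0) y \<in> M'.Mc h"
        using M'.mat_unit_comp[OF k0(2) k0(2) uT] u by metis
      then have "E' (\<pi> 0) (\<pi> 0) y \<in> \<psi> ` M.Mc (M.ed 0 0 t)" using h by simp
      then obtain X where X: "E' (\<pi> 0) (\<pi> 0) y = \<psi> X" "X \<in> M.Mc (M.ed 0 0 t)" by (rule imageE)
      then have "X \<in> C" "X $$ (0, 0) \<in> D t"
        unfolding M.comp_diag_iff[OF t] using M.k_pos by auto
      moreover have "\<psi>\<^sub>0 (X $$ (0, 0)) = y"
        using psi0_entry[OF X(1)[symmetric] \<open>X \<in> C\<close>] k0(2) by simp
      ultimately show "y \<in> \<psi>\<^sub>0 ` D t" by blast
    qed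
  qed
  then show ?thesis using uT by blast
qed

lemma psi0_gr_units: assumes "x \<in> U" shows "\<psi>\<^sub>0 x \<in> U"
proof -
  obtain u where u: "u \<in> T" "\<psi>\<^sub>0 ` D (deg x) = D u"
    using psi0_component[OF deg_mem(1)[OF assms]] by blast
  have "\<psi>\<^sub>0 x * \<psi>\<^sub>0 (inve x) = 1" using inve[OF assms] psi0_mult psi0_one by metis
  then have "\<psi>\<^sub>0 x \<noteq> 0" by auto
  then show ?thesis using u deg_mem(2)[OF assms] gr_unitsI support_carrier by blast
qed

lemma psi0_inve: "x \<in> U \<Longrightarrow> \<psi>\<^sub>0 (inve x) = inve (\<psi>\<^sub>0 x)"
  by (rule inve_eqI[symmetric]) (auto simp: psi0_gr_units inve psi0_one simp flip: psi0_mult)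

section \<open>Compatibility with the involutions\<close>

lemma entry_involution:
  assumes "i < M.k" "j < M.k"
  shows "entry (M.\<sigma> j) (M.\<sigma> i) (inve (M.\<beta> j) * \<phi> d * M.\<beta> i)
    = inve (M'.\<beta> (\<pi> j)) * \<phi> (entry i j d) * M'.\<beta> (\<pi> i)"
proof -
  have s: "M.\<sigma> i < M.k" "M.\<sigma> j < M.k" using assms by (simp_all add: partner_less)
  have "\<psi> (M.Mi (E i j d)) = M'.Mi (\<psi> (E i j d))" by (rule psi_Mi) simp
  then have "E' (\<pi> (M.\<sigma> j)) (\<pi> (M.\<sigma> i)) (entry (M.\<sigma> j) (M.\<sigma> i) (inve (M.\<beta> j) * \<phi> d * M.\<beta> i))
    = E' (\<pi> (M.\<sigma> j)) (\<pi> (M.\<sigma> i)) (inve (M'.\<beta> (\<pi> j)) * \<phi> (entry i j d) * M'.\<beta> (\<pi> i))"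
    by (simp only: M.Mi_mat_unit[OF assms] psi_mat_unit[OF assms] psi_mat_unit[OF s(2,1)]
        M'.Mi_mat_unit[OF pi_less[OF assms(1)] pi_less[OF assms(2)]] pi_sigma assms)
  then show ?thesis using mat_unit_inject[OF pi_less[OF s(2)] pi_less[OF s(1)]] by blast
qed

definition u :: "nat \<Rightarrow> 'd" where
  "u j = \<phi> (c j) * M'.\<beta> (\<pi> j) * c (M.\<sigma> j) * inve (\<psi>\<^sub>0 (M.\<beta> j))"

lemma u_gr_units: "j < M.k \<Longrightarrow> u j \<in> U"
  by (simp add: u_def gr_units_mult phi_gr_units c_gr_units M'.beta_gr_units partner_less inve
      psi0_gr_units M.beta_gr_units)

text \<open>Clearing the factors that depend on \<open>j\<close> from the left of
  \<open>entry_involution\<close> and those that depend on \<open>i\<close> from the right leaves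
  \<open>u j\<close> on one side and \<open>u i\<close> on the other. The case \<open>d = 1\<close>
  gives independence of the index, the case \<open>i = j\<close> the twist relation.\<close>

lemma u_twist:
  assumes ij: "i < M.k" "j < M.k" shows "u j * \<psi>\<^sub>0 (\<phi> d) = \<phi> (\<psi>\<^sub>0 d) * u i"
proof -
  note s = partner_less[of q i s] partner_less[of q j s]
  note U = c_gr_units[OF ij(1)] c_gr_units[OF ij(2)] c_gr_units[of "M.\<sigma> i"]
    psi0_gr_units[OF M.beta_gr_units] M'.beta_gr_units
  have "c (M.\<sigma> j) * \<psi>\<^sub>0 (inve (M.\<beta> j) * \<phi> d * M.\<beta> i) * inve (c (M.\<sigma> i))
    = inve (M'.\<beta> (\<pi> j)) * \<phi> (c i * \<psi>\<^sub>0 d * inve (c j)) * M'.\<beta> (\<pi> i)"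
    using entry_involution[OF ij, of d] entry_formula entry_inverse ij s by simp
  also have "\<phi> (c i * \<psi>\<^sub>0 d * inve (c j)) = inve (\<phi> (c j)) * \<phi> (\<psi>\<^sub>0 d) * \<phi> (c i)"
    by (simp add: phi_mult phi_inve U mult.assoc)
  finally have "\<phi> (c j) * M'.\<beta> (\<pi> j) * (c (M.\<sigma> j) * \<psi>\<^sub>0 (inve (M.\<beta> j) * \<phi> d * M.\<beta> i) * inve (c (M.\<sigma> i)))
      * c (M.\<sigma> i) * inve (\<psi>\<^sub>0 (M.\<beta> i))
    = \<phi> (c j) * M'.\<beta> (\<pi> j) * (inve (M'.\<beta> (\<pi> j)) * (inve (\<phi> (c j)) * \<phi> (\<psi>\<^sub>0 d) * \<phi> (c i)) * M'.\<beta> (\<pi> i))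
      * c (M.\<sigma> i) * inve (\<psi>\<^sub>0 (M.\<beta> i))" by simp
  moreover have "\<phi> (c j) * M'.\<beta> (\<pi> j) * (c (M.\<sigma> j) * \<psi>\<^sub>0 (inve (M.\<beta> j) * \<phi> d * M.\<beta> i) * inve (c (M.\<sigma> i)))
      * c (M.\<sigma> i) * inve (\<psi>\<^sub>0 (M.\<beta> i)) = u j * \<psi>\<^sub>0 (\<phi> d)"
    using U s ij by (simp add: u_def psi0_mult psi0_inve M.beta_gr_units mult.assoc inve_assoc inve)
  moreover have "\<phi> (c j) * M'.\<beta> (\<pi> j) * (inve (M'.\<beta> (\<pi> j)) * (inve (\<phi> (c j)) * \<phi> (\<psi>\<^sub>0 d) * \<phi> (c i)) * M'.\<beta> (\<pi> i))
      * c (M.\<sigma> i) * inve (\<psi>\<^sub>0 (M.\<beta> i)) = \<phi> (\<psi>\<^sub>0 d) * u i"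
    using U by (simp add: u_def mult.assoc inve_assoc phi_gr_units)
  ultimately show ?thesis by simp
qed

lemma u_eq: "i < M.k \<Longrightarrow> j < M.k \<Longrightarrow> u i = u j"
  using u_twist[of j i 1] by (simp add: phi_one psi0_one)

lemma twist: "\<phi> (\<psi>\<^sub>0 d) = u 0 * \<psi>\<^sub>0 (\<phi> d) * inve (u 0)"
  using u_twist[OF M.k_pos M.k_pos, of d] inve[OF u_gr_units[OF M.k_pos]] by (simp add: mult.assoc)

lemma u_psi0_beta:
  assumes j: "j < M.k" shows "u 0 * \<psi>\<^sub>0 (M.\<beta> j) = \<phi> (c j) * M'.\<beta> (\<pi> j) * c (M.\<sigma> j)"
proof -
  have "u 0 = u j" using u_eq[OF M.k_pos j] .
  then show ?thesis
    by (simp add: u_def mult.assoc inve psi0_gr_units M.beta_gr_units)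
qed

text \<open>The image of \<open>u 0 * \<psi>\<^sub>0 (\<beta> 0)\<close> under the involution is
  computed twice. Through \<open>u_psi0_beta\<close> it produces the sign of the second algebra,
  through \<open>twist\<close> the sign of the first; comparing the two yields the claim.\<close>

lemma phi_u: "\<phi> (u 0) = scale (\<delta> * \<delta>') (u 0)"
proof -
  let ?s = "M.\<sigma> 0"
  interpret p0: Vector_Spaces.linear scale scale \<psi>\<^sub>0 by (rule psi0_linear)
  have s: "?s < M.k" using M.k_pos by (simp add: partner_less)
  note U = u_gr_units[OF M.k_pos]
  have "\<phi> (u 0 * \<psi>\<^sub>0 (M.\<beta> 0)) = scale \<delta>' (\<phi> (c ?s) * M'.\<beta> (\<pi> ?s) * c 0)"
    unfolding u_psi0_beta[OF M.k_pos]
    by (simp add: phi_mult phi_phi M'.phi_beta pi_sigma[OF M.k_pos] mult.assoc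
        flip: scale_mult_left scale_mult_right)
  also have "\<dots> = scale \<delta>' (u 0 * \<psi>\<^sub>0 (M.\<beta> ?s))"
    using u_psi0_beta[OF s] by (simp add: partner_partner)
  finally have "\<phi> (u 0 * \<psi>\<^sub>0 (M.\<beta> 0)) = scale \<delta>' (u 0 * \<psi>\<^sub>0 (M.\<beta> ?s))" .
  moreover have "\<phi> (u 0 * \<psi>\<^sub>0 (M.\<beta> 0)) = scale \<delta> (u 0 * \<psi>\<^sub>0 (M.\<beta> ?s) * (inve (u 0) * \<phi> (u 0)))"
    by (simp add: phi_mult twist M.phi_beta p0.scale mult.assoc
        flip: scale_mult_left scale_mult_right)
  ultimately have "u 0 * \<psi>\<^sub>0 (M.\<beta> ?s) * scale \<delta>' 1 = u 0 * \<psi>\<^sub>0 (M.\<beta> ?s) * scale \<delta> (inve (u 0) * \<phi> (u 0))"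
    by (simp flip: scale_mult_right)
  then have "scale \<delta>' 1 = scale \<delta> (inve (u 0) * \<phi> (u 0))"
    using gr_units_cancel(1)[OF gr_units_mult[OF U psi0_gr_units[OF M.beta_gr_units]]] by blast
  then have "u 0 * scale (\<delta> * \<delta>') 1 = u 0 * (scale (\<delta> * \<delta>) (inve (u 0) * \<phi> (u 0)))"
    by (metis scale_scale)
  then show ?thesis using U by (simp add: M.delta inve_assoc flip: scale_mult_right)
qed

text \<open>An index below \<open>q\<close> is its own partner, so \<open>u_psi0_beta\<close> says
  that \<open>\<phi> (c i)\<close> carries \<open>ds' ! \<pi> i\<close> to
  \<open>u 0 * \<psi>\<^sub>0 (ds ! i)\<close>.\<close>

lemma orbit_u_psi0:
  assumes i: "i < q"
  shows "gr_orbit G D \<phi> (u 0 * \<psi>\<^sub>0 (ds ! i)) = gr_orbit G D \<phi> (ds' ! \<pi> i)"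
proof (rule gr_orbit_eqI[OF involution])
  have k: "i < M.k" using i by simp
  have "u 0 * \<psi>\<^sub>0 (ds ! i) = \<phi> (c i) * ds' ! \<pi> i * \<phi> (\<phi> (c i))"
    using u_psi0_beta[OF k] i pi_less_q[OF k]
    by (simp add: M.beta_simps M'.beta_simps partner_simps phi_phi)
  then show "u 0 * \<psi>\<^sub>0 (ds ! i) \<in> gr_orbit G D \<phi> (ds' ! \<pi> i)"
    using phi_gr_units[OF c_gr_units[OF k]] by (auto simp: gr_orbit_def)
qed

end

section \<open>The group of twists and its orbits\<close>

context graded_division_inv
begin

lemma Aut_grading_iff:
  "\<psi> \<in> Aut_grading scale G D \<longleftrightarrow> bij \<psi> \<and> (\<forall>x y. \<psi> (x * y) = \<psi> x * \<psi> y) \<and> \<psi> 1 = 1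
    \<and> Vector_Spaces.linear scale scale \<psi> \<and> bij_betw ((`) \<psi>) (D ` T) (D ` T)"
proof -
  have "\<psi> (x + y) = \<psi> x + \<psi> y" if "Vector_Spaces.linear scale scale \<psi>" for x y
  proof -
    interpret \<psi>: Vector_Spaces.linear scale scale \<psi> by (rule that)
    show ?thesis by (rule \<psi>.add)
  qed
  then show ?thesis
    by (auto simp: Aut_grading_def ring_iso_def Ring.ring_hom_def)
qed

text \<open>Evaluating the defining identity at \<open>\<psi> x\<close> removes the inverse of
  \<open>\<psi>\<close> and leaves the relation in which an equivalence delivers it.\<close>

lemma A_plus_iff:
  "(u, \<psi>) \<in> carrier (A_plus scale G D \<phi>) \<longleftrightarrow> u \<in> U \<and> \<psi> \<in> Aut_grading scale G D
    \<and> (\<forall>x. \<phi> (\<psi> x) = u * \<psi> (\<phi> x) * inve u) \<and> \<phi> u = u"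
proof -
  have "(Int_conj u \<circ> (\<psi> \<circ> \<phi> \<circ> inv_into UNIV \<psi>) = \<phi>)
      \<longleftrightarrow> (\<forall>x. \<phi> (\<psi> x) = u * \<psi> (\<phi> x) * inve u)" if "bij \<psi>"
  proof
    assume I: "Int_conj u \<circ> (\<psi> \<circ> \<phi> \<circ> inv_into UNIV \<psi>) = \<phi>"
    show "\<forall>x. \<phi> (\<psi> x) = u * \<psi> (\<phi> x) * inve u"
      using fun_cong[OF I] that by (metis Int_conj_def bij_is_inj comp_apply inv_f_f)
  next
    assume t: "\<forall>x. \<phi> (\<psi> x) = u * \<psi> (\<phi> x) * inve u"
    show "Int_conj u \<circ> (\<psi> \<circ> \<phi> \<circ> inv_into UNIV \<psi>) = \<phi>"
    proof
      fix y
      have "\<psi> (inv_into UNIV \<psi> y) = y" using that by (simp add: bij_is_surj surj_f_inv_f)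
      then show "(Int_conj u \<circ> (\<psi> \<circ> \<phi> \<circ> inv_into UNIV \<psi>)) y = \<phi> y"
        using t by (metis Int_conj_def comp_apply)
    qed
  qed
  then show ?thesis by (auto simp: A_plus_def semidirect_def Aut_grading_iff)
qed

lemma A_plus_one: "(1, id) \<in> carrier (A_plus scale G D \<phi>)"
proof -
  have "Vector_Spaces.linear scale scale id" by (rule linear_id)
  then show ?thesis by (simp add: A_plus_iff Aut_grading_iff one_gr_units inve_one phi_one bij_betw_def)
qed

lemma Aut_grading_gr_units: "\<psi> \<in> Aut_grading scale G D \<Longrightarrow> x \<in> U \<Longrightarrow> \<psi> x \<in> U"
  using Aut_gr[of \<psi> x] by (simp add: Aut_grading_def)

lemma Aut_grading_inve:
  assumes "\<psi> \<in> Aut_grading scale G D" "x \<in> U" shows "\<psi> (inve x) = inve (\<psi> x)"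
proof (rule inve_eqI[symmetric, OF Aut_grading_gr_units[OF assms]])
  have "\<psi> (inve x) * \<psi> x = \<psi> (inve x * x)" "\<psi> 1 = 1" using assms(1) by (auto simp: Aut_grading_iff)
  then show "\<psi> (inve x) * \<psi> x = 1" using inve(3)[OF assms(2)] by simp
qed

lemma A_plus_mult:
  assumes "(u, \<psi>) \<in> carrier (A_plus scale G D \<phi>)" "(v, \<chi>) \<in> carrier (A_plus scale G D \<phi>)"
  shows "(u * \<psi> v, \<psi> \<circ> \<chi>) \<in> carrier (A_plus scale G D \<phi>)"
proof -
  have A: "u \<in> U" "\<psi> \<in> Aut_grading scale G D" "v \<in> U" "\<chi> \<in> Aut_grading scale G D"
    "\<And>x. \<phi> (\<psi> x) = u * \<psi> (\<phi> x) * inve u" "\<phi> u = u" "\<And>x. \<phi> (\<chi> x) = v * \<chi> (\<phi> x) * inve v" "\<phi> v = v"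
    using assms by (auto simp: A_plus_iff)
  have m: "\<psi> (x * y) = \<psi> x * \<psi> y" "\<chi> (x * y) = \<chi> x * \<chi> y" "\<psi> 1 = 1" "\<chi> 1 = 1" for x y
    using A by (auto simp: Aut_grading_iff)
  note \<psi>v = Aut_grading_gr_units[OF A(2,3)]
  have "bij_betw ((`) (\<psi> \<circ> \<chi>)) (D ` T) (D ` T)"
    using bij_betw_trans[of "(`) \<chi>" "D ` T" "D ` T" "(`) \<psi>" "D ` T"] A(2,4)
    by (simp add: Aut_grading_iff image_comp comp_def)
  moreover have "Vector_Spaces.linear scale scale (\<psi> \<circ> \<chi>)"
    using A(2,4) by (auto simp: Aut_grading_iff intro: Vector_Spaces.linear_compose)
  moreover have "bij (\<psi> \<circ> \<chi>)" using A(2,4) bij_comp by (auto simp: Aut_grading_iff)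
  ultimately have "\<psi> \<circ> \<chi> \<in> Aut_grading scale G D" by (simp add: Aut_grading_iff m)
  moreover have "\<phi> ((\<psi> \<circ> \<chi>) x) = u * \<psi> v * (\<psi> \<circ> \<chi>) (\<phi> x) * inve (u * \<psi> v)" for x
    by (simp add: A m inve_mult \<psi>v Aut_grading_inve mult.assoc)
  moreover have "\<phi> (u * \<psi> v) = u * \<psi> v"
    by (simp add: phi_mult A mult.assoc inve_assoc inve)
  ultimately show ?thesis by (simp add: A_plus_iff gr_units_mult A \<psi>v)
qed

text \<open>The pair is the inverse of \<open>(u, \<psi>)\<close> for the multiplication of the
  semidirect product.\<close>

lemma A_plus_inverse:
  assumes "(u, \<psi>) \<in> carrier (A_plus scale G D \<phi>)"
  shows "(inv_into UNIV \<psi> (inve u), inv_into UNIV \<psi>) \<in> carrier (A_plus scale G D \<phi>)"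
proof -
  let ?i = "inv_into UNIV \<psi>"
  have A: "u \<in> U" "\<psi> \<in> Aut_grading scale G D"
    "\<And>x. \<phi> (\<psi> x) = u * \<psi> (\<phi> x) * inve u" "\<phi> u = u"
    using assms by (auto simp: A_plus_iff)
  have \<psi>: "bij \<psi>" "\<And>x y. \<psi> (x * y) = \<psi> x * \<psi> y" "\<psi> 1 = 1" "bij_betw ((`) \<psi>) (D ` T) (D ` T)"
    and lin: "Vector_Spaces.linear scale scale \<psi>"
    using A(2) by (auto simp: Aut_grading_iff)
  interpret \<psi>: Vector_Spaces.linear scale scale \<psi> by (rule lin)
  have i: "\<psi> (?i x) = x" "?i (\<psi> x) = x" for x
    using \<psi>(1) by (simp_all add: bij_is_surj surj_f_inv_f bij_is_inj)
  have ieq: "?i x = y \<longleftrightarrow> x = \<psi> y" for x y using i by metis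
  have "bij_betw ((`) ?i) (D ` T) (D ` T)"
  proof (rule bij_betw_byWitness[where f' = "(`) \<psi>"])
    have *: "?i ` \<psi> ` X = X" "\<psi> ` ?i ` X = X" for X by (simp_all add: image_comp comp_def i)
    show "\<forall>a\<in>D ` T. \<psi> ` ?i ` a = a" "\<forall>a\<in>D ` T. ?i ` \<psi> ` a = a" by (rule ballI, rule *)+
    show "(`) \<psi> ` (D ` T) \<subseteq> D ` T" using \<psi>(4) by (simp add: bij_betw_def)
    have surj: "(`) \<psi> ` (D ` T) = D ` T" using \<psi>(4) by (simp only: bij_betw_def)
    show "(`) ?i ` (D ` T) \<subseteq> D ` T"
    proof (rule image_subsetI)
      fix X assume "X \<in> D ` T"
      then have "X \<in> (`) \<psi> ` (D ` T)" using surj by simp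
      then obtain Y where Y: "X = \<psi> ` Y" "Y \<in> D ` T" by (rule imageE)
      show "?i ` X \<in> D ` T" unfolding Y(1) *(1) by (rule Y(2))
    qed
  qed
  moreover have "Vector_Spaces.linear scale scale ?i"
    by unfold_locales (simp_all add: ieq \<psi>.add \<psi>.scale i)
  ultimately have iA: "?i \<in> Aut_grading scale G D"
    using bij_imp_bij_inv[OF \<psi>(1)] by (simp add: Aut_grading_iff ieq \<psi> i)
  note iu = Aut_grading_gr_units[OF iA]
  have "\<phi> (?i x) = ?i (inve u) * ?i (\<phi> x) * inve (?i (inve u))" for x
  proof -
    have "\<phi> x = u * \<psi> (\<phi> (?i x)) * inve u" using A(3)[of "?i x"] by (simp add: i)
    then have "inve u * \<phi> x * u = \<psi> (\<phi> (?i x))" by (simp add: mult.assoc inve inve_assoc A(1))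
    then have "\<phi> (?i x) = ?i (inve u * \<phi> x * u)" by (simp add: i)
    also have "\<dots> = ?i (inve u) * ?i (\<phi> x) * ?i u" using iA by (simp add: Aut_grading_iff)
    also have "?i u = inve (?i (inve u))"
      using Aut_grading_inve[OF iA inve(1)[OF A(1)]] by (simp add: inve_inve A(1))
    finally show ?thesis .
  qed
  moreover have "\<phi> (?i (inve u)) = ?i (inve u)"
  proof -
    have "\<phi> (inve u) = u * \<psi> (\<phi> (?i (inve u))) * inve u" using A(3)[of "?i (inve u)"] by (simp add: i)
    then have "\<psi> (\<phi> (?i (inve u))) = inve u"
    proof -
      assume "\<phi> (inve u) = u * \<psi> (\<phi> (?i (inve u))) * inve u"
      then have "1 * inve u = u * \<psi> (\<phi> (?i (inve u))) * inve u"
        by (simp add: phi_inve A(1,4))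
      then have "1 = u * \<psi> (\<phi> (?i (inve u)))"
        using gr_units_cancel(2)[OF inve(1)[OF A(1)]] by blast
      then have "inve u * 1 = inve u * (u * \<psi> (\<phi> (?i (inve u))))" by simp
      then show ?thesis by (simp add: inve_assoc A(1))
    qed
    then have "?i (\<psi> (\<phi> (?i (inve u)))) = ?i (inve u)" by (rule arg_cong)
    then show ?thesis unfolding i(2) .
  qed
  ultimately show ?thesis by (simp add: A_plus_iff iA iu inve A(1))
qed

lemma image_orbit_action:
  assumes "(u, \<psi>) \<in> carrier (A_plus scale G D \<phi>)"
  shows "image_mset (orbit_action G D \<phi> (u, \<psi>)) (image_mset (\<lambda>d. gr_orbit G D \<phi> (f d)) M)
    = image_mset (\<lambda>d. gr_orbit G D \<phi> (u * \<psi> (f d))) M"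
  by (simp add: multiset.map_comp comp_def orbit_action_gr_orbit[OF involution assms])

text \<open>Closure of the group under products makes the orbit of a translate a subset of the
  original orbit (\<open>sub\<close>); closure under inverses gives the reverse inclusion.\<close>

lemma Sigma_orbit_eq_iff:
  "Sigma_orbit scale G D \<phi> ds = Sigma_orbit scale G D \<phi> ds' \<longleftrightarrow>
    (\<exists>(u, \<psi>) \<in> carrier (A_plus scale G D \<phi>).
      Sigma_tilde G D \<phi> ds' = image_mset (\<lambda>d. gr_orbit G D \<phi> (u * \<psi> d)) (mset ds))"
proof -
  let ?A = "carrier (A_plus scale G D \<phi>)"
  define act where "act = (\<lambda>(u, \<psi>) (ds :: 'd list). image_mset (\<lambda>d. gr_orbit G D \<phi> (u * \<psi> d)) (mset ds))"
  have so: "Sigma_orbit scale G D \<phi> ds = {act p ds | p. p \<in> ?A}" for ds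
  proof -
    have eq: "image_mset (orbit_action G D \<phi> p) (Sigma_tilde G D \<phi> ds) = act p ds" if "p \<in> ?A" for p
      using that image_orbit_action[of "fst p" "snd p" "\<lambda>d. d" "mset ds"]
      by (cases p) (simp add: act_def Sigma_tilde_def)
    have "M \<in> Sigma_orbit scale G D \<phi> ds \<longleftrightarrow>
        (\<exists>p\<in>?A. M = image_mset (orbit_action G D \<phi> p) (Sigma_tilde G D \<phi> ds))" for M
      by (auto simp: Sigma_orbit_def orbit_def)
    also have "\<dots> M \<longleftrightarrow> (\<exists>p\<in>?A. M = act p ds)" for M using eq by (intro bex_cong) simp_all
    finally show ?thesis by blast
  qed
  have sub: "Sigma_orbit scale G D \<phi> ds' \<subseteq> Sigma_orbit scale G D \<phi> ds"
    if p: "p \<in> ?A" "Sigma_tilde G D \<phi> ds' = act p ds" for p ds ds'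
  proof
    fix M assume "M \<in> Sigma_orbit scale G D \<phi> ds'"
    then obtain r where r: "r \<in> ?A" "M = image_mset (orbit_action G D \<phi> r) (Sigma_tilde G D \<phi> ds')"
      by (auto simp: Sigma_orbit_def orbit_def)
    obtain u \<psi> v \<chi> where e: "r = (u, \<psi>)" "p = (v, \<chi>)" by (cases r, cases p)
    have m: "\<psi> (x * y) = \<psi> x * \<psi> y" for x y using r(1) by (simp add: e A_plus_iff Aut_grading_iff)
    have "M = act (u * \<psi> v, \<psi> \<circ> \<chi>) ds"
      using image_orbit_action[of u \<psi> "\<lambda>d. v * \<chi> d" "mset ds"] r p
      by (simp add: e act_def m mult.assoc)
    then show "M \<in> Sigma_orbit scale G D \<phi> ds"
      using A_plus_mult[of u \<psi> v \<chi>] r(1) p(1) by (auto simp: so e)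
  qed
  show ?thesis
  proof
    assume eq: "Sigma_orbit scale G D \<phi> ds = Sigma_orbit scale G D \<phi> ds'"
    have "Sigma_tilde G D \<phi> ds' = act (1, id) ds'" by (simp add: act_def Sigma_tilde_def)
    then have "Sigma_tilde G D \<phi> ds' \<in> Sigma_orbit scale G D \<phi> ds'"
      unfolding so using A_plus_one by blast
    then have "Sigma_tilde G D \<phi> ds' \<in> Sigma_orbit scale G D \<phi> ds" by (simp only: eq)
    then show "\<exists>(u, \<psi>) \<in> ?A. Sigma_tilde G D \<phi> ds' = image_mset (\<lambda>d. gr_orbit G D \<phi> (u * \<psi> d)) (mset ds)"
      by (auto simp: so act_def)
  next
    assume "\<exists>(u, \<psi>) \<in> ?A. Sigma_tilde G D \<phi> ds' = image_mset (\<lambda>d. gr_orbit G D \<phi> (u * \<psi> d)) (mset ds)"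
    then obtain u \<psi> where p: "(u, \<psi>) \<in> ?A"
      "Sigma_tilde G D \<phi> ds' = image_mset (\<lambda>d. gr_orbit G D \<phi> (u * \<psi> d)) (mset ds)" by blast
    let ?i = "inv_into UNIV \<psi>"
    have i: "(?i (inve u), ?i) \<in> ?A" by (rule A_plus_inverse[OF p(1)])
    have im: "?i (x * y) = ?i x * ?i y" for x y using i by (simp add: A_plus_iff Aut_grading_iff)
    have U: "u \<in> U" and inj: "inj \<psi>" using p(1) by (auto simp: A_plus_iff Aut_grading_iff bij_is_inj)
    have *: "?i (inve u) * ?i (u * \<psi> d) = d" for d
    proof -
      have "?i (inve u) * ?i (u * \<psi> d) = ?i (inve u * (u * \<psi> d))" by (rule im[symmetric])
      then show ?thesis using inve_assoc(2)[OF U] inv_f_f[OF inj] by simp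
    qed
    have "Sigma_tilde G D \<phi> ds = image_mset (orbit_action G D \<phi> (?i (inve u), ?i)) (Sigma_tilde G D \<phi> ds')"
    proof -
      have "image_mset (orbit_action G D \<phi> (?i (inve u), ?i)) (Sigma_tilde G D \<phi> ds')
          = image_mset (\<lambda>d. gr_orbit G D \<phi> (?i (inve u) * ?i (u * \<psi> d))) (mset ds)"
        unfolding p(2) by (rule image_orbit_action[OF i])
      then show ?thesis by (simp only: * Sigma_tilde_def)
    qed
    also have "\<dots> = act (?i (inve u), ?i) ds'"
      unfolding Sigma_tilde_def act_def prod.case by (rule image_orbit_action[OF i])
    finally show "Sigma_orbit scale G D \<phi> ds = Sigma_orbit scale G D \<phi> ds'"
      using sub[OF i] sub[OF p(1)] p(2) by (intro subset_antisym) (simp_all only: act_def prod.case)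
  qed
qed

end

lemma mset_conv_nth: "mset xs = image_mset ((!) xs) (mset_set {..<length xs})"
proof -
  have "mset xs = mset (map ((!) xs) [0..<length xs])" by (simp only: map_nth)
  then show ?thesis by (simp only: mset_map mset_upt atLeast0LessThan)
qed

context M_equivalence
begin

text \<open>Over a central base field \<open>u 0\<close> is nonzero and symmetric, so
  \<open>phi_u\<close> forces the product of the signs to be 1. Over a larger center both signs are
  1 by convention.\<close>

lemma delta_eq:
  assumes cs: "central_simple_inv scale \<phi>" and fd: "finite_dimensional scale"
    and conv: "(center :: 'd set) \<noteq> scalars scale \<longrightarrow> \<delta> = 1" "(center :: 'd set) \<noteq> scalars scale \<longrightarrow> \<delta>' = 1"
  shows "\<delta> = \<delta>'"
proof (cases "(center :: 'd set) = scalars scale")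
  case True
  have "\<phi> (u 0) = u 0"
    using twist_symmetric[OF cs True fd psi0_linear psi0_mult psi0_one bij_is_surj[OF psi0_bij]
        u_gr_units[OF M.k_pos] twist] .
  then have "scale (\<delta> * \<delta>') (u 0) = scale 1 (u 0)" using phi_u by simp
  then have "\<delta> * \<delta>' = 1"
    using gr_units_nonzero[OF u_gr_units[OF M.k_pos]] by (simp only: scale_cancel_right) simp
  then have "\<delta> * (\<delta> * \<delta>') = \<delta>" by simp
  then show ?thesis using M.delta(1) by (simp flip: mult.assoc)
qed (use conv in simp)

text \<open>Once the signs agree, \<open>phi_u\<close> makes \<open>u 0\<close> symmetric, also over
  a larger center; so the pair of \<open>u 0\<close> and \<open>\<psi>\<^sub>0\<close> lies in the
  acting group, and \<open>\<pi>\<close> below \<open>q\<close> matches the orbits.\<close>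

lemma Sigma_orbit_eq:
  assumes "\<delta> = \<delta>'" shows "Sigma_orbit scale G D \<phi> ds = Sigma_orbit scale G D \<phi> ds'"
proof -
  have "scale (\<delta> * \<delta>') (u 0) = u 0" using assms M.delta(1) by simp
  then have "(u 0, \<psi>\<^sub>0) \<in> carrier (A_plus scale G D \<phi>)"
    using permutes_components[OF psi0_linear psi0_bij psi0_component] psi0_bij psi0_linear
      u_gr_units[OF M.k_pos] phi_u psi0_mult psi0_one twist
    by (simp only: A_plus_iff Aut_grading_iff simp_thms)
  moreover have "Sigma_tilde G D \<phi> ds' = image_mset (\<lambda>d. gr_orbit G D \<phi> (u 0 * \<psi>\<^sub>0 d)) (mset ds)"
  proof -
    have "mset_set {..<q'} = image_mset \<pi> (mset_set {..<q})"
      using pi_bij_q by (simp add: bij_betw_def image_mset_mset_set)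
    then have "Sigma_tilde G D \<phi> ds' = image_mset (\<lambda>i. gr_orbit G D \<phi> (ds' ! \<pi> i)) (mset_set {..<q})"
      by (simp add: Sigma_tilde_def mset_conv_nth[of ds'] M'.ds_props(3) multiset.map_comp comp_def)
    also have "\<dots> = image_mset (\<lambda>i. gr_orbit G D \<phi> (u 0 * \<psi>\<^sub>0 (ds ! i))) (mset_set {..<q})"
      by (rule image_mset_cong) (simp add: orbit_u_psi0)
    finally show ?thesis
      by (simp add: mset_conv_nth[of ds] M.ds_props(3) multiset.map_comp comp_def)
  qed
  ultimately show ?thesis unfolding Sigma_orbit_eq_iff by blast
qed

end

section \<open>Realising a twist by an equivalence\<close>

text \<open>The hypotheses are what was extracted from an equivalence; in particular
  \<open>c_rel\<close> has the form of \<open>u_psi0_beta\<close>.\<close>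

locale M_twist = graded_division_inv scale G D \<phi>
  + M: M_algebra_data scale G D \<phi> q s ds \<delta>
  + M': M_algebra_data scale G D \<phi> q s ds' \<delta>'
  for scale :: "'f::field \<Rightarrow> 'd::ring_1 \<Rightarrow> 'd"
    and G :: "('g, 'm) monoid_scheme" (structure)
    and D :: "'g \<Rightarrow> 'd set"
    and \<phi> :: "'d \<Rightarrow> 'd"
    and q s ds \<delta> ds' \<delta>' +
  fixes u :: 'd and \<psi> :: "'d \<Rightarrow> 'd" and \<pi> :: "nat \<Rightarrow> nat" and c :: "nat \<Rightarrow> 'd"
  assumes A_plus: "(u, \<psi>) \<in> carrier (A_plus scale G D \<phi>)"
    and pi_bij: "bij_betw \<pi> {..<q + 2 * s} {..<q + 2 * s}"
    and pi_sigma: "i < q + 2 * s \<Longrightarrow> \<pi> (partner q i) = partner q (\<pi> i)"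
    and c_gr_units: "i < q + 2 * s \<Longrightarrow> c i \<in> U"
    and c_rel: "i < q + 2 * s \<Longrightarrow> u * \<psi> (M.\<beta> i) = \<phi> (c i) * M'.\<beta> (\<pi> i) * c (partner q i)"
begin

abbreviation "C \<equiv> (carrier_mat M.k M.k :: 'd mat set)"

lemma u_gr_units: "u \<in> U" and psi_Aut: "\<psi> \<in> Aut_grading scale G D"
  and twist: "\<phi> (\<psi> x) = u * \<psi> (\<phi> x) * inve u"
  using A_plus by (auto simp: A_plus_iff)

lemma psi_mult: "\<psi> (x * y) = \<psi> x * \<psi> y" and psi_one: "\<psi> 1 = 1" and psi_bij: "bij \<psi>"
  and psi_linear: "Vector_Spaces.linear scale scale \<psi>"
  and psi_components: "bij_betw ((`) \<psi>) (D ` T) (D ` T)"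
  using psi_Aut by (auto simp: Aut_grading_iff)

sublocale psi: Vector_Spaces.linear scale scale \<psi>
  by (rule psi_linear)

lemma psi_gr_units: "x \<in> U \<Longrightarrow> \<psi> x \<in> U"
  by (rule Aut_grading_gr_units[OF psi_Aut])

lemma psi_eq_0: "\<psi> x = 0 \<longleftrightarrow> x = 0"
  using psi_bij psi.zero by (metis bij_is_inj injD)

lemma pi_less: "i < M.k \<Longrightarrow> \<pi> i < M.k"
  using pi_bij by (auto simp: bij_betw_def)

lemma pi_inj: "i < M.k \<Longrightarrow> j < M.k \<Longrightarrow> \<pi> i = \<pi> j \<longleftrightarrow> i = j"
  using pi_bij by (auto simp: bij_betw_def inj_on_def)

lemma pi_surj:
  assumes "a < M.k" obtains i where "i < M.k" "a = \<pi> i"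
proof -
  have "a \<in> \<pi> ` {..<M.k}" using assms pi_bij by (simp add: bij_betw_def)
  then show ?thesis using that by blast
qed

lemma eq_matI_pi:
  assumes "X \<in> C" "Y \<in> C"
    and "\<And>i j. i < M.k \<Longrightarrow> j < M.k \<Longrightarrow> X $$ (\<pi> i, \<pi> j) = Y $$ (\<pi> i, \<pi> j)"
  shows "X = Y"
proof (rule eq_matI)
  fix a b assume "a < dim_row Y" "b < dim_col Y"
  then have "a < M.k" "b < M.k" using assms(2) by auto
  then show "X $$ (a, b) = Y $$ (a, b)" using assms(3) by (metis pi_surj)
qed (use assms in auto)

definition \<Psi> :: "'d mat \<Rightarrow> 'd mat" where
  "\<Psi> X = mat M.k M.k (\<lambda>(a, b).
     let i = inv_into {..<M.k} \<pi> a; j = inv_into {..<M.k} \<pi> b in c i * \<psi> (X $$ (i, j)) * inve (c j))"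

lemma Psi_carrier: "\<Psi> X \<in> C"
  by (simp add: \<Psi>_def)

lemma Psi_entry:
  assumes "i < M.k" "j < M.k"
  shows "\<Psi> X $$ (\<pi> i, \<pi> j) = c i * \<psi> (X $$ (i, j)) * inve (c j)"
proof -
  have "inv_into {..<M.k} \<pi> (\<pi> i) = i" "inv_into {..<M.k} \<pi> (\<pi> j) = j"
    using pi_bij assms by (simp_all add: bij_betw_def)
  then show ?thesis using pi_less[OF assms(1)] pi_less[OF assms(2)] by (simp add: \<Psi>_def Let_def)
qed

lemma Psi_entry_eq_iff:
  assumes "i < M.k" "j < M.k"
  shows "c i * \<psi> x * inve (c j) = c i * \<psi> y * inve (c j) \<longleftrightarrow> x = y"
  using gr_units_cancel(2)[OF inve(1)[OF c_gr_units[OF assms(2)]]] gr_units_cancel(1)[OF c_gr_units[OF assms(1)]]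
    inj_eq[OF bij_is_inj[OF psi_bij]] by simp

lemma Psi_bij: "bij_betw \<Psi> C C"
proof (rule bij_betw_imageI)
  show "inj_on \<Psi> C"
  proof (rule inj_onI)
    fix X Y assume XY: "X \<in> C" "Y \<in> C" "\<Psi> X = \<Psi> Y"
    show "X = Y"
    proof (rule eq_matI)
      fix i j assume "i < dim_row Y" "j < dim_col Y"
      then have ij: "i < M.k" "j < M.k" using XY(2) by auto
      have "\<Psi> X $$ (\<pi> i, \<pi> j) = \<Psi> Y $$ (\<pi> i, \<pi> j)" using XY(3) by simp
      then show "X $$ (i, j) = Y $$ (i, j)" by (simp only: Psi_entry[OF ij] Psi_entry_eq_iff[OF ij])
    qed (use XY in auto)
  qed
  show "\<Psi> ` C = C"
  proof
    show "\<Psi> ` C \<subseteq> C" using Psi_carrier by blast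
    show "C \<subseteq> \<Psi> ` C"
    proof
      fix Y assume Y: "Y \<in> C"
      define X where "X = mat M.k M.k (\<lambda>(i, j). inv_into UNIV \<psi> (inve (c i) * Y $$ (\<pi> i, \<pi> j) * c j))"
      have "\<Psi> X = Y"
      proof (rule eq_matI_pi[OF Psi_carrier Y])
        fix i j assume ij: "i < M.k" "j < M.k"
        have "\<psi> (X $$ (i, j)) = inve (c i) * Y $$ (\<pi> i, \<pi> j) * c j"
          using ij psi_bij by (simp add: X_def bij_is_surj surj_f_inv_f)
        then show "\<Psi> X $$ (\<pi> i, \<pi> j) = Y $$ (\<pi> i, \<pi> j)"
          using c_gr_units ij by (simp add: Psi_entry mult.assoc inve_assoc inve)
      qed
      moreover have "X \<in> C" by (simp add: X_def)
      ultimately show "Y \<in> \<Psi> ` C" by blast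
    qed
  qed
qed

lemma Psi_mult:
  assumes "X \<in> C" "Y \<in> C" shows "\<Psi> (X * Y) = \<Psi> X * \<Psi> Y"
proof (rule eq_matI_pi)
  show "\<Psi> (X * Y) \<in> C" "\<Psi> X * \<Psi> Y \<in> C"
    by (rule Psi_carrier) (rule mult_carrier_mat[OF Psi_carrier Psi_carrier])
  fix i j assume ij: "i < M.k" "j < M.k"
  have "(\<Psi> X * \<Psi> Y) $$ (\<pi> i, \<pi> j) = (\<Sum>a<M.k. \<Psi> X $$ (\<pi> i, a) * \<Psi> Y $$ (a, \<pi> j))"
    by (rule mat_mult_entry[OF Psi_carrier Psi_carrier pi_less pi_less]) (use ij in auto)
  also have "\<dots> = (\<Sum>l<M.k. \<Psi> X $$ (\<pi> i, \<pi> l) * \<Psi> Y $$ (\<pi> l, \<pi> j))"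
    by (rule sum.reindex_bij_betw[OF pi_bij, symmetric])
  also have "\<dots> = (\<Sum>l<M.k. c i * \<psi> (X $$ (i, l) * Y $$ (l, j)) * inve (c j))"
    by (rule sum.cong) (use ij c_gr_units in \<open>auto simp: Psi_entry psi_mult mult.assoc inve_assoc\<close>)
  also have "\<dots> = c i * \<psi> ((X * Y) $$ (i, j)) * inve (c j)"
    by (simp only: mat_mult_entry[OF assms ij] psi.sum sum_distrib_left sum_distrib_right)
  finally show "\<Psi> (X * Y) $$ (\<pi> i, \<pi> j) = (\<Psi> X * \<Psi> Y) $$ (\<pi> i, \<pi> j)"
    by (simp only: Psi_entry[OF ij])
qed

lemma Psi_add:
  assumes "X \<in> C" "Y \<in> C" shows "\<Psi> (X + Y) = \<Psi> X + \<Psi> Y"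
proof (rule eq_matI_pi)
  show "\<Psi> (X + Y) \<in> C" "\<Psi> X + \<Psi> Y \<in> C"
    by (rule Psi_carrier) (rule add_carrier_mat[OF Psi_carrier])
  fix i j assume ij: "i < M.k" "j < M.k"
  have "(\<Psi> X + \<Psi> Y) $$ (\<pi> i, \<pi> j) = \<Psi> X $$ (\<pi> i, \<pi> j) + \<Psi> Y $$ (\<pi> i, \<pi> j)"
    using pi_less ij Psi_carrier[of Y] by (intro index_add_mat(1)) auto
  moreover have "(X + Y) $$ (i, j) = X $$ (i, j) + Y $$ (i, j)"
    using ij assms by (intro index_add_mat(1)) auto
  ultimately show "\<Psi> (X + Y) $$ (\<pi> i, \<pi> j) = (\<Psi> X + \<Psi> Y) $$ (\<pi> i, \<pi> j)"
    by (simp only: Psi_entry[OF ij] psi.add distrib_left distrib_right)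
qed

lemma Psi_one: "\<Psi> (1\<^sub>m M.k) = 1\<^sub>m M.k"
proof (rule eq_matI_pi[OF Psi_carrier one_carrier_mat])
  fix i j assume ij: "i < M.k" "j < M.k"
  then show "\<Psi> (1\<^sub>m M.k) $$ (\<pi> i, \<pi> j) = 1\<^sub>m M.k $$ (\<pi> i, \<pi> j)"
    using pi_less pi_inj[OF ij] c_gr_units by (auto simp: Psi_entry psi_one psi.zero inve)
qed

lemma Psi_scale:
  assumes "X \<in> C" shows "\<Psi> (map_mat (scale a) X) = map_mat (scale a) (\<Psi> X)"
proof (rule eq_matI_pi[OF Psi_carrier])
  show "map_mat (scale a) (\<Psi> X) \<in> C" by (simp add: Psi_carrier)
  fix i j assume ij: "i < M.k" "j < M.k"
  then have "map_mat (scale a) (\<Psi> X) $$ (\<pi> i, \<pi> j) = scale a (\<Psi> X $$ (\<pi> i, \<pi> j))"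
    using pi_less Psi_carrier[of X] by (intro index_map_mat(1)) auto
  moreover have "map_mat (scale a) X $$ (i, j) = scale a (X $$ (i, j))"
    using ij assms by (intro index_map_mat(1)) auto
  ultimately show "\<Psi> (map_mat (scale a) X) $$ (\<pi> i, \<pi> j) = map_mat (scale a) (\<Psi> X) $$ (\<pi> i, \<pi> j)"
    by (simp only: Psi_entry[OF ij] psi.scale scale_mult_left[symmetric] scale_mult_right[symmetric])
qed

text \<open>After \<open>twist\<close> moves the involution past \<open>\<psi>\<close>, the factors
  left and right of \<open>\<psi> (\<phi> x)\<close> are independent: \<open>c_rel\<close> at the
  partner of \<open>a\<close> rewrites the left one (\<open>Ra\<close>), at the partner of
  \<open>b\<close> the right one (\<open>Rb\<close>).\<close>

lemma Psi_Mi: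
  assumes X: "X \<in> C" shows "\<Psi> (M.Mi X) = M'.Mi (\<Psi> X)"
proof (rule eq_matI_pi[OF Psi_carrier M'.Mi_carrier[OF Psi_carrier]])
  fix a b assume ab: "a < M.k" "b < M.k"
  let ?a = "M.\<sigma> a" and ?b = "M.\<sigma> b"
  have s: "?a < M.k" "?b < M.k" using ab by (simp_all add: partner_less)
  define x where "x = X $$ (?b, ?a)"
  note U = c_gr_units[OF ab(1)] c_gr_units[OF ab(2)] c_gr_units[OF s(1)] c_gr_units[OF s(2)]
    psi_gr_units[OF M.beta_gr_units] M'.beta_gr_units
    u_gr_units inve(1)[OF c_gr_units[OF s(1)]]
  note U' = U phi_gr_units[OF U(3)] phi_gr_units[OF U(4)]
  have R: "u * \<psi> (M.\<beta> ?b) = \<phi> (c ?b) * M'.\<beta> (\<pi> ?b) * c b"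
    "u * \<psi> (M.\<beta> ?a) = \<phi> (c ?a) * M'.\<beta> (\<pi> ?a) * c a"
    using c_rel[OF s(2)] c_rel[OF s(1)] by (simp_all add: partner_partner)
  have Rb: "inve u * \<phi> (c ?b) * M'.\<beta> (\<pi> ?b) = \<psi> (M.\<beta> ?b) * inve (c b)"
  proof -
    have "inve u * \<phi> (c ?b) * M'.\<beta> (\<pi> ?b) = inve u * (\<phi> (c ?b) * M'.\<beta> (\<pi> ?b) * c b) * inve (c b)"
      by (simp add: mult.assoc inve[OF U(2)])
    also have "\<dots> = \<psi> (M.\<beta> ?b) * inve (c b)"
      unfolding R(1)[symmetric] by (simp add: inve_assoc[OF u_gr_units])
    finally show ?thesis .
  qed
  have Ra: "inve (M'.\<beta> (\<pi> ?a)) * inve (\<phi> (c ?a)) * u = c a * inve (\<psi> (M.\<beta> ?a))"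
  proof -
    have "inve (M'.\<beta> (\<pi> ?a)) * inve (\<phi> (c ?a)) * u
        = inve (M'.\<beta> (\<pi> ?a)) * inve (\<phi> (c ?a)) * (u * \<psi> (M.\<beta> ?a)) * inve (\<psi> (M.\<beta> ?a))"
      by (simp add: mult.assoc inve[OF U(5)])
    also have "\<dots> = c a * inve (\<psi> (M.\<beta> ?a))"
      unfolding R(2) by (simp add: mult.assoc inve_assoc U')
    finally show ?thesis .
  qed
  have "M'.Mi (\<Psi> X) $$ (\<pi> a, \<pi> b)
      = inve (M'.\<beta> (\<pi> ?a)) * \<phi> (\<Psi> X $$ (\<pi> ?b, \<pi> ?a)) * M'.\<beta> (\<pi> ?b)"
    using M'.Mi_entry[OF Psi_carrier pi_less[OF ab(1)] pi_less[OF ab(2)]] pi_sigma ab by simp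
  also have "\<phi> (\<Psi> X $$ (\<pi> ?b, \<pi> ?a)) = inve (\<phi> (c ?a)) * (u * \<psi> (\<phi> x) * inve u) * \<phi> (c ?b)"
    by (simp add: Psi_entry[OF s(2,1)] phi_mult twist phi_inve[OF U(3)] mult.assoc x_def)
  also have "inve (M'.\<beta> (\<pi> ?a)) * (inve (\<phi> (c ?a)) * (u * \<psi> (\<phi> x) * inve u) * \<phi> (c ?b)) * M'.\<beta> (\<pi> ?b)
      = (inve (M'.\<beta> (\<pi> ?a)) * inve (\<phi> (c ?a)) * u) * \<psi> (\<phi> x) * (inve u * \<phi> (c ?b) * M'.\<beta> (\<pi> ?b))"
    by (simp only: mult.assoc)
  also have "\<dots> = c a * \<psi> (inve (M.\<beta> ?a) * \<phi> x * M.\<beta> ?b) * inve (c b)"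
    unfolding Ra Rb by (simp add: psi_mult Aut_grading_inve[OF psi_Aut M.beta_gr_units] mult.assoc)
  also have "\<dots> = \<Psi> (M.Mi X) $$ (\<pi> a, \<pi> b)"
    by (simp only: Psi_entry[OF ab] M.Mi_entry[OF X ab] x_def)
  finally show "\<Psi> (M.Mi X) $$ (\<pi> a, \<pi> b) = M'.Mi (\<Psi> X) $$ (\<pi> a, \<pi> b)" by simp
qed

section \<open>The effect of the constructed map on degrees\<close>

definition \<tau> :: "'g \<Rightarrow> 'g" where
  "\<tau> t = (SOME v. v \<in> T \<and> \<psi> ` D t = D v)"

lemma tau:
  assumes "t \<in> T" shows "\<tau> t \<in> T" "\<psi> ` D t = D (\<tau> t)"
proof -
  have "\<psi> ` D t \<in> D ` T" using bij_betwE[OF psi_components] assms by blast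
  then have "\<exists>v. v \<in> T \<and> \<psi> ` D t = D v" by auto
  from someI_ex[OF this] show "\<tau> t \<in> T" "\<psi> ` D t = D (\<tau> t)" by (auto simp: \<tau>_def)
qed

lemma deg_psi: assumes "x \<in> U" shows "deg (\<psi> x) = \<tau> (deg x)"
proof (rule deg_eqI)
  show "\<tau> (deg x) \<in> carrier G" using tau(1) deg_mem(1) assms support_carrier by blast
  show "\<psi> x \<in> D (\<tau> (deg x))" using tau(2)[OF deg_mem(1)[OF assms]] deg_mem(2)[OF assms] by blast
  show "\<psi> x \<noteq> 0" using psi_gr_units[OF assms] gr_units_nonzero by blast
qed

text \<open>A permutation of the components need not respect degrees a priori; it does because a
  product of homogeneous units is a unit whose degree is the product of the degrees.\<close>

lemma tau_hom: "\<tau> \<in> hom TG TG"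
proof (rule homI)
  show "\<tau> t \<in> carrier TG" if "t \<in> carrier TG" for t using that tau(1) by simp
  fix t v assume "t \<in> carrier TG" "v \<in> carrier TG"
  then have tv: "t \<in> T" "v \<in> T" by simp_all
  obtain x where x: "x \<in> U" "deg x = t" using gr_units_obtain[OF tv(1)] by blast
  obtain y where y: "y \<in> U" "deg y = v" using gr_units_obtain[OF tv(2)] by blast
  have "deg (\<psi> (x * y)) = deg (\<psi> x) \<otimes> deg (\<psi> y)"
    unfolding psi_mult by (rule deg_mult) (simp_all add: psi_gr_units x y)
  then show "\<tau> (t \<otimes>\<^bsub>TG\<^esub> v) = \<tau> t \<otimes>\<^bsub>TG\<^esub> \<tau> v"
    using x y by (simp add: deg_psi gr_units_mult deg_mult)
qed

lemma tau_inj: "inj_on \<tau> T"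
proof (rule inj_onI)
  fix t v assume tv: "t \<in> T" "v \<in> T" "\<tau> t = \<tau> v"
  then have "\<psi> ` D t = \<psi> ` D v" using tau(2) by simp
  then have "D t = D v" using inj_image_eq_iff[OF bij_is_inj[OF psi_bij]] by simp
  moreover obtain x where "x \<in> U" "x \<in> D t" using gr_units_obtain[OF tv(1)] by blast
  ultimately show "t = v"
    using components_disjoint[OF support_carrier[OF tv(1)] support_carrier[OF tv(2)]] gr_units_nonzero
    by blast
qed

definition v :: "nat \<Rightarrow> 'g" where "v i = deg (c i)"

lemma v_T: "i < M.k \<Longrightarrow> v i \<in> T"
  using deg_mem(1)[OF c_gr_units] by (simp add: v_def)

text \<open>Taking degrees in \<open>c_rel\<close> gives the shift hypothesis with common factor
  \<open>deg u\<close>, since \<open>\<phi>\<close> preserves degrees.\<close>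

lemma ed_transfer:
  assumes "i < M.k" "j < M.k" "t \<in> T" "i' < M.k" "j' < M.k" "t' \<in> T"
  shows "M.ed i j t = M.ed i' j' t' \<longleftrightarrow>
    M'.ed (\<pi> i) (\<pi> j) (v i \<otimes> inv (v j) \<otimes> \<tau> t) = M'.ed (\<pi> i') (\<pi> j') (v i' \<otimes> inv (v j') \<otimes> \<tau> t')"
proof (rule entry_degree_transfer[OF M.M_algebra_data_axioms M'.M_algebra_data_axioms pi_bij pi_sigma
      v_T deg_mem(1)[OF u_gr_units] tau_hom tau_inj _ assms])
  fix i assume i: "i < M.k"
  have s: "M.\<sigma> i < M.k" using i by (simp add: partner_less)
  note U = u_gr_units psi_gr_units[OF M.beta_gr_units] c_gr_units[OF i] c_gr_units[OF s] M'.beta_gr_units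
  have "deg (u * \<psi> (M.\<beta> i)) = deg (\<phi> (c i) * M'.\<beta> (\<pi> i) * c (M.\<sigma> i))" using c_rel[OF i] by simp
  then show "deg u \<otimes> \<tau> (deg (M.\<beta> i)) = v i \<otimes> deg (M'.\<beta> (\<pi> i)) \<otimes> v (M.\<sigma> i)"
    using U by (simp add: deg_mult gr_units_mult phi_gr_units deg_phi deg_psi M.beta_gr_units v_def)
qed

text \<open>A nonzero entry of some matrix in the component names the target degree
  \<open>h\<close>. By \<open>ed_transfer\<close> every other entry has degree \<open>g\<close>
  exactly if its image has degree \<open>h\<close>, which gives both inclusions at once.\<close>

lemma Psi_component:
  assumes g: "M.Mc g \<noteq> {0\<^sub>m M.k M.k}"
  shows "\<exists>h \<in> carrier (G_tilde G D q s ds'). \<Psi> ` M.Mc g = M'.Mc h"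
proof -
  obtain X where X: "X \<in> M.Mc g" "X \<noteq> 0\<^sub>m M.k M.k" using g M.comp_zero[of g] by blast
  then have "X \<in> C" using M.comp_iff by blast
  then obtain i0 j0 where ij0: "i0 < M.k" "j0 < M.k" "X $$ (i0, j0) \<noteq> 0"
    using X(2) by (metis carrier_matD eq_matI index_zero_mat)
  define t0 where "t0 = deg (X $$ (i0, j0))"
  have t0: "t0 \<in> T" and gt0: "M.ed i0 j0 t0 = g"
    using M.comp_entry[OF X(1) ij0] deg_mem(1) by (auto simp: t0_def)
  define h where "h = M'.ed (\<pi> i0) (\<pi> j0) (v i0 \<otimes> inv (v j0) \<otimes> \<tau> t0)"
  have hc: "h \<in> carrier (G_tilde G D q s ds')"
    unfolding h_def by (intro M'.ed_carrier pi_less ij0 T_mult_closed T_inv_closed v_T tau(1) t0)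
  have entry: "(c i * \<psi> x * inve (c j) = 0 \<or> (c i * \<psi> x * inve (c j) \<in> U
        \<and> M'.ed (\<pi> i) (\<pi> j) (deg (c i * \<psi> x * inve (c j))) = h))
      \<longleftrightarrow> (x = 0 \<or> (x \<in> U \<and> M.ed i j (deg x) = g))" if ij: "i < M.k" "j < M.k" for i j x
  proof -
    note c = c_gr_units[OF ij(1)] c_gr_units[OF ij(2)]
    have z: "c i * \<psi> x * inve (c j) = 0 \<longleftrightarrow> x = 0"
      using Psi_entry_eq_iff[OF ij, of x 0] by (simp add: psi.zero)
    \<comment> \<open>The components are permuted, so an element with homogeneous image is itself
      homogeneous.\<close>
    have U: "x \<in> U" if "c i * \<psi> x * inve (c j) \<in> U"
    proof -
      have "inve (c i) * (c i * \<psi> x * inve (c j)) * c j \<in> U"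
        by (intro gr_units_mult inve c that)
      then have "\<psi> x \<in> U" by (simp add: mult.assoc inve_assoc c inve)
      then obtain t where t: "t \<in> T" "\<psi> x \<in> D t" "\<psi> x \<noteq> 0"
        using deg_mem gr_units_nonzero by blast
      have "D t \<in> (`) \<psi> ` (D ` T)" using psi_components t(1) by (simp add: bij_betw_def)
      then obtain r where r: "r \<in> T" "D t = \<psi> ` D r" by blast
      then have "x \<in> D r" using t(2) inj_image_mem_iff[OF bij_is_inj[OF psi_bij]] by metis
      moreover have "x \<noteq> 0" using t(3) psi_eq_0 by blast
      ultimately show ?thesis using gr_unitsI[OF support_carrier[OF r(1)]] by blast
    qed
    have "M'.ed (\<pi> i) (\<pi> j) (deg (c i * \<psi> x * inve (c j))) = h \<longleftrightarrow> M.ed i j (deg x) = g" if x: "x \<in> U"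
    proof -
      have "deg (c i * \<psi> x * inve (c j)) = v i \<otimes> \<tau> (deg x) \<otimes> inv (v j)"
        using c x by (simp add: deg_mult gr_units_mult psi_gr_units inve deg_inve deg_psi v_def)
      \<comment> \<open>Commutativity of the support brings the degree into the shape used in
        \<open>ed_transfer\<close>.\<close>
      also have "\<dots> = v i \<otimes> inv (v j) \<otimes> \<tau> (deg x)"
        using v_T[OF ij(1)] T_inv_closed[OF v_T[OF ij(2)]] tau(1)[OF deg_mem(1)[OF x]]
        by (simp add: m_assoc support_carrier support_comm[of "\<tau> (deg x)"])
      finally show ?thesis
        using ed_transfer[OF ij deg_mem(1)[OF x] ij0(1,2) t0] by (simp add: h_def gt0)
    qed
    moreover have "c i * \<psi> x * inve (c j) \<in> U" if "x \<in> U"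
      by (intro gr_units_mult inve c psi_gr_units that)
    ultimately show ?thesis using z U by blast
  qed
  have mem: "\<Psi> Y \<in> M'.Mc h \<longleftrightarrow> Y \<in> M.Mc g" if Y: "Y \<in> C" for Y
  proof -
    have "\<Psi> Y \<in> M'.Mc h \<longleftrightarrow> (\<forall>a<M.k. \<forall>b<M.k. \<Psi> Y $$ (a, b) = 0 \<or>
        (\<Psi> Y $$ (a, b) \<in> U \<and> M'.ed a b (deg (\<Psi> Y $$ (a, b))) = h))"
      using M'.comp_iff_deg Psi_carrier by simp
    also have "\<dots> \<longleftrightarrow> (\<forall>i<M.k. \<forall>j<M.k. \<Psi> Y $$ (\<pi> i, \<pi> j) = 0 \<or>
        (\<Psi> Y $$ (\<pi> i, \<pi> j) \<in> U \<and> M'.ed (\<pi> i) (\<pi> j) (deg (\<Psi> Y $$ (\<pi> i, \<pi> j))) = h))"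
      (is "(\<forall>a<_. \<forall>b<_. ?P a b) \<longleftrightarrow> _")
    proof
      assume "\<forall>a<M.k. \<forall>b<M.k. ?P a b"
      then show "\<forall>i<M.k. \<forall>j<M.k. ?P (\<pi> i) (\<pi> j)" using pi_less by blast
    next
      assume *: "\<forall>i<M.k. \<forall>j<M.k. ?P (\<pi> i) (\<pi> j)"
      show "\<forall>a<M.k. \<forall>b<M.k. ?P a b"
      proof (intro allI impI)
        fix a b assume ab: "a < M.k" "b < M.k"
        obtain i where i: "i < M.k" "a = \<pi> i" using pi_surj[OF ab(1)] .
        obtain j where j: "j < M.k" "b = \<pi> j" using pi_surj[OF ab(2)] .
        show "?P a b" unfolding i(2) j(2) using * i(1) j(1) by blast
      qed
    qed
    also have "\<dots> \<longleftrightarrow> (\<forall>i<M.k. \<forall>j<M.k. Y $$ (i, j) = 0 \<or>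
        (Y $$ (i, j) \<in> U \<and> M.ed i j (deg (Y $$ (i, j))) = g))"
      by (intro all_cong) (simp only: Psi_entry entry)
    also have "\<dots> \<longleftrightarrow> Y \<in> M.Mc g"
      using M.comp_iff_deg Y by simp
    finally show ?thesis .
  qed
  have "\<Psi> ` M.Mc g = M'.Mc h"
  proof
    show "\<Psi> ` M.Mc g \<subseteq> M'.Mc h" using mem M.comp_iff by blast
    show "M'.Mc h \<subseteq> \<Psi> ` M.Mc g"
    proof
      fix Z assume Z: "Z \<in> M'.Mc h"
      then have "Z \<in> C" using M'.comp_iff by blast
      then have "Z \<in> \<Psi> ` C" using Psi_bij by (simp add: bij_betw_def)
      then obtain Y where "Z = \<Psi> Y" "Y \<in> C" by (rule imageE)
      then show "Z \<in> \<Psi> ` M.Mc g" using mem Z by blast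
    qed
  qed
  then show ?thesis using hc by blast
qed

lemma equivalent_algebras:
  "equivalent (M_algebra scale G D \<phi> q s ds \<delta>) (M_algebra scale G D \<phi> q s ds' \<delta>')"
proof -
  have "equivalence (M_algebra scale G D \<phi> q s ds \<delta>) (M_algebra scale G D \<phi> q s ds' \<delta>') \<Psi>"
    unfolding equivalence_def M_algebra_def ring_iso_def Ring.ring_hom_def
    using Psi_carrier Psi_mult Psi_add Psi_one Psi_bij Psi_scale Psi_Mi Psi_component
    by simp
  then show ?thesis unfolding equivalent_def by blast
qed

end

section \<open>From matching multisets to the data of a twist\<close>

context M_algebra_data
begin

text \<open>Equality of multisets provides a permutation below \<open>q\<close>, extended by the
  identity to the blocks of size 2, and equality of orbits provides the \<open>a i\<close>.\<close>

lemma equivalent_if_Sigma_orbit_eq: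
  assumes M': "M_algebra_data scale G D \<phi> q s ds' \<delta>"
    and eq: "Sigma_orbit scale G D \<phi> ds = Sigma_orbit scale G D \<phi> ds'"
  shows "equivalent (M_algebra scale G D \<phi> q s ds \<delta>) (M_algebra scale G D \<phi> q s ds' \<delta>)"
proof -
  interpret M': M_algebra_data scale G D \<phi> q s ds' \<delta> by (rule M')
  obtain u \<psi> where A: "(u, \<psi>) \<in> carrier (A_plus scale G D \<phi>)"
    and \<Sigma>: "Sigma_tilde G D \<phi> ds' = image_mset (\<lambda>d. gr_orbit G D \<phi> (u * \<psi> d)) (mset ds)"
    using eq unfolding Sigma_orbit_eq_iff by blast
  have Au: "u \<in> U" "\<psi> \<in> Aut_grading scale G D" "\<phi> u = u" using A by (auto simp: A_plus_iff)
  interpret \<psi>: Vector_Spaces.linear scale scale \<psi> using Au(2) by (simp add: Aut_grading_iff)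
  have \<psi>1: "\<psi> 1 = 1" using Au(2) by (simp add: Aut_grading_iff)
  have "mset (map (\<lambda>d. gr_orbit G D \<phi> (u * \<psi> d)) ds) = mset (map (gr_orbit G D \<phi>) ds')"
    using \<Sigma> by (simp add: Sigma_tilde_def)
  then obtain p where p: "p permutes {..<length (map (gr_orbit G D \<phi>) ds')}"
    "permute_list p (map (gr_orbit G D \<phi>) ds') = map (\<lambda>d. gr_orbit G D \<phi> (u * \<psi> d)) ds"
    by (rule mset_eq_permutation)
  have pq: "p permutes {..<q}" using p(1) M'.ds_props(3) by simp
  have p_less: "p i < q" if "i < q" for i using permutes_in_image[OF pq, of i] that by simp
  have orb: "gr_orbit G D \<phi> (ds' ! p i) = gr_orbit G D \<phi> (u * \<psi> (ds ! i))" if i: "i < q" for i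
  proof -
    have "permute_list p (map (gr_orbit G D \<phi>) ds') ! i = map (gr_orbit G D \<phi>) ds' ! p i"
      by (rule permute_list_nth[OF p(1)]) (use i M'.ds_props(3) in simp)
    then show ?thesis
      unfolding p(2) using i p_less[OF i] ds_props(3) M'.ds_props(3) by simp
  qed
  have "\<exists>a. a \<in> U \<and> u * \<psi> (ds ! i) = a * ds' ! p i * \<phi> a" if i: "i < q" for i
  proof -
    have "u * \<psi> (ds ! i) \<in> gr_orbit G D \<phi> (u * \<psi> (ds ! i))"
      unfolding gr_orbit_def by (rule CollectI, rule exI[of _ 1]) (simp add: one_gr_units phi_one)
    then show ?thesis unfolding orb[OF i, symmetric] by (auto simp: gr_orbit_def)
  qed
  then obtain a where a: "\<And>i. i < q \<Longrightarrow> a i \<in> U"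
    "\<And>i. i < q \<Longrightarrow> u * \<psi> (ds ! i) = a i * ds' ! p i * \<phi> (a i)" by metis
  \<comment> \<open>The values solve \<open>c_rel\<close>. Below \<open>q\<close> this is the orbit
    relation with \<open>a i = \<phi> (c i)\<close>; on a block of size 2 the values 1 and
    \<open>u\<close> work at both indices because \<open>u\<close> is symmetric.\<close>
  define c where "c i = (if i < q then \<phi> (a i) else if even (i - q) then 1 else u)" for i
  have c_simps: "i < q \<Longrightarrow> c i = \<phi> (a i)" "c (q + 2 * j) = 1" "c (Suc (q + 2 * j)) = u" for i j
    by (simp_all add: c_def Suc_diff_le)
  have p_id: "\<not> i < q \<Longrightarrow> p i = i" for i using permutes_not_in[OF pq] by simp
  have "M_twist scale G D \<phi> q s ds \<delta> ds' \<delta> u \<psi> p c"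
  proof (unfold_locales)
    show "(u, \<psi>) \<in> carrier (A_plus scale G D \<phi>)" by (rule A)
    have "p permutes {..<k}" by (rule permutes_subset[OF pq]) auto
    then show "bij_betw p {..<k} {..<k}" by (rule permutes_imp_bij)
    show "p (partner q i) = partner q (p i)" if "i < k" for i
      by (cases i q rule: index_cases) (simp_all add: partner_simps p_id p_less)
    show "c i \<in> U" if "i < k" for i
      by (cases i q rule: index_cases) (simp_all add: c_simps phi_gr_units a(1) one_gr_units Au(1))
    show "u * \<psi> (\<beta> i) = \<phi> (c i) * M'.\<beta> (p i) * c (partner q i)" if "i < k" for i
      by (cases i q rule: index_cases)
        (simp_all add: beta_simps M'.beta_simps partner_simps p_id p_less c_simps a(2) phi_phi
          phi_one \<psi>1 \<psi>.scale Au(3) flip: scale_mult_left scale_mult_right)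
  qed
  then show ?thesis by (rule M_twist.equivalent_algebras)
qed

end

theorem corollary5p7:
  fixes scale :: "'f::field \<Rightarrow> 'd::ring_1 \<Rightarrow> 'd"
    and G :: "('g, 'm) monoid_scheme"
    and D :: "'g \<Rightarrow> 'd set"
    and \<phi>\<^sub>0 :: "'d \<Rightarrow> 'd"
    and q s q' s' :: nat
    and ds ds' :: "'d list"
    and \<delta> \<delta>' :: 'f
  assumes "graded_division_algebra scale G D"
    and "finite_dimensional scale"
    and "\<forall>t \<in> support G D. \<forall>u \<in> support G D. t \<otimes>\<^bsub>G\<^esub> u = u \<otimes>\<^bsub>G\<^esub> t"
    and "is_involution scale \<phi>\<^sub>0" and "degree_preserving G D \<phi>\<^sub>0"
    and "central_simple_inv scale \<phi>\<^sub>0"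
    and "M_data scale G D \<phi>\<^sub>0 q s ds \<delta>" and "(center :: 'd set) \<noteq> scalars scale \<longrightarrow> \<delta> = 1"
    and "M_data scale G D \<phi>\<^sub>0 q' s' ds' \<delta>'" and "(center :: 'd set) \<noteq> scalars scale \<longrightarrow> \<delta>' = 1"
  shows "equivalent (M_algebra scale G D \<phi>\<^sub>0 q s ds \<delta>) (M_algebra scale G D \<phi>\<^sub>0 q' s' ds' \<delta>')
    \<longleftrightarrow> q = q' \<and> s = s' \<and> \<delta> = \<delta>' \<and> Sigma_orbit scale G D \<phi>\<^sub>0 ds = Sigma_orbit scale G D \<phi>\<^sub>0 ds'"
proof -
  interpret graded_division_algebra scale G D by (rule assms(1))
  have inv: "graded_division_inv scale G D \<phi>\<^sub>0"
    by (intro graded_division_inv.intro assms(1) graded_division_inv_axioms.intro)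
      (use assms(3-5) in auto)
  then interpret graded_division_inv scale G D \<phi>\<^sub>0 .
  have M: "M_algebra_data scale G D \<phi>\<^sub>0 q s ds \<delta>"
    by (intro M_algebra_data.intro inv M_algebra_data_axioms.intro assms(7))
  have M': "M_algebra_data scale G D \<phi>\<^sub>0 q' s' ds' \<delta>'"
    by (intro M_algebra_data.intro inv M_algebra_data_axioms.intro assms(9))
  show ?thesis
  proof
    assume "equivalent (M_algebra scale G D \<phi>\<^sub>0 q s ds \<delta>) (M_algebra scale G D \<phi>\<^sub>0 q' s' ds' \<delta>')"
    then obtain \<psi> where "equivalence (M_algebra scale G D \<phi>\<^sub>0 q s ds \<delta>) (M_algebra scale G D \<phi>\<^sub>0 q' s' ds' \<delta>') \<psi>"
      by (auto simp: equivalent_def)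
    then interpret M_equivalence scale G D \<phi>\<^sub>0 q s ds \<delta> q' s' ds' \<delta>' \<psi>
      by (intro M_equivalence.intro inv M M' M_equivalence_axioms.intro)
    \<comment> \<open>Equality of the signs comes before that of the orbits, since it is what puts
      the twist into the acting group.\<close>
    have "\<delta> = \<delta>'" by (rule delta_eq[OF assms(6,2,8,10)])
    then show "q = q' \<and> s = s' \<and> \<delta> = \<delta>' \<and> Sigma_orbit scale G D \<phi>\<^sub>0 ds = Sigma_orbit scale G D \<phi>\<^sub>0 ds'"
      using q_eq s_eq Sigma_orbit_eq by blast
  next
    assume "q = q' \<and> s = s' \<and> \<delta> = \<delta>' \<and> Sigma_orbit scale G D \<phi>\<^sub>0 ds = Sigma_orbit scale G D \<phi>\<^sub>0 ds'"
    then show "equivalent (M_algebra scale G D \<phi>\<^sub>0 q s ds \<delta>) (M_algebra scale G D \<phi>\<^sub>0 q' s' ds' \<delta>')"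
      using M_algebra_data.equivalent_if_Sigma_orbit_eq[OF M] M' by blast
  qed
qed

end
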